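(* Let $R$ be an irreducible, reduced root system of rank $n$ with integer-valued inner product on $R$, with simple roots $\alpha_1,\dots,\alpha_n$. Define a product operation $\star$ on $QH_R$ by letting $1$ be the identity and defining $$\alpha_i\star\alpha_j=-t^2\epsilon_R\langle\alpha_i,\alpha_j\rangle+\sum_{\beta\in R^+}\langle\alpha_i,\beta\rangle\langle\alpha_j,\beta^\vee\rangle\,t\,\frac{1+q^\beta}{1-q^\beta}\,\beta .$$ Then the product is associative, and moreover it satisfies the Frobenius condition $$\langle x\star y,z\rangle=\langle x,y\star z\rangle ,$$ making $QH_R$ into a Frobenius algebra over the ring $\mathbb{Q}[t,t^{-1}][[q_1,\dots,q_n]]$.
   Context: **Root systems.** $R$ is a finite subset of an $n$-dimensional real inner product space $(V,\langle\,,\rangle)$ such that: $R$ spans $V$; if $\alpha\in R$ and $k\alpha\in R$ then $k=\pm1$; for every $\alpha\in R$ the reflection $s_\alpha$ in the hyperplane $\alpha^\perp$ preserves $R$; $\frac{2\langle\alpha,\beta\rangle}{\langle\alpha,\alpha\rangle}\in\mathbb{Z}$ for all $\alpha,\beta\in R$; and $V$ is irreducible as a representation of the Weyl group $W=\langle s_\alpha:\alpha\in R\rangle$. It is also assumed that $\langle\,,\rangle$ takes values in $\mathbb{Z}$ on $R$. A system of simple roots $\{\alpha_1,\dots,\alpha_n\}\subset R$ is fixed (spanning $V$, every root being an integer combination $\sum b_i\alpha_i$ with all $b_i\ge0$ or all $b_i\le0$); $R^+$ denotes the positive roots, and $\alpha^\vee=\frac{2\alpha}{\langle\alpha,\alpha\rangle}$.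 **The constant $\epsilon_R$.** If $\tilde\alpha=\sum_{i=1}^n n_i\alpha_i$ is the largest root, then $$\epsilon_R=\tfrac12\langle\tilde\alpha,\tilde\alpha\rangle+\tfrac12\sum_{i=1}^n n_i^2\langle\alpha_i,\alpha_i\rangle .$$ **The module $QH_R$.** $H_R=\mathbb{Z}\oplus\mathbb{Z}\alpha_1\oplus\cdots\oplus\mathbb{Z}\alpha_n$ and $QH_R=H_R\otimes\mathbb{Z}[t][[q_1,\dots,q_n]]$, the free $\mathbb{Z}[t][[q_1,\dots,q_n]]$-module with basis $1,\alpha_1,\dots,\alpha_n$. The pairing $\langle\,,\rangle$ is extended bilinearly to a $\mathbb{Q}[t,t^{-1}][[q_1,\dots,q_n]]$-valued pairing on $QH_R$ by making $1$ orthogonal to every $\alpha_i$ and setting $\langle1,1\rangle=\frac{-1}{t^2\epsilon_R}$. The product $\star$ is extended bilinearly over the coefficient ring. For $\beta=\sum b_i\alpha_i$, $q^\beta=\prod_i q_i^{b_i}$, and $\frac{1+q^\beta}{1-q^\beta}$ (for $\beta\in R^+$) is expanded as a power series in the $q_i$. The Frobenius algebra statement over $\mathbb{Q}[t,t^{-1}][[q_1,\dots,q_n]]$ is after extension of scalars to this ring. *)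

theory Defs
  imports "HOL-Analysis.Analysis" "HOL-Library.Function_Algebras" "HOL-Library.Poly_Mapping"
    "HOL-Computational_Algebra.Polynomial"
begin

section \<open>Formal power series in the variables indexed by a finite type\<close>

text \<open>Monomials are exponent vectors \<^typ>\<open>'n \<Rightarrow> nat\<close>, added pointwise.\<close>

typedef ('n, 'c) mfps = "UNIV :: (('n \<Rightarrow> nat) \<Rightarrow> 'c) set"
  morphisms mfps_nth Abs_mfps ..

setup_lifting type_definition_mfps

lemma mfps_eqI: "(\<And>m. mfps_nth f m = mfps_nth g m) \<Longrightarrow> f = g"
  by (metis ext mfps_nth_inject)

definition splits :: "('n \<Rightarrow> nat) \<Rightarrow> (('n \<Rightarrow> nat) \<times> ('n \<Rightarrow> nat)) set" where
  "splits m = {(a, b). a + b = m}"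

lemma finite_splits [simp, intro]: "finite (splits (m :: 'n :: finite \<Rightarrow> nat))"
proof -
  let ?L = "{a :: 'n \<Rightarrow> nat. \<forall>i. a i \<le> m i}"
  have "?L = Pi\<^sub>E UNIV (\<lambda>i. {..m i})" by (auto simp: PiE_def Pi_def)
  then have "finite ?L" by (simp add: finite_PiE)
  then have "finite (?L \<times> ?L)" by simp
  moreover have "splits m \<subseteq> ?L \<times> ?L" by (auto simp: splits_def)
  ultimately show ?thesis by (rule rev_finite_subset)
qed

instantiation mfps :: (finite, comm_ring_1) comm_ring_1
begin

lift_definition zero_mfps :: "('a, 'b) mfps" is "\<lambda>_. 0" .
lift_definition one_mfps :: "('a, 'b) mfps" is "\<lambda>m. if m = 0 then 1 else 0" .
lift_definition plus_mfps :: "('a, 'b) mfps \<Rightarrow> ('a, 'b) mfps \<Rightarrow> ('a, 'b) mfps"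
  is "\<lambda>f g m. f m + g m" .
lift_definition minus_mfps :: "('a, 'b) mfps \<Rightarrow> ('a, 'b) mfps \<Rightarrow> ('a, 'b) mfps"
  is "\<lambda>f g m. f m - g m" .
lift_definition uminus_mfps :: "('a, 'b) mfps \<Rightarrow> ('a, 'b) mfps" is "\<lambda>f m. - f m" .
lift_definition times_mfps :: "('a, 'b) mfps \<Rightarrow> ('a, 'b) mfps \<Rightarrow> ('a, 'b) mfps"
  is "\<lambda>f g m. \<Sum>(a, b)\<in>splits m. f a * g b" .

instance
proof
  fix f g h :: "('a, 'b) mfps"
  show "f + g + h = f + (g + h)" by transfer (simp add: add.assoc)
  show "f + g = g + f" by transfer (simp add: add.commute)
  show "0 + f = f" by transfer simp
  show "- f + f = 0" by transfer simp
  show "f - g = f + - g" by transfer simp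
  show "(f + g) * h = f * h + g * h"
    by transfer (simp add: distrib_right case_prod_unfold sum.distrib)
  show "(0 :: ('a, 'b) mfps) \<noteq> 1" by transfer (metis zero_neq_one)
  show "f * g = g * f"
  proof transfer
    fix f g :: "('a \<Rightarrow> nat) \<Rightarrow> 'b"
    show "(\<lambda>m. \<Sum>(a, b)\<in>splits m. f a * g b) = (\<lambda>m. \<Sum>(a, b)\<in>splits m. g a * f b)"
    proof
      fix m :: "'a \<Rightarrow> nat"
      show "(\<Sum>(a, b)\<in>splits m. f a * g b) = (\<Sum>(a, b)\<in>splits m. g a * f b)"
        by (rule sum.reindex_bij_witness[of _ prod.swap prod.swap])
           (auto simp: splits_def add.commute mult.commute)
    qed
  qed
  show "1 * f = f"
  proof transfer
    fix f :: "('a \<Rightarrow> nat) \<Rightarrow> 'b"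
    show "(\<lambda>m. \<Sum>(a, b)\<in>splits m. (if a = 0 then 1 else 0) * f b) = f"
    proof
      fix m :: "'a \<Rightarrow> nat"
      have "(\<Sum>(a, b)\<in>splits m. (if a = 0 then 1 else 0) * f b)
          = (\<Sum>(a, b)\<in>{(0 :: 'a \<Rightarrow> nat, m)}. (if a = 0 then 1 else 0) * f b)"
      proof (rule sum.mono_neutral_right)
        show "{(0 :: 'a \<Rightarrow> nat, m)} \<subseteq> splits m" by (simp add: splits_def)
        show "\<forall>p\<in>splits m - {(0 :: 'a \<Rightarrow> nat, m)}.
            (case p of (a, b) \<Rightarrow> (if a = 0 then 1 else 0) * f b) = 0"
          by (auto simp: splits_def split: if_splits)
      qed simp
      then show "(\<Sum>(a, b)\<in>splits m. (if a = 0 then 1 else 0) * f b) = f m" by simp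
    qed
  qed
  show "f * g * h = f * (g * h)"
  proof transfer
    fix f g h :: "('a \<Rightarrow> nat) \<Rightarrow> 'b"
    show "(\<lambda>m. \<Sum>(a, b)\<in>splits m. (\<Sum>(c, d)\<in>splits a. f c * g d) * h b) =
          (\<lambda>m. \<Sum>(a, b)\<in>splits m. f a * (\<Sum>(c, d)\<in>splits b. g c * h d))"
    proof
      fix m :: "'a \<Rightarrow> nat"
      have "(\<Sum>(a, b)\<in>splits m. (\<Sum>(c, d)\<in>splits a. f c * g d) * h b)
          = (\<Sum>(p, q)\<in>(SIGMA p:splits m. splits (fst p)). f (fst q) * g (snd q) * h (snd p))"
        by (subst sum.Sigma[symmetric]) (auto simp: case_prod_unfold sum_distrib_right)
      also have "\<dots> = (\<Sum>(p, q)\<in>(SIGMA p:splits m. splits (snd p)). f (fst p) * g (fst q) * h (snd q))"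
        by (rule sum.reindex_bij_witness
              [of _ "\<lambda>(p, q). ((fst p + fst q, snd q), (fst p, fst q))"
                    "\<lambda>(p, q). ((fst q, snd q + snd p), (snd q, snd p))"])
           (auto simp: splits_def add.assoc)
      also have "\<dots> = (\<Sum>(a, b)\<in>splits m. f a * (\<Sum>(c, d)\<in>splits b. g c * h d))"
        by (subst sum.Sigma[symmetric]) (auto simp: case_prod_unfold sum_distrib_left mult.assoc)
      finally show "(\<Sum>(a, b)\<in>splits m. (\<Sum>(c, d)\<in>splits a. f c * g d) * h b)
        = (\<Sum>(a, b)\<in>splits m. f a * (\<Sum>(c, d)\<in>splits b. g c * h d))" .
    qed
  qed
qed

end

lift_definition mfps_const :: "'c :: zero \<Rightarrow> ('n, 'c) mfps"
  is "\<lambda>c m. if m = 0 then c else 0" .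

lift_definition mfps_monom :: "('n \<Rightarrow> nat) \<Rightarrow> ('n, 'c :: zero_neq_one) mfps"
  is "\<lambda>k m. if m = k then 1 else 0" .

lift_definition mfps_map :: "('c \<Rightarrow> 'd) \<Rightarrow> ('n, 'c) mfps \<Rightarrow> ('n, 'd) mfps"
  is "\<lambda>h f m. h (f m)" .

text \<open>
  The expansion \<open>1 + 2q\<^sup>k + 2q\<^sup>2\<^sup>k + \<dots>\<close> of \<open>(1 + q\<^sup>k) / (1 - q\<^sup>k)\<close>; lemma \<open>qfrac_mult\<close> below
  confirms that it is this quotient for \<open>k \<noteq> 0\<close>.
\<close>

lift_definition qfrac :: "('n \<Rightarrow> nat) \<Rightarrow> ('n, 'c :: comm_ring_1) mfps"
  is "\<lambda>k m. if m = 0 then 1 else if \<exists>r :: nat. m = (\<lambda>i. r * k i) then 2 else 0" .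

lemma mfps_monom_times_nth:
  fixes f :: "('n :: finite, 'c :: comm_ring_1) mfps"
  shows "mfps_nth (f * mfps_monom k) m = (if k \<le> m then mfps_nth f (m - k) else 0)"
proof -
  have eq: "mfps_nth (f * mfps_monom k) m
      = (\<Sum>(a, b)\<in>splits m. mfps_nth f a * (if b = k then 1 else 0))"
    by (simp add: times_mfps.rep_eq mfps_monom.rep_eq)
  show ?thesis
  proof (cases "k \<le> m")
    case True
    then have mk: "m - k + k = m" by (auto simp: le_fun_def fun_eq_iff)
    have "(\<Sum>(a, b)\<in>splits m. mfps_nth f a * (if b = k then 1 else 0))
        = (\<Sum>(a, b)\<in>{(m - k, k)}. mfps_nth f a * (if b = k then 1 else 0))"
    proof (rule sum.mono_neutral_right)
      show "{(m - k, k)} \<subseteq> splits m" using mk by (simp add: splits_def)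
      show "\<forall>p\<in>splits m - {(m - k, k)}.
          (case p of (a, b) \<Rightarrow> mfps_nth f a * (if b = k then 1 else 0)) = 0"
        by (auto simp: splits_def split: if_splits)
    qed simp
    then show ?thesis using eq True by simp
  next
    case False
    have "(\<Sum>(a, b)\<in>splits m. mfps_nth f a * (if b = k then 1 else 0)) = 0"
      using False by (intro sum.neutral) (auto simp: splits_def le_fun_def)
    then show ?thesis using eq False by simp
  qed
qed

lemma qfrac_mult:
  assumes "k \<noteq> 0"
  shows "(qfrac k :: ('n :: finite, 'c :: comm_ring_1) mfps) * (1 - mfps_monom k) = 1 + mfps_monom k"
proof (rule mfps_eqI)
  fix m :: "'n \<Rightarrow> nat"
  obtain j where j: "k j \<noteq> 0" using assms by (auto simp: fun_eq_iff)
  define Q where "Q = mfps_nth (qfrac k :: ('n, 'c) mfps)"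
  have Q: "Q m = (if m = 0 then 1 else if \<exists>r :: nat. m = (\<lambda>i. r * k i) then 2 else 0)" for m
    by (simp add: Q_def qfrac.rep_eq)
  have L: "mfps_nth ((qfrac k :: ('n, 'c) mfps) * (1 - mfps_monom k)) m
      = Q m - (if k \<le> m then Q (m - k) else 0)"
    by (simp add: right_diff_distrib minus_mfps.rep_eq mfps_monom_times_nth Q_def)
  have R: "mfps_nth ((1 :: ('n, 'c) mfps) + mfps_monom k) m
      = (if m = 0 then 1 else 0) + (if m = k then 1 else 0)"
    by (simp add: plus_mfps.rep_eq one_mfps.rep_eq mfps_monom.rep_eq)
  have "Q m - (if k \<le> m then Q (m - k) else 0) = (if m = 0 then 1 else 0) + (if m = k then 1 else 0)"
  proof (cases "k \<le> m")
    case False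
    then have "m \<noteq> k" by auto
    moreover have "Q m = (if m = 0 then 1 else 0)"
    proof -
      have False if "m = (\<lambda>i. r * k i)" "m \<noteq> 0" for r
        using that False by (cases r) (auto simp: le_fun_def fun_eq_iff)
      then show ?thesis by (auto simp: Q)
    qed
    ultimately show ?thesis using False by auto
  next
    case True
    then have "k j \<le> m j" by (simp add: le_fun_def)
    then have m0: "m \<noteq> 0" using j by auto
    have mk: "m - k = 0 \<longleftrightarrow> m = k" using True by (auto simp: le_fun_def fun_eq_iff intro: antisym)
    have ex: "(\<exists>r :: nat. m - k = (\<lambda>i. r * k i)) \<longleftrightarrow> (\<exists>r :: nat. m = (\<lambda>i. r * k i))"
    proof
      assume "\<exists>r :: nat. m - k = (\<lambda>i. r * k i)"
      then obtain r where r: "m - k = (\<lambda>i. r * k i)" by blast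
      have "m = (\<lambda>i. Suc r * k i)"
      proof
        fix i show "m i = Suc r * k i" using fun_cong[OF r, of i] True
          by (auto simp: le_fun_def dest!: spec[of _ i])
      qed
      then show "\<exists>r :: nat. m = (\<lambda>i. r * k i)" by blast
    next
      assume "\<exists>r :: nat. m = (\<lambda>i. r * k i)"
      then obtain r where r: "m = (\<lambda>i. r * k i)" by blast
      then have "m - k = (\<lambda>i. (r - 1) * k i)" by (auto simp: fun_eq_iff diff_mult_distrib)
      then show "\<exists>r :: nat. m - k = (\<lambda>i. r * k i)" by blast
    qed
    have k1: "\<exists>r :: nat. k = (\<lambda>i. r * k i)" by (rule exI[of _ 1]) simp
    show ?thesis using True m0 mk ex k1 assms by (auto simp: Q)
  qed
  then show "mfps_nth ((qfrac k :: ('n, 'c) mfps) * (1 - mfps_monom k)) m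
      = mfps_nth (1 + mfps_monom k) m" using L R by simp
qed


section \<open>Irreducible root systems and simple roots\<close>

definition reflection :: "'a :: real_inner \<Rightarrow> 'a \<Rightarrow> 'a" where
  "reflection \<alpha> v = v - (2 * (\<alpha> \<bullet> v) / (\<alpha> \<bullet> \<alpha>)) *\<^sub>R \<alpha>"

text \<open>Reflections are involutions, so closing under composition already yields a group.\<close>

inductive_set weyl_group :: "'a :: real_inner set \<Rightarrow> ('a \<Rightarrow> 'a) set" for R where
  "id \<in> weyl_group R"
| "\<alpha> \<in> R \<Longrightarrow> w \<in> weyl_group R \<Longrightarrow> reflection \<alpha> \<circ> w \<in> weyl_group R"

text \<open>
  The scaling condition forces \<open>0 \<notin> R\<close>. The ambient space has positive dimension, so the
  irreducible representation is nonzero.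
\<close>

definition irreducible_root_system :: "'a :: euclidean_space set \<Rightarrow> bool" where
  "irreducible_root_system R \<longleftrightarrow>
     finite R \<and> span R = UNIV \<and>
     (\<forall>\<alpha>\<in>R. \<forall>k :: real. k *\<^sub>R \<alpha> \<in> R \<longrightarrow> k = 1 \<or> k = - 1) \<and>
     (\<forall>\<alpha>\<in>R. reflection \<alpha> ` R = R) \<and>
     (\<forall>\<alpha>\<in>R. \<forall>\<beta>\<in>R. 2 * (\<alpha> \<bullet> \<beta>) / (\<alpha> \<bullet> \<alpha>) \<in> \<int>) \<and>
     (\<forall>U. subspace U \<and> (\<forall>w\<in>weyl_group R. w ` U \<subseteq> U) \<longrightarrow> U = {0} \<or> U = UNIV)"

definition integral_inner_on :: "'a :: euclidean_space set \<Rightarrow> bool" where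
  "integral_inner_on R \<longleftrightarrow> (\<forall>\<alpha>\<in>R. \<forall>\<beta>\<in>R. \<alpha> \<bullet> \<beta> \<in> \<int>)"

definition int_comb :: "('n :: finite \<Rightarrow> 'a :: euclidean_space) \<Rightarrow> ('n \<Rightarrow> int) \<Rightarrow> 'a" where
  "int_comb \<alpha> b = (\<Sum>i\<in>UNIV. real_of_int (b i) *\<^sub>R \<alpha> i)"

definition simple_roots :: "'a :: euclidean_space set \<Rightarrow> ('n :: finite \<Rightarrow> 'a) \<Rightarrow> bool" where
  "simple_roots R \<alpha> \<longleftrightarrow>
     range \<alpha> \<subseteq> R \<and> CARD('n) = DIM('a) \<and> span (range \<alpha>) = UNIV \<and>
     (\<forall>\<beta>\<in>R. \<exists>b. \<beta> = int_comb \<alpha> b \<and> ((\<forall>i. b i \<ge> 0) \<or> (\<forall>i. b i \<le> 0)))"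

definition positive_roots :: "'a :: euclidean_space set \<Rightarrow> ('n :: finite \<Rightarrow> 'a) \<Rightarrow> 'a set" where
  "positive_roots R \<alpha> = {\<beta>\<in>R. \<exists>b. \<beta> = int_comb \<alpha> b \<and> (\<forall>i. b i \<ge> 0)}"

definition root_coords :: "('n :: finite \<Rightarrow> 'a :: euclidean_space) \<Rightarrow> 'a \<Rightarrow> 'n \<Rightarrow> int" where
  "root_coords \<alpha> \<beta> = (THE b. \<beta> = int_comb \<alpha> b)"

definition coroot :: "'a :: real_inner \<Rightarrow> 'a" where
  "coroot \<alpha> = (2 / (\<alpha> \<bullet> \<alpha>)) *\<^sub>R \<alpha>"

text \<open>The largest root is the greatest one for the order whose positive cone is spanned by \<open>\<alpha>\<close>.\<close>

definition is_largest_root ::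
    "'a :: euclidean_space set \<Rightarrow> ('n :: finite \<Rightarrow> 'a) \<Rightarrow> 'a \<Rightarrow> bool" where
  "is_largest_root R \<alpha> \<theta> \<longleftrightarrow>
     \<theta> \<in> R \<and> (\<forall>\<beta>\<in>R. \<exists>b. \<theta> - \<beta> = int_comb \<alpha> b \<and> (\<forall>i. b i \<ge> 0))"

definition largest_root :: "'a :: euclidean_space set \<Rightarrow> ('n :: finite \<Rightarrow> 'a) \<Rightarrow> 'a" where
  "largest_root R \<alpha> = (THE \<theta>. is_largest_root R \<alpha> \<theta>)"

definition eps :: "'a :: euclidean_space set \<Rightarrow> ('n :: finite \<Rightarrow> 'a) \<Rightarrow> real" where
  "eps R \<alpha> = (largest_root R \<alpha> \<bullet> largest_root R \<alpha>) / 2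
     + (\<Sum>i\<in>UNIV. (real_of_int (root_coords \<alpha> (largest_root R \<alpha>) i))\<^sup>2 * (\<alpha> i \<bullet> \<alpha> i)) / 2"


section \<open>Integrality of the structure constants\<close>

lemma simple_roots_independent:
  assumes "simple_roots R (\<alpha> :: 'n :: finite \<Rightarrow> 'a :: euclidean_space)"
  shows "inj \<alpha>" "independent (range \<alpha>)"
proof -
  have s: "span (range \<alpha>) = UNIV" and c: "CARD('n) = DIM('a)"
    using assms by (auto simp: simple_roots_def)
  have "DIM('a) \<le> card (range \<alpha>)"
    using dim_le_card'[of "range \<alpha>"] s by (metis dim_UNIV dim_span finite finite_imageI)
  then have k: "card (range \<alpha>) = CARD('n)" using c card_image_le[of UNIV \<alpha>] by simp
  then show "inj \<alpha>" by (simp add: eq_card_imp_inj_on)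
  show "independent (range \<alpha>)"
    using s k c by (intro card_le_dim_spanning[of _ UNIV]) auto
qed

lemma int_comb_inject:
  assumes "simple_roots R \<alpha>"
  shows "int_comb \<alpha> b = int_comb \<alpha> c \<longleftrightarrow> b = c"
proof
  assume "int_comb \<alpha> b = int_comb \<alpha> c"
  then have "(\<Sum>i\<in>UNIV. real_of_int (b i - c i) *\<^sub>R \<alpha> i) = 0"
    by (simp add: int_comb_def algebra_simps sum_subtractf)
  moreover have "(\<Sum>v\<in>range \<alpha>. real_of_int (b (inv \<alpha> v) - c (inv \<alpha> v)) *\<^sub>R v)
      = (\<Sum>i\<in>UNIV. real_of_int (b i - c i) *\<^sub>R \<alpha> i)"
    using simple_roots_independent(1)[OF assms] by (subst sum.reindex) auto
  ultimately have z: "(\<Sum>v\<in>range \<alpha>. real_of_int (b (inv \<alpha> v) - c (inv \<alpha> v)) *\<^sub>R v) = 0" by simp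
  have "real_of_int (b i - c i) = 0" for i
  proof -
    have "\<forall>v\<in>range \<alpha>. real_of_int (b (inv \<alpha> v) - c (inv \<alpha> v)) = 0"
    proof -
      have "\<forall>c. (\<Sum>v\<in>range \<alpha>. c v *\<^sub>R v) = 0 \<longrightarrow> (\<forall>v\<in>range \<alpha>. c v = 0)"
        using simple_roots_independent(2)[OF assms] unfolding independent_explicit by blast
      then show ?thesis
        using z by (elim allE[of _ "\<lambda>v. real_of_int (b (inv \<alpha> v) - c (inv \<alpha> v))"]) blast
    qed
    then show ?thesis using simple_roots_independent(1)[OF assms] by auto
  qed
  then show "b = c" by auto
qed simp

lemma root_coords_int_comb:
  assumes "simple_roots R \<alpha>" "\<beta> \<in> R"
  shows "int_comb \<alpha> (root_coords \<alpha> \<beta>) = \<beta>"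
proof -
  obtain b where b: "\<beta> = int_comb \<alpha> b" using assms by (auto simp: simple_roots_def)
  then have "root_coords \<alpha> \<beta> = b"
    unfolding root_coords_def using int_comb_inject[OF assms(1)] by (intro the_equality) auto
  then show ?thesis using b by simp
qed

lemma int_comb_uminus: "int_comb \<alpha> (\<lambda>i. - b i) = - int_comb \<alpha> b"
  by (simp add: int_comb_def sum_negf)

lemma largest_root_eqI:
  assumes "simple_roots R \<alpha>" "is_largest_root R \<alpha> \<theta>"
  shows "largest_root R \<alpha> = \<theta>"
  unfolding largest_root_def
proof (rule the_equality)
  fix \<eta> assume eta: "is_largest_root R \<alpha> \<eta>"
  obtain b where b: "\<theta> - \<eta> = int_comb \<alpha> b" "\<forall>i. b i \<ge> 0"
    using eta assms(2) by (auto simp: is_largest_root_def)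
  obtain c where c: "\<eta> - \<theta> = int_comb \<alpha> c" "\<forall>i. c i \<ge> 0"
    using eta assms(2) by (auto simp: is_largest_root_def)
  have "int_comb \<alpha> b = int_comb \<alpha> (\<lambda>i. - c i)"
    using b(1) c(1) by (metis int_comb_uminus minus_diff_eq)
  then have "b = (\<lambda>i. - c i)" using int_comb_inject[OF assms(1)] by blast
  then have "b = (\<lambda>_. 0)" using b(2) c(2) by (auto simp: fun_eq_iff order_antisym)
  then show "\<eta> = \<theta>" using b(1) by (simp add: int_comb_def)
qed (fact assms(2))

lemma eps_in_Ints:
  assumes "simple_roots R \<alpha>" "integral_inner_on R" "is_largest_root R \<alpha> \<theta>"
  shows "eps R \<alpha> \<in> \<int>"
proof -
  define n where "n i = real_of_int (root_coords \<alpha> \<theta> i)" for i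
  define s where "s A = (\<Sum>i\<in>A. n i *\<^sub>R \<alpha> i)" for A
  have "\<theta> \<in> R" using assms(3) by (simp add: is_largest_root_def)
  from root_coords_int_comb[OF assms(1) this]
  have th: "\<theta> = s UNIV" by (simp add: s_def n_def int_comb_def)
  have ip: "\<alpha> i \<bullet> \<alpha> j \<in> \<int>" for i j
    using assms(1,2) unfolding simple_roots_def integral_inner_on_def by (meson range_subsetD)
  have "(s A \<bullet> s A) / 2 + (\<Sum>i\<in>A. (n i)\<^sup>2 * (\<alpha> i \<bullet> \<alpha> i)) / 2 \<in> \<int>" if "finite A" for A
    using that
  proof induction
    case empty
    then show ?case by (simp add: s_def)
  next
    case (insert x A)
    have sx: "s (insert x A) = n x *\<^sub>R \<alpha> x + s A" using insert by (simp add: s_def)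
    have sx2: "s (insert x A) \<bullet> s (insert x A)
        = (n x)\<^sup>2 * (\<alpha> x \<bullet> \<alpha> x) + 2 * (n x * (\<alpha> x \<bullet> s A)) + s A \<bullet> s A"
      by (simp add: sx inner_add_left inner_add_right power2_eq_square inner_commute[of "s A" "\<alpha> x"]
          distrib_left mult.assoc)
    have "\<alpha> x \<bullet> s A \<in> \<int>" unfolding s_def inner_sum_right
      by (intro Ints_sum) (simp add: n_def ip)
    then have "(n x)\<^sup>2 * (\<alpha> x \<bullet> \<alpha> x) + n x * (\<alpha> x \<bullet> s A) \<in> \<int>"
      by (simp add: n_def ip)
    moreover have "(s (insert x A) \<bullet> s (insert x A)) / 2
        + (\<Sum>i\<in>insert x A. (n i)\<^sup>2 * (\<alpha> i \<bullet> \<alpha> i)) / 2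
      = (n x)\<^sup>2 * (\<alpha> x \<bullet> \<alpha> x) + n x * (\<alpha> x \<bullet> s A)
        + ((s A \<bullet> s A) / 2 + (\<Sum>i\<in>A. (n i)\<^sup>2 * (\<alpha> i \<bullet> \<alpha> i)) / 2)"
      using insert(1,2)
      by (simp add: sx2 add_divide_distrib distrib_left)
    ultimately show ?case using insert.IH by (simp only: Ints_add)
  qed
  from this[of UNIV] show ?thesis
    using largest_root_eqI[OF assms(1,3)] by (simp add: eps_def th[symmetric] n_def)
qed

lemma structure_constant_in_Ints:
  assumes "irreducible_root_system R" "integral_inner_on R" "\<alpha> \<in> R" "\<alpha>' \<in> R" "\<beta> \<in> R"
  shows "(\<alpha> \<bullet> \<beta>) * (\<alpha>' \<bullet> coroot \<beta>) \<in> \<int>"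
proof -
  have "2 * (\<beta> \<bullet> \<alpha>') / (\<beta> \<bullet> \<beta>) \<in> \<int>" "\<alpha> \<bullet> \<beta> \<in> \<int>"
    using assms by (auto simp: irreducible_root_system_def integral_inner_on_def)
  from Ints_mult[OF this(2,1)] show ?thesis by (simp add: coroot_def inner_commute)
qed


section \<open>The module and its product\<close>

text \<open>
  Elements of the module are coordinate vectors indexed by \<^typ>\<open>'n option\<close>: \<^const>\<open>None\<close> stands for
  the basis element \<open>1\<close> and \<^term>\<open>Some i\<close> for the simple root \<open>\<alpha>\<^sub>i\<close>. Laurent polynomials
  \<open>\<rat>[t, t\<^sup>-\<^sup>1]\<close> are finitely supported functions \<^typ>\<open>int \<Rightarrow>\<^sub>0 rat\<close> with the convolution product.
\<close>

type_synonym 'n Zcoeff = "('n, int poly) mfps"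
type_synonym 'n Qcoeff = "('n, int \<Rightarrow>\<^sub>0 rat) mfps"
type_synonym 'n QH = "('n Zcoeff, 'n option) vec"
type_synonym 'n QH_ext = "('n Qcoeff, 'n option) vec"

definition laurent_of_poly :: "int poly \<Rightarrow> int \<Rightarrow>\<^sub>0 rat" where
  "laurent_of_poly p =
     (\<Sum>k\<le>degree p. Poly_Mapping.single (int k) (rat_of_int (poly.coeff p k)))"

definition extend_scalars :: "'n Zcoeff \<Rightarrow> 'n Qcoeff" where
  "extend_scalars = mfps_map laurent_of_poly"

definition extend_QH :: "('n :: finite) QH \<Rightarrow> 'n QH_ext" where
  "extend_QH x = (\<chi> a. extend_scalars (x $ a))"

definition unit_vec :: "('c :: zero_neq_one, 'n :: finite option) vec" where
  "unit_vec = axis None 1"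

definition tt :: "('n :: finite) Zcoeff" where
  "tt = mfps_const [:0, 1:]"

definition root_vec :: "('n :: finite \<Rightarrow> 'a :: euclidean_space) \<Rightarrow> 'a \<Rightarrow> 'n QH" where
  "root_vec \<alpha> \<beta> = (\<Sum>i\<in>UNIV. of_int (root_coords \<alpha> \<beta> i) *s axis (Some i) 1)"

definition root_qfrac :: "('n :: finite \<Rightarrow> 'a :: euclidean_space) \<Rightarrow> 'a \<Rightarrow> 'n Zcoeff" where
  "root_qfrac \<alpha> \<beta> = qfrac (\<lambda>i. nat (root_coords \<alpha> \<beta> i))"

text \<open>
  The floors below only convert reals that are integers, see \<open>eps_in_Ints\<close> and
  \<open>structure_constant_in_Ints\<close>.
\<close>

fun star_basis ::
    "'a :: euclidean_space set \<Rightarrow> ('n :: finite \<Rightarrow> 'a) \<Rightarrow> 'n option \<Rightarrow> 'n option \<Rightarrow> 'n QH" where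
  "star_basis R \<alpha> None b = axis b 1"
| "star_basis R \<alpha> (Some i) None = axis (Some i) 1"
| "star_basis R \<alpha> (Some i) (Some j) =
     (- (tt\<^sup>2 * of_int \<lfloor>eps R \<alpha>\<rfloor> * of_int \<lfloor>\<alpha> i \<bullet> \<alpha> j\<rfloor>)) *s unit_vec
     + (\<Sum>\<beta>\<in>positive_roots R \<alpha>.
          (of_int \<lfloor>(\<alpha> i \<bullet> \<beta>) * (\<alpha> j \<bullet> coroot \<beta>)\<rfloor> * tt * root_qfrac \<alpha> \<beta>) *s root_vec \<alpha> \<beta>)"

definition bilinear_extension ::
    "('b :: finite \<Rightarrow> 'b \<Rightarrow> ('c :: comm_ring_1, 'b) vec) \<Rightarrow> ('c, 'b) vec \<Rightarrow> ('c, 'b) vec \<Rightarrow> ('c, 'b) vec"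
  where "bilinear_extension m x y = (\<Sum>a\<in>UNIV. \<Sum>b\<in>UNIV. (x $ a * y $ b) *s m a b)"

definition star ::
    "'a :: euclidean_space set \<Rightarrow> ('n :: finite \<Rightarrow> 'a) \<Rightarrow> 'n QH \<Rightarrow> 'n QH \<Rightarrow> 'n QH" where
  "star R \<alpha> = bilinear_extension (star_basis R \<alpha>)"

definition star_ext ::
    "'a :: euclidean_space set \<Rightarrow> ('n :: finite \<Rightarrow> 'a) \<Rightarrow> 'n QH_ext \<Rightarrow> 'n QH_ext \<Rightarrow> 'n QH_ext" where
  "star_ext R \<alpha> = bilinear_extension (\<lambda>a b. extend_QH (star_basis R \<alpha> a b))"

fun pairing_basis ::
    "'a :: euclidean_space set \<Rightarrow> ('n :: finite \<Rightarrow> 'a) \<Rightarrow> 'n option \<Rightarrow> 'n option \<Rightarrow> 'n Qcoeff" where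
  "pairing_basis R \<alpha> None None =
     mfps_const (Poly_Mapping.single (- 2) (- 1 / rat_of_int \<lfloor>eps R \<alpha>\<rfloor>))"
| "pairing_basis R \<alpha> None (Some j) = 0"
| "pairing_basis R \<alpha> (Some i) None = 0"
| "pairing_basis R \<alpha> (Some i) (Some j) = of_int \<lfloor>\<alpha> i \<bullet> \<alpha> j\<rfloor>"

definition pairing_ext ::
    "'a :: euclidean_space set \<Rightarrow> ('n :: finite \<Rightarrow> 'a) \<Rightarrow> 'n QH_ext \<Rightarrow> 'n QH_ext \<Rightarrow> 'n Qcoeff" where
  "pairing_ext R \<alpha> x y = (\<Sum>a\<in>UNIV. \<Sum>b\<in>UNIV. x $ a * y $ b * pairing_basis R \<alpha> a b)"

definition pairing ::
    "'a :: euclidean_space set \<Rightarrow> ('n :: finite \<Rightarrow> 'a) \<Rightarrow> 'n QH \<Rightarrow> 'n QH \<Rightarrow> 'n Qcoeff" where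
  "pairing R \<alpha> x y = pairing_ext R \<alpha> (extend_QH x) (extend_QH y)"


section \<open>Frobenius algebras\<close>

text \<open>
  An associative unital algebra over a commutative ring whose underlying module is finitely
  generated projective (expressed through a finite dual basis), with a perfect bilinear form
  satisfying the Frobenius condition.
\<close>

locale frobenius_algebra = module scale
  for scale :: "'k :: comm_ring_1 \<Rightarrow> 'b :: ab_group_add \<Rightarrow> 'b" +
  fixes mult :: "'b \<Rightarrow> 'b \<Rightarrow> 'b"
    and unit :: 'b
    and form :: "'b \<Rightarrow> 'b \<Rightarrow> 'k"
  assumes mult_linear_right: "module_hom scale scale (mult x)"
    and mult_linear_left: "module_hom scale scale (\<lambda>x. mult x y)"
    and mult_assoc: "mult (mult x y) z = mult x (mult y z)"
    and mult_unit_left: "mult unit x = x"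
    and mult_unit_right: "mult x unit = x"
    and dual_basis: "\<exists>E \<phi>. finite E \<and> (\<forall>e\<in>E. module_hom scale (*) (\<phi> e)) \<and>
          (\<forall>x. x = (\<Sum>e\<in>E. scale (\<phi> e x) e))"
    and form_linear_right: "module_hom scale (*) (form x)"
    and form_linear_left: "module_hom scale (*) (\<lambda>x. form x y)"
    and perfect_left: "module_hom scale (*) f \<Longrightarrow> \<exists>!x. \<forall>y. form x y = f y"
    and perfect_right: "module_hom scale (*) f \<Longrightarrow> \<exists>!y. \<forall>x. form x y = f x"
    and frobenius: "form (mult x y) z = form x (mult y z)"

end

theory Submission
  imports Defs
begin

text \<open>
  Write \<open>x \<circ> y\<close> for the vector \<open>\<Sum>\<^sub>\<beta> \<langle>x,\<beta>\<rangle> \<langle>y,\<beta>\<^sup>\<or>\<rangle> \<beta>\<close>, the sum being over the positive roots, and \<open>x \<circ>\<^sub>q y\<close> for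
  its deformation with the factors \<open>(1 + q\<^sup>\<beta>) / (1 - q\<^sup>\<beta>)\<close>. Since \<open>\<star>\<close> is commutative, its associativity says
  that the tensor \<open>\<langle>x \<circ>\<^sub>q y, z \<circ>\<^sub>q w\<rangle> - \<langle>x \<circ>\<^sub>q w, y \<circ>\<^sub>q z\<rangle>\<close>, which behaves like a curvature tensor, is
  \<open>\<epsilon>\<^sub>R (\<langle>x,y\<rangle> \<langle>z,w\<rangle> - \<langle>x,w\<rangle> \<langle>z,y\<rangle>)\<close>.

  The tensor does not depend on \<open>q\<close>: its coefficients are invariant under the Weyl group and
  vanish outside the positive cone, and the orbit of a nonzero vector is not contained in that cone.

  At \<open>q = 0\<close>, invariance under the simple reflections makes every \<open>\<alpha>\<^sub>i \<and> \<alpha>\<^sub>j\<close> an eigenvector of the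
  tensor, regarded as an operator on bivectors. By symmetry and irreducibility all the eigenvalues
  are equal.

  For the value of the eigenvalue \<open>L\<close> let \<open>\<theta> = \<Sum> n\<^sub>i \<alpha>\<^sub>i\<close> be the largest root. Then \<open>\<theta> \<circ> \<theta> = \<mu> \<theta>\<close> with
  \<open>\<mu> = \<langle>\<theta>,\<theta>\<rangle> (3 + \<Sum> n\<^sub>i) / 2\<close>, and a simple root \<open>\<alpha>\<^sub>j\<close> orthogonal to \<open>\<theta>\<close> is an eigenvector of \<open>x \<mapsto> \<theta> \<circ> x\<close>
  whose eigenvalue is a zero of \<open>m\<^sup>2 - \<mu> m + L \<langle>\<theta>,\<theta>\<rangle>\<close>. On the other hand, the identity
  \<open>c\<^sub>i \<langle>\<alpha>\<^sub>i \<circ> \<alpha>\<^sub>i, \<alpha>\<^sub>j\<rangle> + c\<^sub>j \<langle>\<alpha>\<^sub>j \<circ> \<alpha>\<^sub>j, \<alpha>\<^sub>i\<rangle> = 2 \<langle>\<alpha>\<^sub>i,\<alpha>\<^sub>j\<rangle>\<close> for \<open>i \<noteq> j\<close>, with \<open>c\<^sub>i = 2 / \<langle>\<alpha>\<^sub>i,\<alpha>\<^sub>i\<rangle>\<close>, yields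
  \<open>\<Sum> n\<^sub>i c\<^sub>i \<langle>\<theta> \<circ> \<alpha>\<^sub>i, \<alpha>\<^sub>i\<rangle> = 6 \<epsilon>\<^sub>R - 2 \<langle>\<theta>,\<theta>\<rangle>\<close>. The one or two simple roots not orthogonal to \<open>\<theta>\<close> and their
  neighbours in the Dynkin diagram determine the eigenvalues \<open>m\<close> well enough to compare the two.
\<close>

section \<open>Positive roots and the product at \<open>q = 0\<close>\<close>

lemma reflection_inner:
  assumes "a \<noteq> 0" shows "reflection a x \<bullet> reflection a y = x \<bullet> y"
proof -
  have "a \<bullet> a \<noteq> 0" using assms by simp
  then show ?thesis
    by (simp add: reflection_def inner_diff_left inner_diff_right inner_commute[of x a] field_simps)
qed

lemma reflection_linear: "linear (reflection a)"
  by (rule linearI) (simp_all add: reflection_def inner_add_right algebra_simps add_divide_distrib)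

lemma reflection_reflection: "a \<noteq> 0 \<Longrightarrow> reflection a (reflection a x) = x"
  by (simp add: reflection_def inner_diff_right algebra_simps)

lemma reflection_self: "a \<noteq> 0 \<Longrightarrow> reflection a a = - a"
  by (simp add: reflection_def scaleR_2)

lemma reflection_eq: "reflection a x = x - (2 / (a \<bullet> a) * (a \<bullet> x)) *\<^sub>R a"
  by (simp add: reflection_def)

lemma reflection_adjoint: "a \<noteq> 0 \<Longrightarrow> reflection a x \<bullet> y = x \<bullet> reflection a y"
  by (metis reflection_inner reflection_reflection)

locale irreducible_roots =
  fixes R :: "'a :: euclidean_space set" and \<alpha> :: "'n :: finite \<Rightarrow> 'a"
  assumes irr: "irreducible_root_system R" and simple: "simple_roots R \<alpha>"
begin

abbreviation "P \<equiv> positive_roots R \<alpha>"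
abbreviation c :: "'a \<Rightarrow> real" where "c \<beta> \<equiv> 2 / (\<beta> \<bullet> \<beta>)"
abbreviation "ci i \<equiv> c (\<alpha> i)"
abbreviation "gram i j \<equiv> \<alpha> i \<bullet> \<alpha> j"
abbreviation "s i \<equiv> reflection (\<alpha> i)"

lemmas irr_conj = irr[unfolded irreducible_root_system_def]

lemma finite_R: "finite R" using irr_conj by (rule conjunct1)
lemma finite_P: "finite P" using finite_R by (simp add: positive_roots_def)
lemma P_subset: "P \<subseteq> R" by (auto simp: positive_roots_def)
lemma reduced: assumes "\<beta> \<in> R" "k *\<^sub>R \<beta> \<in> R" shows "k = 1 \<or> k = -1"
  using irr_conj[THEN conjunct2, THEN conjunct2, THEN conjunct1, rule_format, OF assms] .
lemma refl_image: assumes "\<beta> \<in> R" shows "reflection \<beta> ` R = R"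
  using irr_conj[THEN conjunct2, THEN conjunct2, THEN conjunct2, THEN conjunct1, rule_format, OF assms] .
lemma cartan_int: assumes "\<beta> \<in> R" "\<gamma> \<in> R" shows "c \<beta> * (\<beta> \<bullet> \<gamma>) \<in> \<int>"
  using irr_conj[THEN conjunct2, THEN conjunct2, THEN conjunct2, THEN conjunct2, THEN conjunct1, rule_format, OF assms]
  by simp
lemma invariant_subspace:
  assumes "subspace U" "\<And>w. w \<in> weyl_group R \<Longrightarrow> w ` U \<subseteq> U" shows "U = {0} \<or> U = UNIV"
  using irr_conj[THEN conjunct2, THEN conjunct2, THEN conjunct2, THEN conjunct2, THEN conjunct2, rule_format, of U] assms
  by auto
lemma refl_in: "\<beta> \<in> R \<Longrightarrow> \<gamma> \<in> R \<Longrightarrow> reflection \<beta> \<gamma> \<in> R"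
  using refl_image by auto
lemma zero_notin: "0 \<notin> R"
  using reduced[of 0 2] by auto
lemma simple_in: "\<alpha> i \<in> R" using simple by (auto simp: simple_roots_def)
lemma simple_nz: "\<alpha> i \<noteq> 0" using simple_in zero_notin by metis
lemma root_nz: "\<beta> \<in> R \<Longrightarrow> \<beta> \<noteq> 0" using zero_notin by metis
lemma norm_pos: "\<beta> \<in> R \<Longrightarrow> \<beta> \<bullet> \<beta> > 0" using root_nz by simp
lemma uminus_in: "\<beta> \<in> R \<Longrightarrow> - \<beta> \<in> R" using refl_in[of \<beta> \<beta>] reflection_self root_nz by metis
lemma s_norm: "s i x \<bullet> s i x = x \<bullet> x" using reflection_inner simple_nz by blast
lemma s_lin: "linear (s i)" by (rule reflection_linear)

section \<open>The basis dual to the simple roots\<close>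

lemma ex_dual: "\<exists>\<omega>. \<forall>i j. \<omega> i \<bullet> \<alpha> j = (if i = j then 1 else (0::real))"
proof -
  have "\<exists>w. \<forall>j. w \<bullet> \<alpha> j = (if i = j then 1 else (0::real))" for i
  proof -
    obtain g where g: "linear g" "\<forall>x\<in>range \<alpha>. g x = (if x = \<alpha> i then 1 else (0::real))"
      using linear_independent_extend[OF simple_roots_independent(2)[OF simple], of "\<lambda>x. if x = \<alpha> i then 1 else (0::real)"]
      by blast
    have "adjoint g 1 \<bullet> x = g x" for x using adjoint_clauses(2)[OF g(1)] by simp
    then show ?thesis using g(2) simple_roots_independent(1)[OF simple]
      by (intro exI[of _ "adjoint g 1"]) (auto simp: inj_eq)
  qed
  then show ?thesis by metis
qed

text \<open>The fundamental coweights: pairing with \<open>\<omega> i\<close> reads off the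
  coefficient at \<open>\<alpha> i\<close>, so that sign and integrality of coefficients become
  statements about inner products.\<close>

definition \<omega> :: "'n \<Rightarrow> 'a" where "\<omega> = (SOME w. \<forall>i j. w i \<bullet> \<alpha> j = (if i = j then 1 else (0::real)))"

lemma dual: "\<omega> i \<bullet> \<alpha> j = (if i = j then 1 else 0)"
  using someI_ex[OF ex_dual] unfolding \<omega>_def by blast
lemma dual': "\<alpha> j \<bullet> \<omega> i = (if i = j then 1 else 0)"
  using dual by (simp add: inner_commute)

lemma expand: "x = (\<Sum>i\<in>UNIV. (\<omega> i \<bullet> x) *\<^sub>R \<alpha> i)"
proof -
  have l: "linear (\<lambda>x. \<Sum>i\<in>UNIV. (\<omega> i \<bullet> x) *\<^sub>R \<alpha> i)"
    by (rule linearI) (simp_all add: inner_add_right scaleR_left_distrib sum.distrib scaleR_sum_right)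
  have "id x = (\<Sum>i\<in>UNIV. (\<omega> i \<bullet> x) *\<^sub>R \<alpha> i)"
    by (rule linear_eq_on_span[OF linear_id l, of "range \<alpha>"])
      (use simple in \<open>auto simp: simple_roots_def dual if_distrib[of "\<lambda>r. r *\<^sub>R _"] cong: if_cong\<close>)
  then show ?thesis unfolding id_apply .
qed

lemma inner_simple_eqI: assumes "\<And>i. \<alpha> i \<bullet> x = \<alpha> i \<bullet> y" shows "x = y"
proof -
  have "(x - y) \<bullet> (x - y) = (\<Sum>i\<in>UNIV. (\<omega> i \<bullet> (x-y)) * (\<alpha> i \<bullet> (x-y)))"
    by (subst (1) expand[of "x - y"]) (simp add: inner_sum_left)
  also have "\<dots> = 0" using assms by (simp add: inner_diff_right)
  finally show ?thesis by simp
qed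

lemma inner_dual_eqI: assumes "\<And>i. \<omega> i \<bullet> x = \<omega> i \<bullet> y" shows "x = y"
proof -
  have "x = (\<Sum>i\<in>UNIV. (\<omega> i \<bullet> x) *\<^sub>R \<alpha> i)" by (rule expand)
  also have "\<dots> = (\<Sum>i\<in>UNIV. (\<omega> i \<bullet> y) *\<^sub>R \<alpha> i)" using assms by simp
  also have "\<dots> = y" by (rule expand[symmetric])
  finally show ?thesis .
qed

lemma expand_dual: "x = (\<Sum>i\<in>UNIV. (\<alpha> i \<bullet> x) *\<^sub>R \<omega> i)"
  by (rule inner_simple_eqI) (simp add: inner_sum_right dual' if_distrib cong: if_cong)

lemma inner_expand: "x \<bullet> y = (\<Sum>i\<in>UNIV. (\<omega> i \<bullet> x) * (\<alpha> i \<bullet> y))"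
  by (subst expand[of x]) (simp add: inner_sum_left)

lemma int_comb_inner: "\<omega> i \<bullet> int_comb \<alpha> b = real_of_int (b i)"
  by (simp add: int_comb_def inner_sum_right dual if_distrib cong: if_cong)

lemma coord_root: "\<beta> \<in> R \<Longrightarrow> real_of_int (root_coords \<alpha> \<beta> i) = \<omega> i \<bullet> \<beta>"
  using root_coords_int_comb[OF simple] int_comb_inner by metis
lemma coord_int: "\<beta> \<in> R \<Longrightarrow> \<omega> i \<bullet> \<beta> \<in> \<int>"
  using coord_root by (metis Ints_of_int)

section \<open>Positive roots and simple reflections\<close>

lemma P_iff: "\<beta> \<in> P \<longleftrightarrow> \<beta> \<in> R \<and> (\<forall>i. \<omega> i \<bullet> \<beta> \<ge> 0)"
proof
  assume "\<beta> \<in> P" then show "\<beta> \<in> R \<and> (\<forall>i. \<omega> i \<bullet> \<beta> \<ge> 0)"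
    by (auto simp: positive_roots_def int_comb_inner)
next
  assume a: "\<beta> \<in> R \<and> (\<forall>i. \<omega> i \<bullet> \<beta> \<ge> 0)"
  then have "\<beta> = int_comb \<alpha> (root_coords \<alpha> \<beta>)" "\<forall>i. root_coords \<alpha> \<beta> i \<ge> 0"
    using root_coords_int_comb[OF simple] coord_root by (auto, metis of_int_0_le_iff)
  then show "\<beta> \<in> P" using a unfolding positive_roots_def by blast
qed
lemma P_or: "\<beta> \<in> R \<Longrightarrow> \<beta> \<in> P \<or> - \<beta> \<in> P"
proof -
  assume b: "\<beta> \<in> R"
  then obtain b where "\<beta> = int_comb \<alpha> b" "(\<forall>i. b i \<ge> 0) \<or> (\<forall>i. b i \<le> 0)"
    using simple unfolding simple_roots_def by blast
  then show ?thesis using b uminus_in[OF b] by (auto simp: P_iff int_comb_inner)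
qed
lemma P_not_both: "\<beta> \<in> P \<Longrightarrow> - \<beta> \<notin> P"
proof
  assume "\<beta> \<in> P" "- \<beta> \<in> P"
  then have "\<omega> i \<bullet> \<beta> = 0" for i by (auto simp: P_iff intro: antisym)
  then have "\<beta> = 0" by (intro inner_dual_eqI) simp
  then show False using \<open>\<beta> \<in> P\<close> root_nz by (auto simp: P_iff)
qed
lemma simple_P: "\<alpha> i \<in> P" by (simp add: P_iff simple_in dual)
text \<open>The coefficients of a root never have opposite signs, so one positive coefficient
  settles positivity.\<close>

lemma P_coord_pos: "\<beta> \<in> R \<Longrightarrow> \<omega> i \<bullet> \<beta> > 0 \<Longrightarrow> \<beta> \<in> P"
  using P_or[of \<beta>] by (auto simp: P_iff) (metis inner_minus_right neg_0_le_iff_le not_le)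
lemma s_coord: "i \<noteq> j \<Longrightarrow> \<omega> j \<bullet> s i x = \<omega> j \<bullet> x"
  by (simp add: reflection_def inner_diff_right dual)
text \<open>Otherwise \<open>\<beta>\<close> would be a multiple of \<open>\<alpha> i\<close>, and
  in a reduced system the only positive one is \<open>\<alpha> i\<close> itself.\<close>

lemma P_other_coord:
  assumes "\<beta> \<in> P" "\<beta> \<noteq> \<alpha> i" obtains j where "j \<noteq> i" "\<omega> j \<bullet> \<beta> > 0"
proof -
  have "\<exists>j. j \<noteq> i \<and> \<omega> j \<bullet> \<beta> > 0"
  proof (rule ccontr)
    assume n: "\<not> ?thesis"
    then have z: "\<omega> j \<bullet> \<beta> = 0" if "j \<noteq> i" for j
      using n P_iff[of \<beta>] assms(1) that by (meson antisym_conv not_le)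
    have e: "(\<omega> i \<bullet> \<beta>) *\<^sub>R \<alpha> i = \<beta>" by (rule inner_dual_eqI) (use z in \<open>auto simp: dual\<close>)
    then have "(\<omega> i \<bullet> \<beta>) *\<^sub>R \<alpha> i \<in> R" using assms(1) P_subset by auto
    then have "\<omega> i \<bullet> \<beta> = 1 \<or> \<omega> i \<bullet> \<beta> = -1" by (rule reduced[OF simple_in])
    moreover have "\<omega> i \<bullet> \<beta> \<ge> 0" using assms(1) P_iff by blast
    ultimately have "\<omega> i \<bullet> \<beta> = 1" by auto
    then show False using assms(2) e by simp
  qed
  then show ?thesis using that by blast
qed
text \<open>\<open>s i\<close> changes only the coefficient at \<open>i\<close>, so a positive
  coefficient elsewhere survives.\<close>

lemma s_P: assumes "\<beta> \<in> P" "\<beta> \<noteq> \<alpha> i" shows "s i \<beta> \<in> P" "s i \<beta> \<noteq> \<alpha> i"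
proof -
  obtain j where j: "j \<noteq> i" "\<omega> j \<bullet> \<beta> > 0" using P_other_coord assms by metis
  then show "s i \<beta> \<in> P" using s_coord[of i j \<beta>] refl_in[OF simple_in] assms(1) P_subset
    by (intro P_coord_pos[of _ j]) auto
  show "s i \<beta> \<noteq> \<alpha> i" using s_coord[of i j \<beta>] j dual[of j i] by auto
qed
lemma s_bij: "bij_betw (s i) (P - {\<alpha> i}) (P - {\<alpha> i})"
  by (rule bij_betw_byWitness[where f'="s i"])
    (auto simp: s_P reflection_reflection[OF simple_nz])

section \<open>The product at q = 0 and its cubic form\<close>

definition cprod :: "'a \<Rightarrow> 'a \<Rightarrow> 'a" where
  "cprod x y = (\<Sum>\<beta>\<in>P. (c \<beta> * (x \<bullet> \<beta>) * (y \<bullet> \<beta>)) *\<^sub>R \<beta>)"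

lemma cprod_comm: "cprod x y = cprod y x" by (simp add: cprod_def mult_ac)
lemma cprod_linear: "linear (cprod x)"
  by (rule linearI) (simp_all add: cprod_def inner_add_left ring_distribs add_divide_distrib scaleR_add_left
      sum.distrib scaleR_sum_right mult_ac)
lemma cprod_linear': "linear (\<lambda>x. cprod x y)"
  using cprod_linear[of y] by (simp add: cprod_comm[of _ y])
lemmas cprod_simps = linear_add[OF cprod_linear] linear_add[OF cprod_linear'] linear_diff[OF cprod_linear]
  linear_diff[OF cprod_linear'] linear_scale[OF cprod_linear] linear_scale[OF cprod_linear'] linear_neg[OF cprod_linear]
  linear_neg[OF cprod_linear'] linear_0[OF cprod_linear] linear_0[OF cprod_linear']
lemma tri_eq: "cprod x y \<bullet> z = (\<Sum>\<beta>\<in>P. c \<beta> * (x \<bullet> \<beta>) * (y \<bullet> \<beta>) * (z \<bullet> \<beta>))"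
  unfolding cprod_def inner_sum_left by (rule sum.cong) (simp_all add: inner_commute[of z])
lemma tri_sym: "cprod x y \<bullet> z = cprod x z \<bullet> y" by (simp add: tri_eq mult_ac)
lemma tri_sym': "cprod x y \<bullet> z = cprod z y \<bullet> x" by (simp add: tri_eq mult_ac)

text \<open>\<open>s i\<close> permutes all summands except that of \<open>\<alpha> i\<close>. This
  one is unchanged on the left but negated by the outer \<open>s i\<close> on the right, so the
  correction is twice this summand.\<close>

lemma cprod_reflection: "cprod (s i x) (s i y) = s i (cprod x y) + (2 * ci i * (\<alpha> i \<bullet> x) * (\<alpha> i \<bullet> y)) *\<^sub>R \<alpha> i"
proof -
  define f where "f = (\<lambda>x y \<beta>. (c \<beta> * (x \<bullet> \<beta>) * (y \<bullet> \<beta>)) *\<^sub>R \<beta>)"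
  have sp: "cprod x y = f x y (\<alpha> i) + (\<Sum>\<beta>\<in>P - {\<alpha> i}. f x y \<beta>)" for x y
    unfolding cprod_def f_def using sum.remove[OF finite_P simple_P] .
  have "(\<Sum>\<beta>\<in>P - {\<alpha> i}. f (s i x) (s i y) \<beta>) = (\<Sum>\<beta>\<in>P - {\<alpha> i}. f (s i x) (s i y) (s i \<beta>))"
    using sum.reindex_bij_betw[OF s_bij, of "f (s i x) (s i y)" i] by simp
  also have "\<dots> = (\<Sum>\<beta>\<in>P - {\<alpha> i}. s i (f x y \<beta>))"
    by (simp add: f_def reflection_inner simple_nz linear_scale[OF s_lin])
  also have "\<dots> = s i (\<Sum>\<beta>\<in>P - {\<alpha> i}. f x y \<beta>)" by (simp add: linear_sum[OF s_lin])
  finally have e: "(\<Sum>\<beta>\<in>P - {\<alpha> i}. f (s i x) (s i y) \<beta>) = s i (\<Sum>\<beta>\<in>P - {\<alpha> i}. f x y \<beta>)" .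
  have f1: "f (s i x) (s i y) (\<alpha> i) = f x y (\<alpha> i)"
    by (simp add: f_def reflection_adjoint[OF simple_nz] reflection_self[OF simple_nz])
  have f2: "s i (f x y (\<alpha> i)) = - f x y (\<alpha> i)"
    by (simp add: f_def linear_scale[OF s_lin] reflection_self[OF simple_nz])
  have "cprod (s i x) (s i y) = s i (cprod x y) + 2 *\<^sub>R f x y (\<alpha> i)"
    unfolding sp linear_add[OF s_lin] e f1 f2 by (simp add: scaleR_2)
  then show ?thesis by (simp add: f_def inner_commute mult_ac)
qed

text \<open>Here \<open>s i\<close> fixes \<open>x\<close>, negates \<open>\<alpha> i\<close>, and
  the correction in \<open>cprod_reflection\<close> vanishes. So the product lies in the -1
  eigenspace of \<open>s i\<close>, the line through \<open>\<alpha> i\<close>.\<close>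

lemma cprod_orth: assumes "\<alpha> i \<bullet> x = 0"
  shows "cprod x (\<alpha> i) = ((cprod x (\<alpha> i) \<bullet> \<alpha> i) / (\<alpha> i \<bullet> \<alpha> i)) *\<^sub>R \<alpha> i"
proof -
  have sx: "s i x = x" using assms by (simp add: reflection_def)
  have "- cprod x (\<alpha> i) = s i (cprod x (\<alpha> i))"
    using cprod_reflection[of i x "\<alpha> i"] assms by (simp add: sx reflection_self[OF simple_nz] cprod_simps)
  then have "2 *\<^sub>R cprod x (\<alpha> i) = (ci i * (\<alpha> i \<bullet> cprod x (\<alpha> i))) *\<^sub>R \<alpha> i"
    by (simp add: reflection_def scaleR_2 algebra_simps)
  then have "cprod x (\<alpha> i) = (1/2) *\<^sub>R (ci i * (\<alpha> i \<bullet> cprod x (\<alpha> i))) *\<^sub>R \<alpha> i"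
    by (metis scaleR_half_double scaleR_2 scaleR_add_right)
  then show ?thesis by (simp add: inner_commute)
qed

lemma tri_orth: "\<alpha> i \<bullet> x = 0 \<Longrightarrow> \<alpha> i \<bullet> y = 0 \<Longrightarrow> cprod x (\<alpha> i) \<bullet> y = 0"
  by (subst cprod_orth) auto

text \<open>By \<open>tri_orth\<close> the symmetric form
  \<open>cprod x (\<alpha> i) \<bullet> y\<close> vanishes on the hyperplane orthogonal to
  \<open>\<alpha> i\<close>; such a form is a symmetrised product of the functional of
  \<open>\<alpha> i\<close> with a second one.\<close>

lemma tri_decomp: obtains \<phi> where "\<And>x y. cprod x (\<alpha> i) \<bullet> y = (\<alpha> i \<bullet> x) * \<phi> y + (\<alpha> i \<bullet> y) * \<phi> x"
proof
  fix x y
  let ?a = "\<alpha> i" let ?d = "\<alpha> i \<bullet> \<alpha> i"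
  have d: "?d \<noteq> 0" using simple_nz by simp
  \<comment> \<open>The components orthogonal to \<open>?a\<close>. Expanding the vanishing of the
    form on them expresses its values by those in which \<open>?a\<close> occurs at least
    twice.\<close>
  let ?x = "x - ((?a \<bullet> x) / ?d) *\<^sub>R ?a" let ?y = "y - ((?a \<bullet> y) / ?d) *\<^sub>R ?a"
  have "cprod ?x ?a \<bullet> ?y = 0" using d by (intro tri_orth) (simp_all add: inner_diff_right)
  then have "?d * (?d * (cprod x ?a \<bullet> y)) = (?a \<bullet> x) * (?d * (cprod ?a ?a \<bullet> y)) + (?a \<bullet> y) * (?d * (cprod ?a ?a \<bullet> x))
      - (?a \<bullet> x) * ((?a \<bullet> y) * (cprod ?a ?a \<bullet> ?a))"
    using d tri_sym'[of x ?a ?a]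
    by (simp add: cprod_simps inner_diff_left inner_diff_right field_simps power2_eq_square)
  then have q: "cprod x ?a \<bullet> y = ((?a \<bullet> x) * (?d * (cprod ?a ?a \<bullet> y)) + (?a \<bullet> y) * (?d * (cprod ?a ?a \<bullet> x))
      - (?a \<bullet> x) * ((?a \<bullet> y) * (cprod ?a ?a \<bullet> ?a))) / (?d * ?d)"
    using d by (simp add: nonzero_eq_divide_eq mult_ac)
  \<comment> \<open>The term with \<open>cprod ?a ?a \<bullet> ?a\<close> is split evenly between
    the two occurrences of \<open>\<phi>\<close>, whence the factor 2 in the denominators.\<close>
  show "cprod x ?a \<bullet> y = (?a \<bullet> x) * (cprod ?a ?a \<bullet> y / ?d - cprod ?a ?a \<bullet> ?a * (?a \<bullet> y) / (2 * ?d^2))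
     + (?a \<bullet> y) * (cprod ?a ?a \<bullet> x / ?d - cprod ?a ?a \<bullet> ?a * (?a \<bullet> x) / (2 * ?d^2))"
    unfolding q using d by (simp add: field_simps power2_eq_square)
qed

section \<open>The curvature tensor and its eigenvectors\<close>

definition curv :: "'a \<Rightarrow> 'a \<Rightarrow> 'a \<Rightarrow> 'a \<Rightarrow> real" where
  "curv x z y w = cprod x y \<bullet> cprod z w - cprod x w \<bullet> cprod y z"

lemma curv_sym: "curv x z y w = curv y w x z"
  by (simp add: curv_def cprod_comm[of y x] cprod_comm[of w z] cprod_comm[of x w] cprod_comm[of z y], rule inner_commute)
text \<open>The exchange swaps the two summands. With \<open>curv_sym\<close> this makes the pairs
  \<open>x\<close>, \<open>z\<close> and \<open>y\<close>, \<open>w\<close> the two bivectors on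
  which the tensor acts.\<close>

lemma curv_anti: "curv z x y w = - curv x z y w"
  by (simp add: curv_def inner_commute[of "cprod z y"] inner_commute[of "cprod z w"] cprod_comm[of y])
lemma curv_linear: "linear (\<lambda>w. curv x z y w)"
  by (rule linearI) (simp_all add: curv_def cprod_simps inner_add_left inner_add_right algebra_simps)

text \<open>By \<open>tri_decomp\<close> the corrections from \<open>cprod_reflection\<close>
  contribute expressions symmetric in all four arguments, and these cancel in the difference
  defining \<open>curv\<close>.\<close>

lemma curv_reflection: "curv (s i x) (s i z) (s i y) (s i w) = curv x z y w"
proof -
  obtain \<phi> where phi: "\<And>x y. cprod x (\<alpha> i) \<bullet> y = (\<alpha> i \<bullet> x) * \<phi> y + (\<alpha> i \<bullet> y) * \<phi> x"
    using tri_decomp by blast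
  have k: "s i (cprod x y) \<bullet> \<alpha> i = - ((\<alpha> i \<bullet> x) * \<phi> y + (\<alpha> i \<bullet> y) * \<phi> x)" for x y
    using phi[of x y] tri_sym[of x y "\<alpha> i"]
    by (simp add: reflection_adjoint[OF simple_nz] reflection_self[OF simple_nz])
  show ?thesis
    unfolding curv_def cprod_reflection inner_add_left inner_add_right inner_scaleR_left inner_scaleR_right
      reflection_inner[OF simple_nz] inner_commute[of "\<alpha> i" "s i _"] k
    by (simp add: algebra_simps add_divide_distrib diff_divide_distrib)
qed

text \<open>As \<open>s i\<close> fixes \<open>y\<close> and \<open>w\<close>, invariance replaces
  \<open>z\<close> by \<open>s i z\<close> at the cost of a sign. But \<open>s i z\<close> differs
  from \<open>z\<close> by a multiple of \<open>\<alpha> i\<close>, where antisymmetry gives 0. So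
  the value is its own negative.\<close>

lemma curv_vanish: assumes "\<alpha> i \<bullet> y = 0" "\<alpha> i \<bullet> w = 0" shows "curv (\<alpha> i) z y w = 0"
proof -
  have sy: "s i y = y" "s i w = w" using assms by (simp_all add: reflection_def)
  have l: "linear (\<lambda>z. curv (\<alpha> i) z y w)"
    by (subst curv_sym) (rule curv_linear)
  have "curv (\<alpha> i) z y w = curv (- \<alpha> i) (s i z) y w"
    using curv_reflection[of i "\<alpha> i" z y w] by (simp add: sy reflection_self[OF simple_nz])
  also have "\<dots> = - curv (\<alpha> i) (s i z) y w"
    by (simp add: curv_def cprod_simps)
  also have "curv (\<alpha> i) (s i z) y w = curv (\<alpha> i) z y w - ci i * (\<alpha> i \<bullet> z) * curv (\<alpha> i) (\<alpha> i) y w"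
    unfolding reflection_eq linear_diff[OF l] linear_scale[OF l] by simp
  also have "curv (\<alpha> i) (\<alpha> i) y w = 0" using curv_anti[of "\<alpha> i" "\<alpha> i" y w] by simp
  finally show ?thesis by simp
qed

definition curv_coeff :: "'n \<Rightarrow> 'n \<Rightarrow> real" where "curv_coeff i j = curv (\<alpha> i) (\<alpha> j) (\<omega> i) (\<omega> j)"

text \<open>\<open>curv_vanish\<close>, applied to \<open>\<alpha> i\<close> and to
  \<open>\<alpha> j\<close>, leaves only the components with \<open>{a, b} = {i, j}\<close> in the
  dual basis. Thus \<open>curv_coeff i j\<close> is the eigenvalue at the bivector of
  \<open>\<alpha> i\<close> and \<open>\<alpha> j\<close>.\<close>

lemma curv_basis: assumes "i \<noteq> j"
  shows "curv (\<alpha> i) (\<alpha> j) y w = curv_coeff i j * ((\<alpha> i \<bullet> y) * (\<alpha> j \<bullet> w) - (\<alpha> i \<bullet> w) * (\<alpha> j \<bullet> y))"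
proof -
  have anti: "curv a b y w = - curv a b w y" for a b y w
    using curv_sym curv_anti by metis
  have l2: "linear (\<lambda>y. curv (\<alpha> i) (\<alpha> j) y w)" for w
    using linear_compose_neg[OF curv_linear[of "\<alpha> i" "\<alpha> j" w]] by (simp add: anti[of _ _ _ w])
  have e: "curv (\<alpha> i) (\<alpha> j) (\<omega> a) (\<omega> b) = curv_coeff i j * ((\<alpha> i \<bullet> \<omega> a) * (\<alpha> j \<bullet> \<omega> b) - (\<alpha> i \<bullet> \<omega> b) * (\<alpha> j \<bullet> \<omega> a))" for a b
  proof -
    have z1: "curv (\<alpha> i) (\<alpha> j) (\<omega> a) (\<omega> b) = 0" if "a \<noteq> i" "b \<noteq> i"
      by (rule curv_vanish) (use that in \<open>auto simp: dual'\<close>)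
    have z2: "curv (\<alpha> i) (\<alpha> j) (\<omega> a) (\<omega> b) = 0" if "a \<noteq> j" "b \<noteq> j"
      using curv_vanish[of j "\<omega> a" "\<omega> b" "\<alpha> i"] that curv_anti[of "\<alpha> j" "\<alpha> i"] by (auto simp: dual')
    show ?thesis using z1 z2 anti[of "\<alpha> i" "\<alpha> j" "\<omega> j" "\<omega> i"] assms unfolding curv_coeff_def by (auto simp: dual')
  qed
  have "curv (\<alpha> i) (\<alpha> j) y w = (\<Sum>b\<in>UNIV. \<Sum>a\<in>UNIV. (\<alpha> b \<bullet> w) * ((\<alpha> a \<bullet> y) * curv (\<alpha> i) (\<alpha> j) (\<omega> a) (\<omega> b)))"
    by (subst expand_dual[of y], subst expand_dual[of w])
      (simp add: linear_sum[OF l2] linear_scale[OF l2] linear_sum[OF curv_linear] linear_scale[OF curv_linear] sum_distrib_left)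
  also have "\<dots> = curv_coeff i j * ((\<alpha> i \<bullet> y) * (\<alpha> j \<bullet> w) - (\<alpha> i \<bullet> w) * (\<alpha> j \<bullet> y))"
  proof -
    have x: "(\<Sum>a\<in>UNIV. (\<alpha> a \<bullet> v) * (u \<bullet> \<omega> a)) = u \<bullet> v" for u v
      by (subst (2) expand_dual[of v]) (simp add: inner_sum_right)
    have "(\<Sum>a\<in>UNIV. (\<alpha> b \<bullet> w) * ((\<alpha> a \<bullet> y) * curv (\<alpha> i) (\<alpha> j) (\<omega> a) (\<omega> b)))
      = curv_coeff i j * ((\<alpha> b \<bullet> w) * (\<alpha> j \<bullet> \<omega> b) * (\<Sum>a\<in>UNIV. (\<alpha> a \<bullet> y) * (\<alpha> i \<bullet> \<omega> a))
        - (\<alpha> b \<bullet> w) * (\<alpha> i \<bullet> \<omega> b) * (\<Sum>a\<in>UNIV. (\<alpha> a \<bullet> y) * (\<alpha> j \<bullet> \<omega> a)))" for b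
      unfolding e by (simp add: sum_distrib_left right_diff_distrib sum_subtractf mult_ac)
    then show ?thesis
      by (simp add: x sum_distrib_left[symmetric] sum_subtractf sum_distrib_right[symmetric])
  qed
  finally show ?thesis .
qed

section \<open>Constancy of the curvature\<close>

text \<open>\<open>s i (\<alpha> j)\<close> is a positive root whose coefficient at \<open>i\<close>
  is a negative multiple of \<open>gram i j\<close>.\<close>

lemma simple_nonpos: assumes "i \<noteq> j" shows "gram i j \<le> 0"
proof -
  have "\<alpha> j \<noteq> \<alpha> i" using assms simple_roots_independent(1)[OF simple] by (auto simp: inj_eq)
  then have "s i (\<alpha> j) \<in> P" using s_P(1) simple_P by blast
  then have "\<omega> i \<bullet> s i (\<alpha> j) \<ge> 0" using P_iff by blast
  then have "ci i * (gram i j) \<le> 0" using assms by (simp add: reflection_def inner_diff_right dual)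
  then show ?thesis using norm_pos[OF simple_in, of i] by (simp add: mult_le_0_iff divide_le_0_iff)
qed

section \<open>Heights and descent to the simple roots\<close>

definition ht :: "'a \<Rightarrow> real" where "ht x = (\<Sum>i\<in>UNIV. \<omega> i \<bullet> x)"

lemma ht_linear: "linear ht"
  by (rule linearI) (simp_all add: ht_def inner_add_right sum.distrib sum_distrib_left)
lemma ht_simple: "ht (\<alpha> i) = 1" by (simp add: ht_def dual)
lemma ht_s: "ht (s i x) = ht x - ci i * (\<alpha> i \<bullet> x)"
  unfolding reflection_eq linear_diff[OF ht_linear] linear_scale[OF ht_linear] ht_simple by simp

lemma ht_le_0: assumes nn: "\<And>i. 0 \<le> \<omega> i \<bullet> v" and "ht v \<le> 0" shows "v = 0"
proof -
  have "ht v \<ge> 0" unfolding ht_def using nn by (rule sum_nonneg)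
  then have "(\<Sum>i\<in>UNIV. \<omega> i \<bullet> v) = 0" using assms(2) unfolding ht_def by linarith
  then have "\<forall>i\<in>UNIV. \<omega> i \<bullet> v = 0" using nn by (subst (asm) sum_nonneg_eq_0_iff) auto
  then show ?thesis by (intro inner_dual_eqI) simp
qed

lemma ex_descent: assumes "\<beta> \<in> P" shows "\<exists>i. \<alpha> i \<bullet> \<beta> > 0"
proof (rule ccontr)
  assume "\<not> ?thesis"
  then have "\<And>i. \<alpha> i \<bullet> \<beta> \<le> 0" by (simp add: not_less)
  then have "\<beta> \<bullet> \<beta> \<le> 0" unfolding inner_expand[of \<beta> \<beta>]
    using assms by (intro sum_nonpos) (auto simp: P_iff mult_nonneg_nonpos)
  then show False using norm_pos assms P_iff by (metis not_le)
qed

lemma cartan_ge_1: assumes "\<beta> \<in> R" "\<gamma> \<in> R" "\<beta> \<bullet> \<gamma> > 0" shows "c \<beta> * (\<beta> \<bullet> \<gamma>) \<ge> 1"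
proof -
  obtain k where k: "c \<beta> * (\<beta> \<bullet> \<gamma>) = of_int k" using cartan_int[OF assms(1,2)] by (auto elim: Ints_cases)
  moreover have "c \<beta> * (\<beta> \<bullet> \<gamma>) > 0" using assms norm_pos by simp
  ultimately show ?thesis by simp
qed

text \<open>Induction on the height. \<open>ex_descent\<close> provides a simple root with positive
  pairing; reflecting in it keeps any other root positive and, the Cartan number being a positive
  integer, lowers the height by at least 1.\<close>

lemma P_induct [consumes 1, case_names simple step]:
  assumes "\<beta> \<in> P" and simple: "\<And>i. Q (\<alpha> i)"
    and step: "\<And>\<beta> i. \<beta> \<in> P \<Longrightarrow> \<beta> \<noteq> \<alpha> i \<Longrightarrow> \<alpha> i \<bullet> \<beta> > 0 \<Longrightarrow> s i \<beta> \<in> P \<Longrightarrow> Q (s i \<beta>) \<Longrightarrow> Q \<beta>"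
  shows "Q \<beta>"
proof -
  have "\<beta> \<in> P \<Longrightarrow> ht \<beta> \<le> real n \<Longrightarrow> Q \<beta>" for n
  proof (induction n arbitrary: \<beta>)
    case 0
    have nn: "0 \<le> \<omega> i \<bullet> \<beta>" for i using 0 P_iff by blast
    then have "\<beta> = 0" using ht_le_0 0 by simp
    then show ?case using 0 root_nz P_iff by auto
  next
    case (Suc n)
    obtain i where i: "\<alpha> i \<bullet> \<beta> > 0" using ex_descent Suc by blast
    show ?case
    proof (cases "\<beta> = \<alpha> i")
      case False
      have p: "s i \<beta> \<in> P" using s_P False Suc by blast
      have "ci i * (\<alpha> i \<bullet> \<beta>) \<ge> 1" using cartan_ge_1[OF simple_in] i Suc P_iff by blast
      then have "ht (s i \<beta>) \<le> real n" using Suc.prems by (simp only: ht_s)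
      then show ?thesis using step[OF Suc.prems(1) False i p] Suc.IH p by blast
    qed (use simple in auto)
  qed
  then show ?thesis using assms(1) real_arch_simple by blast
qed

text \<open>Connectedness of the Dynkin diagram. Without an edge leaving \<open>J\<close>, every
  root would be supported in \<open>J\<close> or in its complement, and the vectors supported in
  \<open>J\<close> would form a proper nonzero subspace invariant under the Weyl group.\<close>

lemma connected:
  assumes "J \<noteq> {}" "J \<noteq> UNIV" shows "\<exists>i\<in>J. \<exists>j\<in>-J. gram i j \<noteq> 0"
proof (rule ccontr)
  assume n: "\<not> ?thesis"
  have orth: "gram i j = 0" "gram j i = 0" if "i \<in> J" "j \<notin> J" for i j
    using n that by (auto simp: inner_commute)
  define S where "S J x \<longleftrightarrow> (\<forall>j. j \<notin> J \<longrightarrow> \<omega> j \<bullet> x = 0)" for J x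
  have perp: "x \<bullet> y = 0" if "S J x" "S (-J) y" for x y
  proof -
    have "\<alpha> i \<bullet> y = 0" if "i \<in> J" for i
    proof -
      have "\<alpha> i \<bullet> y = (\<Sum>j\<in>UNIV. (\<omega> j \<bullet> y) * (gram j i))"
        using inner_expand[of y "\<alpha> i"] by (simp only: inner_commute[of _ y])
      also have "\<dots> = 0"
        using \<open>S (-J) y\<close> that orth unfolding S_def by (intro sum.neutral) (metis ComplD mult_eq_0_iff)
      finally show ?thesis .
    qed
    then show ?thesis using \<open>S J x\<close> unfolding inner_expand[of x y] S_def
      by (intro sum.neutral) (metis mult_eq_0_iff)
  qed
  have split: "S J \<beta> \<or> S (-J) \<beta>" if "\<beta> \<in> P" for \<beta>
    using that
  proof (induction rule: P_induct)
    case (simple i)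
    then show ?case by (auto simp: S_def dual)
  next
    case (step \<beta> i)
    \<comment> \<open>Since \<open>s i \<beta>\<close> is not orthogonal to
      \<open>\<alpha> i\<close>, both are supported on the same side; passing back to
      \<open>\<beta>\<close> changes only the coefficient at \<open>i\<close>.\<close>
    have ne: "\<alpha> i \<bullet> s i \<beta> \<noteq> 0"
      using step.hyps by (simp add: reflection_adjoint[OF simple_nz, symmetric] reflection_self[OF simple_nz])
    have c: "\<omega> j \<bullet> \<beta> = \<omega> j \<bullet> s i \<beta>" if "j \<noteq> i" for j using s_coord that by metis
    have Si: "S J (\<alpha> i)" if "i \<in> J" "S K x" for J K x using that by (auto simp: S_def dual)
    from step.IH show ?case
    proof
      assume a: "S J (s i \<beta>)"
      have "i \<in> J"
      proof (rule ccontr)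
        assume "i \<notin> J" then have "S (-J) (\<alpha> i)" by (auto simp: S_def dual)
        then show False using perp[OF a] ne by (simp add: inner_commute)
      qed
      then have "S J \<beta>" using a c unfolding S_def by metis
      then show ?thesis ..
    next
      assume a: "S (-J) (s i \<beta>)"
      have "i \<notin> J"
      proof
        assume "i \<in> J" then have "S J (\<alpha> i)" by (auto simp: S_def dual)
        then show False using perp[OF _ a] ne by blast
      qed
      then have "S (-J) \<beta>" using a c unfolding S_def by (metis ComplI)
      then show ?thesis ..
    qed
  qed
  have split': "S J \<beta> \<or> S (-J) \<beta>" if "\<beta> \<in> R" for \<beta>
    using P_or[OF that] split[of \<beta>] split[of "-\<beta>"] by (auto simp: S_def)
  let ?U = "{x. S J x}"
  have sub: "subspace ?U" by (rule subspaceI) (auto simp: S_def inner_add_right)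
  have refl: "reflection \<beta> x \<in> ?U" if "\<beta> \<in> R" "x \<in> ?U" for \<beta> x
    using split'[OF that(1)]
  proof
    assume "S J \<beta>" then show ?thesis using that(2) by (auto simp: S_def reflection_def inner_diff_right)
  next
    assume "S (-J) \<beta>" then show ?thesis using that(2) perp[of x \<beta>] by (simp add: reflection_def inner_commute)
  qed
  have "w ` ?U \<subseteq> ?U" if "w \<in> weyl_group R" for w
    using that by induction (use refl in auto)
  then have "?U = {0} \<or> ?U = UNIV" by (rule invariant_subspace[OF sub])
  then show False
  proof
    assume u: "?U = {0}"
    obtain i where "i \<in> J" using assms by blast
    then have "\<alpha> i \<in> ?U" by (auto simp: S_def dual)
    then show False using u simple_nz by auto
  next
    assume u: "?U = UNIV"
    obtain i where "i \<notin> J" using assms by blast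
    then have "\<alpha> i \<notin> ?U" by (auto simp: S_def dual)
    then show False using u by auto
  qed
qed

section \<open>Comparison of the eigenvalues\<close>

lemma curv_coeff_sym: "i \<noteq> j \<Longrightarrow> curv_coeff i j = curv_coeff j i"
  using curv_basis[of i j "\<omega> j" "\<omega> i"] curv_anti[of "\<alpha> j" "\<alpha> i"] by (simp add: curv_coeff_def[of j i] dual')

text \<open>Symmetry equates two evaluations of
  \<open>curv (\<alpha> i) (\<alpha> j) (\<alpha> i) (\<alpha> l)\<close>. Their common factor
  \<open>?m\<close> is nonzero: both its terms are \<le> 0, and the last assumption makes one of
  them nonzero.\<close>

lemma curv_coeff_eq:
  assumes "i \<noteq> j" "i \<noteq> l" "j \<noteq> l" "gram j l \<noteq> 0 \<or> gram i j \<noteq> 0 \<and> gram i l \<noteq> 0"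
  shows "curv_coeff i j = curv_coeff i l"
proof -
  let ?m = "(gram i i) * (gram j l) - (gram i l) * (gram i j)"
  have d: "gram i i > 0" using norm_pos simple_in by blast
  have np: "gram j l \<le> 0" "gram i l \<le> 0" "gram i j \<le> 0" using simple_nonpos assms by auto
  have p: "(gram i i) * (gram j l) \<le> 0" "(gram i l) * (gram i j) \<ge> 0"
    using np d by (simp_all add: mult_le_0_iff zero_le_mult_iff)
  have "(gram i i) * (gram j l) \<noteq> 0 \<or> (gram i l) * (gram i j) \<noteq> 0"
    using assms(4) d by auto
  then have "?m \<noteq> 0" using p by linarith
  moreover have "curv_coeff i j * ?m = curv_coeff i l * ?m"
    using curv_sym[of "\<alpha> i" "\<alpha> j" "\<alpha> i" "\<alpha> l"]
    unfolding curv_basis[OF assms(1)] curv_basis[OF assms(2)]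
    by (simp add: inner_commute[of "\<alpha> l" "\<alpha> i"] inner_commute[of "\<alpha> j" "\<alpha> i"] inner_commute[of "\<alpha> l" "\<alpha> j"] algebra_simps)
  ultimately show ?thesis by simp
qed

lemma ex_curv_coeff: "\<exists>L. \<forall>i j. i \<noteq> j \<longrightarrow> curv_coeff i j = L"
proof -
  have one: "\<exists>f. \<forall>l. l \<noteq> i \<longrightarrow> curv_coeff i l = f" for i
  proof (cases "UNIV = {i}")
    case True then show ?thesis by auto
  next
    case False
    then obtain j0 where j0: "j0 \<noteq> i" "gram i j0 \<noteq> 0" using connected[of "{i}"] by auto
    \<comment> \<open>Connectedness yields an edge from \<open>l\<close> in \<open>?J\<close> to
      \<open>m\<close> outside. If \<open>m\<close> is \<open>i\<close>, then \<open>l\<close> and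
      \<open>j0\<close> are both neighbours of \<open>i\<close>; otherwise \<open>l\<close> and
      \<open>m\<close> are adjacent. \<open>curv_coeff_eq\<close> covers both situations.\<close>
    let ?J = "{l. l \<noteq> i \<and> curv_coeff i l \<noteq> curv_coeff i j0}"
    have "?J = {}"
    proof (rule ccontr)
      assume "?J \<noteq> {}"
      moreover have "?J \<noteq> UNIV" by auto
      ultimately obtain l m where lm: "l \<in> ?J" "m \<notin> ?J" "gram l m \<noteq> 0" using connected[of ?J] by auto
      show False
      proof (cases "m = i")
        case True
        then have "curv_coeff i l = curv_coeff i j0" using lm j0 by (cases "l = j0") (auto intro!: curv_coeff_eq simp: inner_commute)
        then show False using lm by auto
      next
        case False
        then have "curv_coeff i l = curv_coeff i m" using lm by (intro curv_coeff_eq) auto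
        then show False using lm False by auto
      qed
    qed
    then show ?thesis by auto
  qed
  then obtain f where f: "\<And>i l. l \<noteq> i \<Longrightarrow> curv_coeff i l = f i" by metis
  then have "f i = f j" if "i \<noteq> j" for i j using curv_coeff_sym[OF that] that by metis
  then show ?thesis using f by (intro exI[of _ "f undefined"]) metis
qed

text \<open>The bivectors of pairs of simple roots span all bivectors, and the tensor acts on each
  of them by the same scalar.\<close>

lemma ex_curv_const: "\<exists>L. \<forall>x z y w. curv x z y w = L * ((x \<bullet> y) * (z \<bullet> w) - (x \<bullet> w) * (z \<bullet> y))"
proof -
  obtain L where L: "\<And>i j. i \<noteq> j \<Longrightarrow> curv_coeff i j = L" using ex_curv_coeff by blast
  have b: "curv (\<alpha> i) (\<alpha> j) y w = L * ((\<alpha> i \<bullet> y) * (\<alpha> j \<bullet> w) - (\<alpha> i \<bullet> w) * (\<alpha> j \<bullet> y))" for i j y w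
  proof (cases "i = j")
    case True then show ?thesis using curv_anti[of "\<alpha> i" "\<alpha> i" y w] by simp
  qed (simp add: curv_basis L)
  have lz: "linear (\<lambda>z. curv x z y w)" for x y w by (subst curv_sym) (rule curv_linear)
  have lx: "linear (\<lambda>x. curv x z y w)" for z y w
    using linear_compose_neg[OF lz[of z y w]] by (simp add: curv_anti[of z _ y w, symmetric] curv_anti[of _ z y w])
  have "curv x z y w = (\<Sum>i\<in>UNIV. \<Sum>j\<in>UNIV. (\<omega> i \<bullet> x) * ((\<omega> j \<bullet> z) * curv (\<alpha> i) (\<alpha> j) y w))" for x z y w
    by (subst expand[of x], subst expand[of z], rule trans[OF _ sum.swap])
      (simp add: linear_sum[OF lx] linear_sum[OF lz] linear_scale[OF lx] linear_scale[OF lz] sum_distrib_left mult_ac)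
  also have "\<dots> x z y w = L * ((x \<bullet> y) * (z \<bullet> w) - (x \<bullet> w) * (z \<bullet> y))" for x z y w
  proof -
    have "(\<Sum>j\<in>UNIV. (\<omega> i \<bullet> x) * ((\<omega> j \<bullet> z) * curv (\<alpha> i) (\<alpha> j) y w))
        = L * ((\<omega> i \<bullet> x) * (\<alpha> i \<bullet> y) * (z \<bullet> w) - (\<omega> i \<bullet> x) * (\<alpha> i \<bullet> w) * (z \<bullet> y))" for i
      unfolding b inner_expand[of z] by (simp add: sum_distrib_left right_diff_distrib sum_subtractf mult_ac)
    then show ?thesis unfolding inner_expand[of x]
      by (simp add: sum_distrib_left sum_distrib_right right_diff_distrib sum_subtractf mult_ac)
  qed
  finally show ?thesis by blast
qed

section \<open>The largest root\<close>

lemma close_roots_eq: assumes "\<beta> \<bullet> \<gamma> \<ge> \<beta> \<bullet> \<beta>" "\<beta> \<bullet> \<gamma> \<ge> \<gamma> \<bullet> \<gamma>" shows "\<beta> = (\<gamma> :: 'a)"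
proof -
  have "(\<beta> - \<gamma>) \<bullet> (\<beta> - \<gamma>) \<le> 0" using assms by (simp add: inner_diff_left inner_diff_right inner_commute[of \<gamma> \<beta>])
  then show ?thesis by (metis eq_iff_diff_eq_0 inner_eq_zero_iff inner_ge_zero order_antisym)
qed

lemma cartan_one_or_ge: assumes "\<beta> \<in> R" "\<gamma> \<in> R" "\<beta> \<bullet> \<gamma> > 0"
  shows "c \<beta> * (\<beta> \<bullet> \<gamma>) = 1 \<or> \<beta> \<bullet> \<gamma> \<ge> \<beta> \<bullet> \<beta>"
proof -
  obtain k where k: "c \<beta> * (\<beta> \<bullet> \<gamma>) = of_int k" using cartan_int[OF assms(1,2)] by (auto elim: Ints_cases)
  have k1: "k \<ge> 1" using cartan_ge_1[OF assms] unfolding k by simp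
  show ?thesis
  proof (cases "k = 1")
    case False
    then have "real_of_int k \<ge> 2" using k1 by linarith
    then have "c \<beta> * (\<beta> \<bullet> \<gamma>) \<ge> 2" using k by simp
    then show ?thesis using norm_pos[OF assms(1)] by (simp add: field_simps)
  qed (use k in simp)
qed

text \<open>One of the two Cartan numbers is 1: otherwise \<open>\<beta> \<bullet> \<gamma>\<close>
  is at least both squared lengths and the roots coincide. The corresponding reflection produces the
  difference up to sign.\<close>

lemma diff_root: assumes "\<beta> \<in> R" "\<gamma> \<in> R" "\<beta> \<bullet> \<gamma> > 0" "\<beta> \<noteq> \<gamma>" shows "\<beta> - \<gamma> \<in> R"
proof -
  have "c \<beta> * (\<beta> \<bullet> \<gamma>) = 1 \<or> c \<gamma> * (\<gamma> \<bullet> \<beta>) = 1"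
    using cartan_one_or_ge[OF assms(1-3)] cartan_one_or_ge[OF assms(2,1)] assms(3,4) close_roots_eq[of \<beta> \<gamma>]
    by (auto simp: inner_commute)
  then show ?thesis
  proof
    assume "c \<beta> * (\<beta> \<bullet> \<gamma>) = 1"
    then have "reflection \<beta> \<gamma> = - (\<beta> - \<gamma>)" unfolding reflection_eq by (simp only: scaleR_one minus_diff_eq)
    then show ?thesis using refl_in[OF assms(1,2)] uminus_in by (metis minus_minus)
  next
    assume "c \<gamma> * (\<gamma> \<bullet> \<beta>) = 1"
    then have "reflection \<gamma> \<beta> = \<beta> - \<gamma>" unfolding reflection_eq by (simp only: scaleR_one)
    then show ?thesis using refl_in[OF assms(2,1)] by simp
  qed
qed

section \<open>Dominant roots and existence of the largest root\<close>

definition above :: "'a \<Rightarrow> 'a \<Rightarrow> bool" where "above \<beta> \<gamma> \<longleftrightarrow> (\<forall>i. \<omega> i \<bullet> \<beta> \<le> \<omega> i \<bullet> \<gamma>)"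
definition dominant :: "'a \<Rightarrow> bool" where "dominant x \<longleftrightarrow> (\<forall>i. \<alpha> i \<bullet> x \<ge> 0)"

lemma inner_above: "above \<beta> \<gamma> \<Longrightarrow> dominant x \<Longrightarrow> \<beta> \<bullet> x \<le> \<gamma> \<bullet> x"
  unfolding inner_expand[of \<beta> x] inner_expand[of \<gamma> x] above_def dominant_def
  by (intro sum_mono mult_right_mono) auto
lemma above_s: assumes "\<alpha> i \<bullet> \<gamma> < 0" "above \<beta> \<gamma>" shows "above \<beta> (s i \<gamma>)" "ht \<gamma> < ht (s i \<gamma>)"
proof -
  have "ci i * (\<alpha> i \<bullet> \<gamma>) < 0" using assms norm_pos[OF simple_in, of i] by (simp add: mult_less_0_iff divide_less_0_iff)
  then show "ht \<gamma> < ht (s i \<gamma>)" unfolding ht_s by linarith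
  show "above \<beta> (s i \<gamma>)" unfolding above_def
  proof
    fix j show "\<omega> j \<bullet> \<beta> \<le> \<omega> j \<bullet> s i \<gamma>"
    proof (cases "i = j")
      case True
      then have "\<omega> j \<bullet> s i \<gamma> = \<omega> j \<bullet> \<gamma> - ci i * (\<alpha> i \<bullet> \<gamma>)" by (simp add: reflection_eq inner_diff_right dual)
      then show ?thesis using assms(2) \<open>ci i * (\<alpha> i \<bullet> \<gamma>) < 0\<close> unfolding above_def by (smt (verit))
    next
      case False then show ?thesis using assms(2) s_coord[OF False] unfolding above_def by simp
    qed
  qed
qed
lemma dominant_P: assumes "\<gamma> \<in> R" "dominant \<gamma>" shows "\<gamma> \<in> P"
  using P_or[OF assms(1)] ex_descent[of "-\<gamma>"] assms(2) unfolding dominant_def by (auto simp: not_less) (meson not_le)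
lemma ex_max_ht: assumes "finite A" "A \<noteq> {}" shows "\<exists>\<gamma>\<in>A. \<forall>\<delta>\<in>A. ht \<delta> \<le> ht \<gamma>"
  using assms by (metis (no_types, lifting) Max_ge Max_in finite_imageI imageE imageI image_is_empty)
text \<open>Among the roots above \<open>\<beta>\<close> of the same length, one of maximal height
  is dominant: reflecting in a simple root with negative pairing would raise the height.\<close>

lemma ex_dominant: assumes "\<beta> \<in> R"
  shows "\<exists>\<gamma>\<in>R. above \<beta> \<gamma> \<and> dominant \<gamma> \<and> \<gamma> \<bullet> \<gamma> = \<beta> \<bullet> \<beta>"
proof -
  let ?A = "{\<gamma>\<in>R. above \<beta> \<gamma> \<and> \<gamma> \<bullet> \<gamma> = \<beta> \<bullet> \<beta>}"
  have "\<beta> \<in> ?A" using assms by (auto simp: above_def)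
  then obtain \<gamma> where g: "\<gamma> \<in> ?A" "\<And>\<delta>. \<delta> \<in> ?A \<Longrightarrow> ht \<delta> \<le> ht \<gamma>" using ex_max_ht[of ?A] finite_R by auto
  have "\<not> \<alpha> i \<bullet> \<gamma> < 0" for i
  proof
    assume n: "\<alpha> i \<bullet> \<gamma> < 0"
    then have "s i \<gamma> \<in> ?A" using g(1) above_s[OF n] refl_in[OF simple_in] s_norm by auto
    then show False using g(2) above_s[OF n] g(1) by fastforce
  qed
  then show ?thesis using g(1) by (auto simp: dominant_def not_less)
qed
text \<open>At an edge from the support of \<open>\<gamma>\<close> to a node \<open>j\<close>
  outside it, all terms of \<open>\<gamma> \<bullet> \<alpha> j\<close> are nonpositive and one is
  negative, contrary to dominance.\<close>

lemma dominant_full: assumes "\<gamma> \<in> R" "dominant \<gamma>" shows "\<omega> i \<bullet> \<gamma> > 0"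
proof -
  have p: "\<gamma> \<in> P" using dominant_P assms by blast
  let ?J = "{i. \<omega> i \<bullet> \<gamma> > 0}"
  have "?J \<noteq> {}"
  proof
    assume e: "?J = {}"
    have "\<omega> i \<bullet> \<gamma> = 0" for i using p P_iff e by (metis (mono_tags) empty_iff mem_Collect_eq order_le_less)
    then have "\<gamma> = 0" by (intro inner_dual_eqI) simp
    then show False using assms root_nz by blast
  qed
  moreover have "?J = UNIV" if ne: "?J \<noteq> {}"
  proof (rule ccontr)
    assume "?J \<noteq> UNIV"
    from connected[OF ne this] obtain i j where ij: "i \<in> ?J" "j \<notin> ?J" "gram i j \<noteq> 0" by auto
    have z: "\<omega> j \<bullet> \<gamma> = 0" using ij p P_iff by (metis mem_Collect_eq order_le_less)
    have le: "(\<omega> l \<bullet> \<gamma>) * (gram l j) \<le> 0" for l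
      using p P_iff z simple_nonpos[of l j] by (cases "l = j") (auto simp: mult_nonneg_nonpos)
    have "i \<noteq> j" using ij by auto
    then have "gram i j < 0" using simple_nonpos[of i j] ij by simp
    then have lt: "(\<omega> i \<bullet> \<gamma>) * (gram i j) < 0" using ij by (simp add: mult_pos_neg)
    have "\<gamma> \<bullet> \<alpha> j = (\<omega> i \<bullet> \<gamma>) * (gram i j) + (\<Sum>l\<in>UNIV - {i}. (\<omega> l \<bullet> \<gamma>) * (gram l j))"
      unfolding inner_expand[of \<gamma> "\<alpha> j"] by (rule sum.remove) auto
    moreover have "(\<Sum>l\<in>UNIV - {i}. (\<omega> l \<bullet> \<gamma>) * (gram l j)) \<le> 0" by (rule sum_nonpos) (rule le)
    ultimately have "\<gamma> \<bullet> \<alpha> j < 0" using lt by linarith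
    then show False using assms(2) unfolding dominant_def by (metis inner_commute not_le)
  qed
  ultimately show ?thesis by auto
qed

lemma dominant_inner_pos: assumes "\<gamma> \<in> R" "dominant \<gamma>" "\<delta> \<in> R" "dominant \<delta>" shows "\<gamma> \<bullet> \<delta> > 0"
proof -
  obtain i where i: "\<alpha> i \<bullet> \<delta> > 0" using ex_descent dominant_P assms by blast
  have "\<gamma> \<bullet> \<delta> = (\<omega> i \<bullet> \<gamma>) * (\<alpha> i \<bullet> \<delta>) + (\<Sum>l\<in>UNIV - {i}. (\<omega> l \<bullet> \<gamma>) * (\<alpha> l \<bullet> \<delta>))"
    unfolding inner_expand[of \<gamma> \<delta>] by (rule sum.remove) auto
  moreover have "(\<Sum>l\<in>UNIV - {i}. (\<omega> l \<bullet> \<gamma>) * (\<alpha> l \<bullet> \<delta>)) \<ge> 0"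
    using assms dominant_full[OF assms(1,2)] unfolding dominant_def
    by (intro sum_nonneg mult_nonneg_nonneg) (auto simp: less_imp_le)
  moreover have "(\<omega> i \<bullet> \<gamma>) * (\<alpha> i \<bullet> \<delta>) > 0" using i dominant_full[OF assms(1,2)] by simp
  ultimately show ?thesis by linarith
qed

lemma P_ht_pos: assumes "\<beta> \<in> P" shows "ht \<beta> > 0"
proof -
  obtain j where "\<omega> j \<bullet> \<beta> > 0"
    using assms P_iff root_nz inner_dual_eqI[of \<beta> 0] by (metis inner_zero_right order_le_less)
  then show ?thesis unfolding ht_def using assms P_iff by (intro sum_pos2[of _ j]) auto
qed

text \<open>Take a dominant root \<open>\<theta>'\<close> above a root of maximal height and, for
  any \<open>\<beta>\<close>, a root \<open>\<gamma>\<close> of maximal height above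
  \<open>\<beta>\<close>, which is dominant as well. If they differ, their inner product is
  positive, so their difference is a root, and either sign of it contradicts one of the two
  maximality conditions.\<close>

lemma ex_largest: "\<exists>\<theta>. is_largest_root R \<alpha> \<theta>"
proof -
  obtain \<theta> where t: "\<theta> \<in> R" "\<And>\<delta>. \<delta> \<in> R \<Longrightarrow> ht \<delta> \<le> ht \<theta>"
    using ex_max_ht[of R] finite_R simple_in by blast
  obtain \<theta>' where t': "\<theta>' \<in> R" "above \<theta> \<theta>'" "dominant \<theta>'" using ex_dominant[OF t(1)] by blast
  have ab: "above \<beta> \<theta>'" if "\<beta> \<in> R" for \<beta>
  proof -
    let ?A = "{\<gamma>\<in>R. above \<beta> \<gamma>}"
    have "\<beta> \<in> ?A" using that by (auto simp: above_def)
    then obtain \<gamma> where g: "\<gamma> \<in> ?A" "\<And>\<delta>. \<delta> \<in> ?A \<Longrightarrow> ht \<delta> \<le> ht \<gamma>" using ex_max_ht[of ?A] finite_R by auto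
    have tri: "above \<gamma> \<delta> \<Longrightarrow> above \<beta> \<delta>" for \<delta> using g(1) unfolding above_def by (auto intro: order_trans)
    have "\<not> \<alpha> i \<bullet> \<gamma> < 0" for i
    proof
      assume n: "\<alpha> i \<bullet> \<gamma> < 0"
      then have "s i \<gamma> \<in> ?A" using g(1) above_s[OF n] refl_in[OF simple_in] by auto
      then show False using g(2) above_s[OF n] g(1) by fastforce
    qed
    then have dg: "dominant \<gamma>" by (auto simp: dominant_def not_less)
    have "\<gamma> = \<theta>'"
    proof (rule ccontr)
      assume ne: "\<gamma> \<noteq> \<theta>'"
      have "\<gamma> - \<theta>' \<in> R" using diff_root[OF _ t'(1) _ ne] dominant_inner_pos[of \<gamma> \<theta>'] g(1) dg t' by blast
      then show False
      proof (rule P_or[THEN disjE])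
        assume p: "\<gamma> - \<theta>' \<in> P"
        have "ht \<theta>' \<ge> ht \<theta>" using t'(2) unfolding above_def ht_def by (intro sum_mono) auto
        moreover have "ht \<gamma> \<le> ht \<theta>" using t(2) g(1) by blast
        moreover have "ht (\<gamma> - \<theta>') > 0" using P_ht_pos p by blast
        ultimately show False unfolding linear_diff[OF ht_linear] by linarith
      next
        assume p: "- (\<gamma> - \<theta>') \<in> P"
        then have "above \<gamma> \<theta>'" unfolding above_def P_iff by (simp add: inner_diff_right)
        then have "ht \<theta>' \<le> ht \<gamma>" using g(2) tri t'(1) by blast
        moreover have "ht (- (\<gamma> - \<theta>')) > 0" using P_ht_pos p by blast
        ultimately show False unfolding linear_diff[OF ht_linear] linear_neg[OF ht_linear] by linarith
      qed
    qed
    then show ?thesis using g(1) by auto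
  qed
  have "is_largest_root R \<alpha> \<theta>'" unfolding is_largest_root_def
  proof (intro conjI ballI t')
    fix \<beta> assume b: "\<beta> \<in> R"
    let ?b = "\<lambda>i. root_coords \<alpha> \<theta>' i - root_coords \<alpha> \<beta> i"
    have "int_comb \<alpha> ?b = int_comb \<alpha> (root_coords \<alpha> \<theta>') - int_comb \<alpha> (root_coords \<alpha> \<beta>)"
      by (simp add: int_comb_def scaleR_left_diff_distrib sum_subtractf)
    then have "\<theta>' - \<beta> = int_comb \<alpha> ?b" using root_coords_int_comb[OF simple] b t' by metis
    moreover have "?b i \<ge> 0" for i
      using ab[OF b] coord_root[OF b, of i] coord_root[OF t'(1), of i] unfolding above_def
      by (metis diff_ge_0_iff_ge of_int_le_iff)
    ultimately show "\<exists>b. \<theta>' - \<beta> = int_comb \<alpha> b \<and> (\<forall>i. b i \<ge> 0)" by (intro exI[of _ ?b]) auto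
  qed
  then show ?thesis by blast
qed

definition "\<theta> = largest_root R \<alpha>"

lemma theta_largest: "is_largest_root R \<alpha> \<theta>"
  using ex_largest largest_root_eqI[OF simple] unfolding \<theta>_def by metis
lemma theta_R: "\<theta> \<in> R" using theta_largest by (simp add: is_largest_root_def)
lemma theta_max: assumes "\<beta> \<in> R" shows "\<omega> i \<bullet> \<beta> \<le> \<omega> i \<bullet> \<theta>"
proof -
  obtain b where b: "\<theta> - \<beta> = int_comb \<alpha> b" "\<forall>i. b i \<ge> 0" using theta_largest assms by (auto simp: is_largest_root_def)
  have "\<omega> i \<bullet> (\<theta> - \<beta>) \<ge> 0" unfolding b(1) int_comb_inner using b(2) by simp
  then show ?thesis by (simp add: inner_diff_right)
qed
lemma theta_dom: "dominant \<theta>"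
proof -
  have "\<not> \<alpha> i \<bullet> \<theta> < 0" for i
  proof
    assume n: "\<alpha> i \<bullet> \<theta> < 0"
    have "ht (s i \<theta>) \<le> ht \<theta>" unfolding ht_def by (intro sum_mono theta_max refl_in simple_in theta_R)
    then show False using above_s(2)[OF n, of \<theta>] by (auto simp: above_def)
  qed
  then show ?thesis by (auto simp: dominant_def not_less)
qed
lemma theta_P: "\<theta> \<in> P" using dominant_P theta_R theta_dom by blast
lemma theta_simple_nonneg: "\<alpha> i \<bullet> \<theta> \<ge> 0" using theta_dom by (auto simp: dominant_def)

section \<open>Length of the largest root and its square under the product\<close>

abbreviation "d \<equiv> \<theta> \<bullet> \<theta>"
abbreviation "n i \<equiv> \<omega> i \<bullet> \<theta>"

lemma d_pos: "d > 0" using norm_pos theta_R by blast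
lemma n_ge_1: "n i \<ge> 1"
proof -
  obtain k where "n i = of_int k" using coord_int[OF theta_R] by (auto elim: Ints_cases)
  then show ?thesis using dominant_full[OF theta_R theta_dom, of i] by simp
qed
text \<open>For a dominant \<open>\<gamma>\<close> of the same length, \<open>\<gamma> \<bullet>
  \<gamma> \<le> \<theta> \<bullet> \<gamma> \<le> \<theta> \<bullet> \<theta>\<close>, because
  \<open>\<theta>\<close> is above \<open>\<gamma>\<close> and both are dominant.\<close>

lemma theta_long: assumes "\<beta> \<in> R" shows "\<beta> \<bullet> \<beta> \<le> d"
proof -
  obtain \<gamma> where g: "\<gamma> \<in> R" "dominant \<gamma>" "\<gamma> \<bullet> \<gamma> = \<beta> \<bullet> \<beta>" using ex_dominant[OF assms] by blast
  have ab: "above \<gamma> \<theta>" using theta_max g(1) by (auto simp: above_def)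
  have "\<gamma> \<bullet> \<gamma> \<le> \<theta> \<bullet> \<gamma>" using inner_above[OF ab g(2)] .
  also have "\<dots> = \<gamma> \<bullet> \<theta>" by (rule inner_commute)
  also have "\<dots> \<le> d" using inner_above[OF ab theta_dom] .
  finally show ?thesis using g by simp
qed
text \<open>Since \<open>\<beta>\<close> has maximal length, a Cartan number other than 1 would
  force the two roots to coincide.\<close>

lemma long_pair: assumes "\<beta> \<in> R" "\<gamma> \<in> R" "\<beta> \<bullet> \<beta> = d" "\<beta> \<bullet> \<gamma> > 0" "\<beta> \<noteq> \<gamma>" shows "\<beta> \<bullet> \<gamma> = d / 2"
proof -
  have "c \<beta> * (\<beta> \<bullet> \<gamma>) = 1"
    using cartan_one_or_ge[OF assms(1,2,4)] close_roots_eq[of \<beta> \<gamma>] theta_long[OF assms(2)] assms(3,5) by auto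
  then show ?thesis using d_pos assms(3) by (simp add: field_simps)
qed
lemma theta_pair: assumes "\<beta> \<in> P" "\<beta> \<noteq> \<theta>" "\<theta> \<bullet> \<beta> \<noteq> 0" shows "\<theta> \<bullet> \<beta> = d / 2"
proof -
  have "\<theta> \<bullet> \<beta> \<ge> 0" unfolding inner_commute[of \<theta>] inner_expand[of \<beta> \<theta>]
    using assms(1) theta_simple_nonneg by (intro sum_nonneg) (auto simp: P_iff)
  then show ?thesis using assms P_subset by (intro long_pair theta_R) auto
qed

text \<open>Besides \<open>\<theta>\<close> only the roots \<open>\<beta>\<close> with
  \<open>\<theta> \<bullet> \<beta> = d / 2\<close> contribute. Sending \<open>\<beta>\<close> to
  \<open>\<theta> - \<beta>\<close> permutes them and keeps lengths, so their weighted sum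
  \<open>X\<close> equals the total weight times \<open>\<theta>\<close> minus
  \<open>X\<close>.\<close>

lemma cprod_theta_parallel: "\<exists>\<mu>. cprod \<theta> \<theta> = \<mu> *\<^sub>R \<theta>"
proof -
  let ?B = "{\<beta>\<in>P. \<beta> \<noteq> \<theta> \<and> \<theta> \<bullet> \<beta> = d / 2}"
  have fin: "finite ?B" using finite_P by simp
  have flip: "\<theta> - \<beta> \<in> ?B" "c (\<theta> - \<beta>) = c \<beta>" if "\<beta> \<in> ?B" for \<beta>
  proof -
    have b: "\<beta> \<in> R" "\<theta> \<bullet> \<beta> = d / 2" "\<beta> \<noteq> \<theta>" using that P_subset by auto
    have "\<theta> - \<beta> \<in> R" using diff_root[OF theta_R b(1)] b d_pos by auto
    moreover have "\<omega> i \<bullet> (\<theta> - \<beta>) \<ge> 0" for i using theta_max[OF b(1)] by (simp add: inner_diff_right)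
    ultimately have "\<theta> - \<beta> \<in> P" using P_iff by blast
    moreover have "\<theta> \<bullet> (\<theta> - \<beta>) = d / 2" using b by (simp add: inner_diff_right)
    moreover have "\<theta> - \<beta> \<noteq> \<theta>" using root_nz[OF b(1)] by simp
    ultimately show "\<theta> - \<beta> \<in> ?B" by blast
    show "c (\<theta> - \<beta>) = c \<beta>" using b(2) by (simp add: inner_diff_left inner_diff_right inner_commute[of \<beta> \<theta>])
  qed
  define X where "X = (\<Sum>\<beta>\<in>?B. c \<beta> *\<^sub>R \<beta>)"
  have "X = (\<Sum>\<beta>\<in>?B. c (\<theta> - \<beta>) *\<^sub>R (\<theta> - \<beta>))"
    unfolding X_def by (rule sum.reindex_bij_witness[of _ "\<lambda>\<beta>. \<theta> - \<beta>" "\<lambda>\<beta>. \<theta> - \<beta>"]) (use flip in auto)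
  also have "\<dots> = (\<Sum>\<beta>\<in>?B. c \<beta> *\<^sub>R \<theta> - c \<beta> *\<^sub>R \<beta>)"
    by (rule sum.cong) (use flip(2) in \<open>auto simp: scaleR_right_diff_distrib\<close>)
  also have "\<dots> = (\<Sum>\<beta>\<in>?B. c \<beta>) *\<^sub>R \<theta> - X" by (simp add: sum_subtractf X_def scaleR_left.sum)
  finally have X: "X = ((\<Sum>\<beta>\<in>?B. c \<beta>) / 2) *\<^sub>R \<theta>"
    by (metis (no_types, lifting) add_diff_cancel_right' diff_add_cancel divide_inverse_commute inverse_eq_divide scaleR_2
        scaleR_half_double scaleR_scaleR)
  let ?f = "\<lambda>\<beta>. (c \<beta> * (\<theta> \<bullet> \<beta>) * (\<theta> \<bullet> \<beta>)) *\<^sub>R \<beta>"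
  have "cprod \<theta> \<theta> = ?f \<theta> + sum ?f (P - {\<theta>})" unfolding cprod_def by (rule sum.remove[OF finite_P theta_P])
  also have "sum ?f (P - {\<theta>}) = sum ?f ?B"
    by (rule sum.mono_neutral_right) (use finite_P theta_pair in auto)
  also have "sum ?f ?B = (d/2)^2 *\<^sub>R X" unfolding X_def scaleR_sum_right
  proof (rule sum.cong)
    fix \<beta> assume "\<beta> \<in> ?B"
    then have h: "\<theta> \<bullet> \<beta> = d / 2" by simp
    show "?f \<beta> = (d/2)^2 *\<^sub>R c \<beta> *\<^sub>R \<beta>" unfolding h by (simp add: power2_eq_square)
  qed simp
  finally have "cprod \<theta> \<theta> = (c \<theta> * d * d + (d/2)^2 * ((\<Sum>\<beta>\<in>?B. c \<beta>) / 2)) *\<^sub>R \<theta>"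
    unfolding X scaleR_scaleR scaleR_left_distrib[symmetric] .
  then show ?thesis by blast
qed

definition "\<mu> = (cprod \<theta> \<theta> \<bullet> \<theta>) / d"
lemma cprod_theta_theta: "cprod \<theta> \<theta> = \<mu> *\<^sub>R \<theta>"
  using cprod_theta_parallel d_pos unfolding \<mu>_def by auto

text \<open>The value is the summand of \<open>\<alpha> i\<close> alone; the remaining ones cancel
  under \<open>s i\<close>.\<close>

lemma tri_simple: "cprod (\<alpha> i) (\<alpha> i) \<bullet> \<alpha> i = 2 * (gram i i)^2"
proof -
  have d: "gram i i \<noteq> 0" using simple_nz by simp
  let ?v = "cprod (\<alpha> i) (\<alpha> i)"
  have "?v = s i ?v + (2 * ci i * (gram i i) * (gram i i)) *\<^sub>R \<alpha> i"
    using cprod_reflection[of i "\<alpha> i" "\<alpha> i"] by (simp add: reflection_self[OF simple_nz] cprod_simps)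
  then have "?v \<bullet> \<alpha> i = s i ?v \<bullet> \<alpha> i + (2 * ci i * (gram i i) * (gram i i)) * (gram i i)"
    by (metis inner_add_left inner_scaleR_left)
  also have "s i ?v \<bullet> \<alpha> i = - (?v \<bullet> \<alpha> i)"
    by (simp add: reflection_adjoint[OF simple_nz] reflection_self[OF simple_nz])
  finally show ?thesis using d by (simp add: power2_eq_square)
qed

lemma cubic_s: "cprod (s i x) (s i x) \<bullet> s i x = cprod x x \<bullet> x - 2 * ci i * (\<alpha> i \<bullet> x)^3"
proof -
  have "\<alpha> i \<bullet> s i x = - (\<alpha> i \<bullet> x)"
    by (simp add: reflection_adjoint[OF simple_nz, symmetric] reflection_self[OF simple_nz])
  then show ?thesis
    unfolding cprod_reflection inner_add_left reflection_inner[OF simple_nz] inner_scaleR_left by (simp add: power3_eq_cube)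
qed

text \<open>A step of \<open>P_induct\<close> keeps the length and has
  \<open>\<alpha> i \<bullet> \<beta> = d / 2\<close>, so by \<open>cubic_s\<close> and
  \<open>ht_s\<close> the cubic form and the height change proportionally.\<close>

lemma cubic_long: assumes "\<beta> \<in> P" "\<beta> \<bullet> \<beta> = d" shows "cprod \<beta> \<beta> \<bullet> \<beta> = d^2 / 2 * (ht \<beta> + 3)"
  using assms
proof (induction rule: P_induct)
  case (simple i)
  then show ?case by (simp add: tri_simple ht_simple)
next
  case (step \<beta> i)
  have h: "\<alpha> i \<bullet> \<beta> = d / 2"
    using long_pair[of \<beta> "\<alpha> i"] step.hyps step.prems P_subset simple_in by (auto simp: inner_commute)
  have "cprod (s i \<beta>) (s i \<beta>) \<bullet> s i \<beta> = d^2 / 2 * (ht (s i \<beta>) + 3)"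
    using step.IH step.prems s_norm by simp
  then have "cprod \<beta> \<beta> \<bullet> \<beta> = d^2 / 2 * (ht \<beta> - ci i * (d/2) + 3) + 2 * ci i * (d/2)^3"
    unfolding cubic_s ht_s h by linarith
  then show ?case by (simp add: power2_eq_square power3_eq_cube algebra_simps)
qed

lemma mu_eq: "\<mu> = d / 2 * (ht \<theta> + 3)"
  using cubic_long[OF theta_P refl] d_pos by (simp add: \<mu>_def power2_eq_square)

lemma eps_eq: "eps R \<alpha> = d / 2 + (\<Sum>i\<in>UNIV. (n i)^2 * (gram i i)) / 2"
  unfolding eps_def \<theta>_def[symmetric] coord_root[OF theta_R] ..

lemma eps_pos: "eps R \<alpha> > 0"
  unfolding eps_eq using d_pos by (intro add_pos_nonneg) (auto intro!: divide_nonneg_pos sum_nonneg)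

section \<open>Products of simple roots\<close>

abbreviation "trit i j \<equiv> cprod \<theta> (\<alpha> i) \<bullet> \<alpha> j"
abbreviation "tri i j k \<equiv> cprod (\<alpha> i) (\<alpha> j) \<bullet> \<alpha> k"
text \<open>The sign is opposite to that of the usual Cartan matrix, so that the off-diagonal
  entries are nonnegative.\<close>

definition "cartan i j = - (ci i * (gram i j))"

lemma tri_perm: "tri i j k = tri j i k" "tri i j k = tri i k j"
  by (simp add: cprod_comm) (rule tri_sym)

lemma simple_pos: "gram i i > 0" using norm_pos simple_in by blast

lemma cartan_nonneg: "i \<noteq> j \<Longrightarrow> cartan i j \<ge> 0"
  using simple_nonpos[of i j] simple_pos[of i] by (simp add: cartan_def divide_nonpos_pos)
lemma cartan_in_Ints: "cartan i j \<in> \<int>" unfolding cartan_def using cartan_int[OF simple_in simple_in] by (rule Ints_minus)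
lemma cartan_eq_0: "cartan i j = 0 \<longleftrightarrow> gram i j = 0" using simple_pos[of i] by (simp add: cartan_def)
lemma Int_pos_ge_1: "x \<in> \<int> \<Longrightarrow> x > 0 \<Longrightarrow> x \<ge> (1::real)" by (auto elim!: Ints_cases)
lemma Int_gt_1_ge_2: "x \<in> \<int> \<Longrightarrow> x > 1 \<Longrightarrow> x \<ge> (2::real)" by (auto elim!: Ints_cases)
lemma cartan_ge1: "i \<noteq> j \<Longrightarrow> gram i j \<noteq> 0 \<Longrightarrow> cartan i j \<ge> 1"
  using cartan_nonneg[of i j] cartan_eq_0[of i j] by (intro Int_pos_ge_1 cartan_in_Ints) auto
text \<open>If both entries were at least 2, \<open>close_roots_eq\<close> would identify
  \<open>\<alpha> i\<close> with \<open>- \<alpha> j\<close>, a positive root with a negative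
  one.\<close>

lemma cartan_one: assumes "i \<noteq> j" "gram i j \<noteq> 0" shows "cartan i j = 1 \<or> cartan j i = 1"
proof (rule ccontr)
  assume n: "\<not> ?thesis"
  have g: "gram j i \<noteq> 0" using assms(2) by (simp add: inner_commute)
  have 1: "cartan i j > 1" using n cartan_ge1[OF assms] by linarith
  have 2: "cartan j i > 1" using n cartan_ge1[OF assms(1)[symmetric] g] by linarith
  have "cartan i j \<ge> 2" "cartan j i \<ge> 2" using Int_gt_1_ge_2[OF cartan_in_Ints 1] Int_gt_1_ge_2[OF cartan_in_Ints 2] by auto
  then have "\<alpha> i \<bullet> - \<alpha> j \<ge> gram i i" "\<alpha> i \<bullet> - \<alpha> j \<ge> - \<alpha> j \<bullet> - \<alpha> j"
    using simple_pos by (simp_all add: cartan_def field_simps inner_commute[of "\<alpha> j" "\<alpha> i"])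
  then have "\<alpha> i = - \<alpha> j" by (rule close_roots_eq)
  then show False using simple_P P_not_both by metis
qed

text \<open>By \<open>cprod_orth\<close> the product is a multiple of \<open>\<alpha> i\<close> and
  also of \<open>\<alpha> j\<close>.\<close>

lemma cprod_orth_simple: assumes "i \<noteq> j" "gram i j = 0" shows "cprod (\<alpha> i) (\<alpha> j) = 0"
proof -
  have "\<omega> l \<bullet> cprod (\<alpha> i) (\<alpha> j) = 0" for l
  proof (cases "l = j")
    case False
    then show ?thesis using assms by (subst cprod_orth[of j "\<alpha> i"]) (auto simp: inner_commute[of "\<alpha> j" "\<alpha> i"] dual)
  next
    case True
    then show ?thesis using assms by (subst cprod_comm, subst cprod_orth[of i "\<alpha> j"]) (auto simp: dual)
  qed
  then show ?thesis by (intro inner_dual_eqI) simp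
qed

text \<open>\<open>cubic_s\<close> compares the cubic form at \<open>\<alpha> j\<close> with that at
  its mirror image \<open>\<alpha> j + cartan i j *\<^sub>R \<alpha> i\<close>; after expansion the
  factor \<open>cartan i j\<close> is cancelled.\<close>

lemma edge_rel: assumes "i \<noteq> j" shows "tri j j i + cartan i j * tri i i j = - 2 * (gram i j)^2"
proof (cases "gram i j = 0")
  case True
  have "tri j j i = 0" "tri i i j = 0"
    using cprod_orth_simple[OF assms True] tri_perm(2)[of i i j] tri_perm(2)[of j j i] tri_perm(1)[of j i j] by auto
  then show ?thesis using True by simp
next
  case False
  let ?g = "gram i j" let ?a = "cartan i j" let ?c = "ci i"
  have sj: "s i (\<alpha> j) = \<alpha> j + ?a *\<^sub>R \<alpha> i" by (simp add: reflection_eq cartan_def)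
  have "cprod (\<alpha> j + ?a *\<^sub>R \<alpha> i) (\<alpha> j + ?a *\<^sub>R \<alpha> i) \<bullet> (\<alpha> j + ?a *\<^sub>R \<alpha> i)
    = tri j j j + 3 * ?a * tri j j i + 3 * ?a^2 * tri i i j + ?a^3 * tri i i i"
    using tri_perm[of i j i] tri_perm[of j i j] tri_perm[of i j j] tri_perm[of j i i]
    by (simp add: cprod_simps inner_add_left inner_add_right power2_eq_square power3_eq_cube algebra_simps)
  moreover have "cprod (s i (\<alpha> j)) (s i (\<alpha> j)) \<bullet> s i (\<alpha> j) = tri j j j - 2 * ?c * ?g^3" by (rule cubic_s)
  ultimately have e: "3 * ?a * tri j j i + 3 * ?a^2 * tri i i j + ?a^3 * tri i i i = - 2 * ?c * ?g^3" unfolding sj by linarith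
  have t: "?a * ?a * tri i i i = 8 * ?g^2"
    unfolding tri_simple cartan_def using simple_pos[of i] by (simp add: power2_eq_square)
  have cg: "?c * ?g = - ?a" by (simp add: cartan_def)
  have "?a * (3 * tri j j i + 3 * ?a * tri i i j + ?a * ?a * tri i i i) = - 2 * (?c * ?g) * (?g * ?g)"
    using e by (simp only: power2_eq_square power3_eq_cube algebra_simps)
  then have "?a * (3 * tri j j i + 3 * ?a * tri i i j + 8 * ?g^2) = ?a * (2 * ?g^2)"
    unfolding t cg by (simp add: power2_eq_square)
  moreover have "?a \<noteq> 0" using False cartan_eq_0 by blast
  ultimately show ?thesis by simp
qed

lemma edge_sum: assumes "i \<noteq> j" shows "ci i * tri i i j + ci j * tri j j i = 2 * (gram i j)"
proof (cases "gram i j = 0")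
  case True
  have "tri j j i = 0" "tri i i j = 0"
    using cprod_orth_simple[OF assms True] tri_perm(2)[of i i j] tri_perm(2)[of j j i] tri_perm(1)[of j i j] by auto
  then show ?thesis using True by simp
next
  case False
  let ?g = "gram i j"
  have 1: "tri j j i + cartan i j * tri i i j = - 2 * ?g^2" using edge_rel[OF assms] .
  have 2: "tri i i j + cartan j i * tri j j i = - 2 * ?g^2" using edge_rel[OF assms[symmetric]] by (simp add: inner_commute)
  \<comment> \<open>An entry equal to 1 can be inserted as a coefficient:
    \<open>cartan i j = 1\<close> turns relation \<open>2\<close> into this one,
    \<open>cartan j i = 1\<close> relation \<open>1\<close>.\<close>
  have 3: "cartan i j * tri i i j + cartan j i * tri j j i = - 2 * ?g^2"
    using cartan_one[OF assms False] 1 2 by auto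
  have "?g * (ci i * tri i i j + ci j * tri j j i) = - (cartan i j * tri i i j + cartan j i * tri j j i)"
    by (simp add: cartan_def inner_commute[of "\<alpha> j" "\<alpha> i"] algebra_simps)
  then have "?g * (ci i * tri i i j + ci j * tri j j i) = ?g * (2 * ?g)"
    unfolding 3 by (simp add: power2_eq_square)
  then show ?thesis using False mult_left_cancel by blast
qed

text \<open>Unit vectors along adjacent simple roots have inner product at most -1/2. The sum of
  three such vectors would have nonpositive squared length, hence be 0, contrary to linear
  independence.\<close>

lemma no_triangle: assumes "i \<noteq> j" "i \<noteq> k" "j \<noteq> k" "gram i j \<noteq> 0" "gram i k \<noteq> 0" shows "gram j k = 0"
proof (rule ccontr)
  assume jk: "gram j k \<noteq> 0"
  define e where "e i = (1 / norm (\<alpha> i)) *\<^sub>R \<alpha> i" for i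
  have n0: "norm (\<alpha> i) > 0" for i using simple_nz by simp
  have ee: "e i \<bullet> e i = 1" for i using simple_nz[of i] by (simp add: e_def dot_square_norm power2_eq_square)
  have le: "e i \<bullet> e j \<le> - 1/2" if ij: "i \<noteq> j" "gram i j \<noteq> 0" for i j
  proof -
    have "gram j i \<noteq> 0" using ij by (simp add: inner_commute)
    then have "1 * 1 \<le> cartan i j * cartan j i" using cartan_ge1[OF ij] cartan_ge1[of j i] ij by (intro mult_mono) auto
    also have "cartan i j * cartan j i = 4 * (e i \<bullet> e j)^2"
      by (simp add: cartan_def e_def inner_commute[of "\<alpha> j" "\<alpha> i"] dot_square_norm power2_eq_square)
    finally have "(1/2)^2 \<le> (- (e i \<bullet> e j))^2" by (simp add: power2_eq_square)
    moreover have "- (e i \<bullet> e j) \<ge> 0" using simple_nonpos[OF ij(1)] n0 by (simp add: e_def divide_nonpos_pos)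
    ultimately have "1/2 \<le> - (e i \<bullet> e j)" by (rule power2_le_imp_le)
    then show ?thesis by simp
  qed
  let ?x = "e i + e j + e k"
  have "?x \<bullet> ?x = 3 + 2 * (e i \<bullet> e j) + 2 * (e i \<bullet> e k) + 2 * (e j \<bullet> e k)"
    by (simp add: inner_add_left inner_add_right ee inner_commute[of "e j" "e i"] inner_commute[of "e k" "e i"] inner_commute[of "e k" "e j"])
  also have "\<dots> \<le> 0" using le[OF assms(1,4)] le[OF assms(2,5)] le[OF assms(3) jk] by linarith
  finally have "?x \<bullet> ?x \<le> 0" .
  then have "?x = 0" by (metis inner_eq_zero_iff inner_ge_zero order_antisym)
  then have "\<omega> i \<bullet> ?x = 0" by simp
  then show False using assms(1,2) simple_nz by (simp add: e_def inner_add_right dual)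
qed

lemma tri_distinct: assumes "i \<noteq> j" "i \<noteq> k" "j \<noteq> k" shows "tri i j k = 0"
proof -
  have "gram i j = 0 \<or> gram i k = 0 \<or> gram j k = 0" using no_triangle assms by blast
  moreover have "tri i j k = tri i k j" "tri i j k = tri j k i" using tri_perm(2)[of i j k] tri_perm(1)[of i j k] tri_perm(2)[of j i k] by auto
  ultimately show ?thesis using cprod_orth_simple assms by fastforce
qed

lemma tri_theta_expand: "cprod \<theta> x \<bullet> y = (\<Sum>i\<in>UNIV. n i * (cprod (\<alpha> i) x \<bullet> y))"
  by (subst expand[of \<theta>]) (simp add: linear_sum[OF cprod_linear'] linear_scale[OF cprod_linear'] inner_sum_left)

text \<open>The double sum is symmetrised in \<open>i\<close> and \<open>j\<close>, then evaluated
  by \<open>edge_sum\<close> off the diagonal and by \<open>tri_simple\<close> on it. The diagonal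
  exceeds the off-diagonal pattern by \<open>6 * ((n i)^2 * gram i i)\<close>, which supplies the
  second sum in \<open>eps\<close>.\<close>

lemma norm_sum: "(\<Sum>i\<in>UNIV. n i * ci i * (trit i i)) = 6 * eps R \<alpha> - 2 * d"
proof -
  let ?f = "\<lambda>i j. n i * n j * (ci i * tri i i j)"
  let ?N = "\<Sum>i\<in>UNIV. (n i)^2 * (gram i i)"
  have "n i * ci i * (trit i i) = (\<Sum>j\<in>UNIV. ?f i j)" for i
    unfolding tri_theta_expand sum_distrib_left
    by (rule sum.cong) (simp_all add: tri_sym'[of "\<alpha> i" "\<alpha> i"] mult_ac)
  then have S: "(\<Sum>i\<in>UNIV. n i * ci i * (trit i i)) = (\<Sum>i\<in>UNIV. \<Sum>j\<in>UNIV. ?f i j)" by simp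
  have e: "?f i j + ?f j i = n i * n j * (2 * (gram i j)) + (if j = i then 6 * ((n i)^2 * (gram i i)) else 0)" for i j
  proof (cases "i = j")
    case True
    have "ci i * tri i i i = 4 * (gram i i)" unfolding tri_simple using simple_pos[of i] by (simp add: power2_eq_square)
    then show ?thesis using True by (simp add: power2_eq_square)
  next
    case False
    have "?f i j + ?f j i = n i * n j * (ci i * tri i i j + ci j * tri j j i)" by (simp add: algebra_simps)
    then show ?thesis unfolding edge_sum[OF False] using False by simp
  qed
  have dd: "d = (\<Sum>i\<in>UNIV. \<Sum>j\<in>UNIV. n i * n j * (gram i j))"
  proof -
    have "d = (\<Sum>i\<in>UNIV. n i * (\<alpha> i \<bullet> \<theta>))" by (rule inner_expand)
    also have "\<dots> = (\<Sum>i\<in>UNIV. n i * (\<Sum>j\<in>UNIV. n j * (gram j i)))"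
    proof (rule sum.cong[OF refl])
      fix i
      have "\<alpha> i \<bullet> \<theta> = (\<Sum>j\<in>UNIV. n j * (gram j i))" by (subst inner_commute) (rule inner_expand)
      then show "n i * (\<alpha> i \<bullet> \<theta>) = n i * (\<Sum>j\<in>UNIV. n j * (gram j i))" by simp
    qed
    finally show ?thesis by (simp add: sum_distrib_left inner_commute[of "\<alpha> _" "\<alpha> _"] mult_ac)
  qed
  have "2 * (\<Sum>i\<in>UNIV. \<Sum>j\<in>UNIV. ?f i j) = (\<Sum>i\<in>UNIV. \<Sum>j\<in>UNIV. ?f i j) + (\<Sum>i\<in>UNIV. \<Sum>j\<in>UNIV. ?f j i)"
    using sum.swap[of "\<lambda>i j. ?f j i" UNIV UNIV] by simp
  also have "\<dots> = (\<Sum>i\<in>UNIV. \<Sum>j\<in>UNIV. ?f i j + ?f j i)" by (simp add: sum.distrib)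
  also have "\<dots> = (\<Sum>i\<in>UNIV. (\<Sum>j\<in>UNIV. n i * n j * (2 * (gram i j))) + 6 * ((n i)^2 * (gram i i)))"
    unfolding e by (simp add: sum.distrib)
  also have "\<dots> = 2 * (\<Sum>i\<in>UNIV. \<Sum>j\<in>UNIV. n i * n j * (gram i j)) + 6 * ?N"
    by (simp add: sum.distrib sum_distrib_left mult_ac)
  finally show ?thesis unfolding S eps_eq dd[symmetric] by simp
qed

end

section \<open>The value of the curvature\<close>

locale curved_roots = irreducible_roots R \<alpha>
  for R :: "'a :: euclidean_space set" and \<alpha> :: "'n :: finite \<Rightarrow> 'a" +
  fixes L :: real
  assumes curv_const: "curv x z y w = L * ((x \<bullet> y) * (z \<bullet> w) - (x \<bullet> w) * (z \<bullet> y))"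
    and rank_ge_2: "\<exists>i j. i \<noteq> (j :: 'n)"
begin

text \<open>
  \<open>U\<close>, \<open>M j\<close> and \<open>\<Lambda>\<close> are \<open>\<mu>\<close>, the eigenvalue of \<open>cprod \<theta>\<close> at \<open>\<alpha> j\<close> and \<open>L\<close>, scaled by \<open>2 / d\<close>. The
  interpretation of \<open>M j\<close> as an eigenvalue is valid for \<open>j\<close> in \<open>Z\<close>, the nodes orthogonal to \<open>\<theta>\<close>.
\<close>

definition "U = ht \<theta> + 3"
definition "M j = 2 / d * ((trit j j) / (gram j j))"
definition "\<Lambda> = 2 * L / d"
definition "Z = {j. \<alpha> j \<bullet> \<theta> = 0}"
definition "\<kappa> k = ci k * (\<alpha> k \<bullet> \<theta>)"

lemma mu_U: "\<mu> = d / 2 * U" by (simp add: mu_eq U_def)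

lemma ne_theta: "\<alpha> k \<noteq> \<theta>"
proof
  assume e: "\<alpha> k = \<theta>"
  obtain j where "j \<noteq> k" using rank_ge_2 by metis
  then have "\<omega> j \<bullet> \<alpha> k = 0" by (simp add: dual)
  then show False using n_ge_1[of j] e by simp
qed

lemma inner_theta_half: "k \<notin> Z \<Longrightarrow> \<alpha> k \<bullet> \<theta> = d / 2"
  using theta_pair[OF simple_P ne_theta, of k] by (simp add: Z_def inner_commute)

lemma kappa: assumes "k \<notin> Z" shows "\<kappa> k = ci k * (d / 2)" "\<kappa> k \<ge> 1" "\<kappa> k \<in> \<int>"
proof -
  show "\<kappa> k = ci k * (d / 2)" by (simp only: \<kappa>_def inner_theta_half[OF assms])
  show "\<kappa> k \<in> \<int>" unfolding \<kappa>_def using cartan_int simple_in theta_R by blast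
  show "\<kappa> k \<ge> 1" unfolding \<kappa>_def using inner_theta_half[OF assms] d_pos by (intro cartan_ge_1 simple_in theta_R) linarith
qed

lemma sum_n: "(\<Sum>i\<in>UNIV. n i) = U - 3" by (simp add: U_def ht_def)

text \<open>In the expansion of \<open>\<theta> \<bullet> \<theta>\<close> each node
  \<open>k\<close> outside \<open>Z\<close> contributes \<open>n k * (d / 2)\<close>. As
  \<open>n k \<ge> 1\<close>, there is either one such node, of weight 2, or there are two of weight
  1.\<close>

lemma sum_K: "(\<Sum>k\<in>-Z. n k) = 2"
proof -
  have "d = (\<Sum>i\<in>UNIV. n i * (\<alpha> i \<bullet> \<theta>))" by (rule inner_expand)
  also have "\<dots> = (\<Sum>i\<in>-Z. n i * (\<alpha> i \<bullet> \<theta>))" by (rule sum.mono_neutral_right) (auto simp: Z_def)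
  also have "\<dots> = (\<Sum>i\<in>-Z. n i * (d / 2))"
  proof (rule sum.cong[OF refl])
    fix i assume "i \<in> -Z" then show "n i * (\<alpha> i \<bullet> \<theta>) = n i * (d / 2)" using inner_theta_half[of i] by simp
  qed
  also have "\<dots> = (\<Sum>k\<in>-Z. n k) * (d / 2)" by (simp add: sum_distrib_right)
  finally show ?thesis using d_pos by (simp add: field_simps)
qed

lemma sum_Z: "(\<Sum>j\<in>Z. n j) = U - 5"
proof -
  have "(\<Sum>i\<in>UNIV. n i) = (\<Sum>j\<in>Z. n j) + (\<Sum>k\<in>-Z. n k)"
    using sum.union_disjoint[of Z "-Z" n] by (simp add: Compl_partition)
  then show ?thesis using sum_n sum_K by simp
qed

section \<open>Eigenvalues at the nodes orthogonal to the largest root\<close>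

lemma cprod_Z: assumes "j \<in> Z" shows "cprod \<theta> (\<alpha> j) = (d / 2 * M j) *\<^sub>R \<alpha> j"
  using cprod_orth[of j \<theta>] assms d_pos by (simp add: Z_def M_def)

text \<open>Evaluates \<open>curv \<theta> (\<alpha> j) \<theta> (\<alpha> j)\<close> by constancy
  of the curvature and by the eigenvalues of \<open>cprod \<theta>\<close>.\<close>

lemma M_quadratic: assumes "j \<in> Z" shows "2 * \<Lambda> = M j * (U - M j)"
proof -
  let ?dj = "gram j j"
  have "curv \<theta> (\<alpha> j) \<theta> (\<alpha> j) = L * (d * ?dj)"
    using assms unfolding curv_const by (simp add: Z_def inner_commute)
  moreover have "curv \<theta> (\<alpha> j) \<theta> (\<alpha> j) = (d / 2)^2 * (U * M j - M j * M j) * ?dj"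
  proof -
    have "cprod \<theta> \<theta> \<bullet> cprod (\<alpha> j) (\<alpha> j) = \<mu> * (trit j j)"
      unfolding cprod_theta_theta using tri_sym'[of "\<alpha> j" "\<alpha> j" \<theta>] by (simp add: inner_commute)
    then show ?thesis
      unfolding curv_def mu_U cprod_Z[OF assms] by (simp add: power2_eq_square algebra_simps)
  qed
  ultimately have "L * d = (d / 2)^2 * (U * M j - M j * M j)" using simple_pos[of j] by simp
  then have "d * (4 * L) = d * (d * (M j * (U - M j)))" by (simp add: power2_eq_square algebra_simps)
  then have "4 * L = d * (M j * (U - M j))" using d_pos by simp
  then show ?thesis using d_pos unfolding \<Lambda>_def by (simp add: field_simps)
qed

lemma M_nonneg: "M j \<ge> 0"
proof -
  have "trit j j \<ge> 0" unfolding tri_eq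
  proof (rule sum_nonneg)
    fix \<beta> assume b: "\<beta> \<in> P"
    have "\<theta> \<bullet> \<beta> \<ge> 0" unfolding inner_commute[of \<theta>] inner_expand[of \<beta> \<theta>]
      using b theta_simple_nonneg by (intro sum_nonneg) (auto simp: P_iff)
    then show "0 \<le> c \<beta> * (\<theta> \<bullet> \<beta>) * (\<alpha> j \<bullet> \<beta>) * (\<alpha> j \<bullet> \<beta>)"
      by (simp add: mult.assoc)
  qed
  then show ?thesis unfolding M_def using d_pos simple_pos[of j] by simp
qed

text \<open>Eigenvectors of the symmetric operator \<open>cprod \<theta>\<close> that are not
  orthogonal share their eigenvalue.\<close>

lemma M_adjacent: assumes "i \<in> Z" "j \<in> Z" "gram i j \<noteq> 0" shows "M i = M j"
proof -
  have "trit i j = trit j i" by (rule tri_sym)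
  then show ?thesis unfolding cprod_Z[OF assms(1)] cprod_Z[OF assms(2)] using assms(3) d_pos by (simp add: inner_commute)
qed

text \<open>This is \<open>cprod_reflection\<close> with
  \<open>s k \<theta> = \<theta> - \<kappa> k *\<^sub>R \<alpha> k\<close>. Pairing it with
  \<open>\<theta>\<close> gives \<open>K_diag\<close>, pairing it with \<open>\<alpha> j\<close>
  gives \<open>edge_A\<close>.\<close>

lemma K_reflect: assumes "k \<notin> Z"
  shows "2 *\<^sub>R cprod \<theta> (\<alpha> k) = \<kappa> k *\<^sub>R cprod (\<alpha> k) (\<alpha> k) + (ci k * (trit k k) - 2 * d) *\<^sub>R \<alpha> k"
proof -
  have ck: "ci k * (gram k k) = 2" using simple_pos[of k] by simp
  have st: "s k \<theta> = \<theta> - \<kappa> k *\<^sub>R \<alpha> k" by (simp only: reflection_eq \<kappa>_def)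
  have "cprod (s k \<theta>) (s k (\<alpha> k)) = s k (cprod \<theta> (\<alpha> k)) + (2 * (ci k * (gram k k)) * (\<alpha> k \<bullet> \<theta>)) *\<^sub>R \<alpha> k"
    using cprod_reflection[of k \<theta> "\<alpha> k"] by (simp only: mult_ac)
  then have "- cprod \<theta> (\<alpha> k) + \<kappa> k *\<^sub>R cprod (\<alpha> k) (\<alpha> k) = s k (cprod \<theta> (\<alpha> k)) + (2 * d) *\<^sub>R \<alpha> k"
    unfolding ck inner_theta_half[OF assms] st reflection_self[OF simple_nz] by (simp add: cprod_simps)
  then have "- cprod \<theta> (\<alpha> k) + \<kappa> k *\<^sub>R cprod (\<alpha> k) (\<alpha> k)
    = cprod \<theta> (\<alpha> k) - (ci k * (trit k k)) *\<^sub>R \<alpha> k + (2 * d) *\<^sub>R \<alpha> k"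
    unfolding reflection_eq inner_commute[of "\<alpha> k" "cprod \<theta> (\<alpha> k)"] .
  then show ?thesis by (simp add: scaleR_2 algebra_simps)
qed

lemma K_diag: assumes "k \<notin> Z" shows "ci k * (trit k k) = d / 2 * (U + 2)"
proof -
  let ?X = "trit k k"
  have 1: "cprod \<theta> (\<alpha> k) \<bullet> \<theta> = \<mu> * (d / 2)"
    using tri_sym[of \<theta> "\<alpha> k" \<theta>] inner_theta_half[OF assms] by (simp add: cprod_theta_theta inner_commute)
  have 2: "cprod (\<alpha> k) (\<alpha> k) \<bullet> \<theta> = ?X" by (rule tri_sym')
  have "2 * (cprod \<theta> (\<alpha> k) \<bullet> \<theta>) = \<kappa> k * (cprod (\<alpha> k) (\<alpha> k) \<bullet> \<theta>) + (ci k * ?X - 2 * d) * (\<alpha> k \<bullet> \<theta>)"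
    using arg_cong[OF K_reflect[OF assms], of "\<lambda>v. v \<bullet> \<theta>"] by (simp only: inner_add_left inner_scaleR_left)
  then have "2 * (\<mu> * (d / 2)) = ci k * (d/2) * ?X + (ci k * ?X - 2 * d) * (d / 2)"
    unfolding 1 2 inner_theta_half[OF assms] kappa(1)[OF assms] .
  also have "\<dots> = d * (ci k * ?X - d)" by (simp only: algebra_simps) simp
  finally have "d * \<mu> = d * (ci k * ?X - d)" by simp
  then have "\<mu> = ci k * ?X - d" using d_pos by simp
  then show ?thesis unfolding mu_U by (simp add: algebra_simps)
qed

text \<open>The ratio of \<open>ci k * tri k k j\<close> to \<open>gram k j\<close> for a neighbour
  \<open>k\<close> of \<open>j\<close> outside \<open>Z\<close>; by \<open>edge_A\<close> it depends
  on \<open>j\<close> only.\<close>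

definition "A j = 2 * M j - U + 2"

lemma edge_A: assumes "k \<notin> Z" "j \<in> Z" shows "ci k * tri k k j = (gram k j) * A j"
proof -
  let ?g = "gram k j"
  have t: "trit k j = d / 2 * M j * ?g"
    using tri_sym[of \<theta> "\<alpha> k" "\<alpha> j"] cprod_Z[OF assms(2)] by (simp add: inner_commute)
  have "2 * (trit k j) = \<kappa> k * tri k k j + (ci k * (trit k k) - 2 * d) * ?g"
    using arg_cong[OF K_reflect[OF assms(1)], of "\<lambda>v. v \<bullet> \<alpha> j"] by (simp only: inner_add_left inner_scaleR_left)
  then have "2 * (d / 2 * M j * ?g) = ci k * (d / 2) * tri k k j + (d / 2 * (U + 2) - 2 * d) * ?g"
    unfolding t K_diag[OF assms(1)] kappa(1)[OF assms(1)] .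
  moreover obtain T where T: "T = ci k * tri k k j" by blast
  ultimately have "2 * (d / 2 * M j * ?g) = T * (d / 2) + (d / 2 * (U + 2) - 2 * d) * ?g"
    by (simp only: mult_ac)
  then have "d * T = d * (?g * A j)" unfolding A_def by (simp add: field_simps)
  then have "T = ?g * A j" using d_pos by simp
  then show ?thesis unfolding T .
qed

text \<open>By \<open>tri_distinct\<close> only \<open>j\<close> and \<open>k\<close> contribute to
  the expansion of \<open>trit j k\<close>, and \<open>edge_rel\<close> with \<open>edge_A\<close>
  evaluates both terms. If \<open>cartan k j\<close> is not 1, then \<open>cartan j k\<close> is,
  and the two orientations of \<open>edge_rel\<close> force \<open>A j = 0\<close>.\<close>

lemma edge_M: assumes "k \<notin> Z" "j \<in> Z" "gram k j \<noteq> 0"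
  shows "cartan k j = 1 \<and> \<kappa> k * M j = n k * A j + n j * (2 - A j) \<or>
    cartan k j \<ge> 2 \<and> cartan k j \<le> \<kappa> k \<and> \<kappa> k * M j = 2 * cartan k j * n j"
proof -
  let ?g = "gram k j" let ?p = "cartan k j"
  have kj: "k \<noteq> j" using assms by auto
  have "trit j k = (\<Sum>i\<in>UNIV. n i * tri i j k)" by (rule tri_theta_expand)
  also have "\<dots> = (\<Sum>i\<in>{j,k}. n i * tri i j k)"
    by (rule sum.mono_neutral_right) (use tri_distinct kj in auto)
  also have "\<dots> = n j * tri j j k + n k * tri k k j" using kj tri_perm(2)[of k j k] by simp
  finally have "d / 2 * M j * ?g = n j * tri j j k + n k * tri k k j"
    unfolding cprod_Z[OF assms(2)] by (simp add: inner_commute)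
  then have "ci k * (d / 2 * M j * ?g) = n j * (ci k * tri j j k) + n k * (ci k * tri k k j)"
    by (simp only: algebra_simps)
  then have e: "\<kappa> k * M j * ?g = n j * (ci k * tri j j k) + n k * (?g * A j)"
    unfolding edge_A[OF assms(1,2)] kappa(1)[OF assms(1)] by (simp only: mult_ac)
  have e1: "ci k * tri j j k = ?g * (2 * ?p - ?p * A j)"
  proof -
    have "ci k * (tri j j k + ?p * tri k k j) = ci k * (- 2 * ?g^2)" using edge_rel[OF kj] by simp
    then have "ci k * tri j j k = - ?p * (ci k * tri k k j) + 2 * (- (ci k * ?g)) * ?g"
      by (simp only: power2_eq_square algebra_simps)
    then have y: "ci k * tri j j k = - ?p * (?g * A j) + 2 * ?p * ?g" unfolding edge_A[OF assms(1,2)] cartan_def[symmetric] .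
    show ?thesis unfolding y by (simp add: algebra_simps)
  qed
  show ?thesis
  proof (cases "?p = 1")
    case True
    have "?g * (\<kappa> k * M j) = ?g * (n k * A j + n j * (2 - A j))"
      using e unfolding e1 True by (simp only: algebra_simps)
    then show ?thesis using True assms(3) by simp
  next
    case False
    then have q: "cartan j k = 1" using cartan_one[OF kj assms(3)] by simp
    have g: "gram j k = ?g" by (rule inner_commute)
    have p1: "?p > 1" using False cartan_ge1[OF kj assms(3)] by linarith
    have "ci k * (tri k k j + tri j j k) = ci k * (- 2 * ?g^2)" using edge_rel[OF kj[symmetric]] q g by simp
    then have "ci k * tri j j k = - (ci k * tri k k j) + 2 * (- (ci k * ?g)) * ?g"
      by (simp only: power2_eq_square algebra_simps)
    then have y: "ci k * tri j j k = - (?g * A j) + 2 * ?p * ?g" unfolding edge_A[OF assms(1,2)] cartan_def[symmetric] .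
    have e2: "ci k * tri j j k = ?g * (2 * ?p - A j)" unfolding y by (simp add: algebra_simps)
    have "?g * (2 * ?p - ?p * A j) = ?g * (2 * ?p - A j)" using e1 e2 by (rule trans[OF sym])
    then have "?g * ((?p - 1) * A j) = 0" by (simp only: algebra_simps)
    then have A0: "A j = 0" using assms(3) p1 by simp
    have "?g * (\<kappa> k * M j) = ?g * (2 * ?p * n j)" using e unfolding e1 A0 by (simp add: algebra_simps)
    then have m: "\<kappa> k * M j = 2 * ?p * n j" using assms(3) mult_left_cancel by blast
    \<comment> \<open>Holds because \<open>\<theta>\<close> is at least as long as
      \<open>\<alpha> j\<close>; it bounds \<open>?p\<close> by \<open>\<kappa> k\<close>.\<close>
    have cj: "ci j * (d / 2) \<ge> 1" using theta_long[OF simple_in, of j] simple_pos[of j] by simp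
    have "ci j * ?g = - 1" using q g unfolding cartan_def by simp
    then have "?p = ?p * (- (ci j * ?g))" by simp
    also have "\<dots> = - (?p * ?g) * ci j" by simp
    also have "\<dots> \<le> - (?p * ?g) * ci j * (ci j * (d / 2))"
    proof -
      have "?p * ?g \<le> 0" using p1 simple_nonpos[OF kj] by (simp add: mult_nonneg_nonpos)
      then have "- (?p * ?g) * ci j \<ge> 0" using simple_pos[of j] by (intro mult_nonneg_nonneg) auto
      then show ?thesis using mult_left_mono[OF cj] by fastforce
    qed
    also have "\<dots> = (- (ci j * ?g)) * (- (ci j * ?g)) * \<kappa> k"
      unfolding kappa(1)[OF assms(1)] cartan_def by (simp add: mult_ac)
    also have "\<dots> = \<kappa> k" unfolding \<open>ci j * ?g = - 1\<close> by simp
    finally show ?thesis using m Int_gt_1_ge_2[OF cartan_in_Ints p1] by blast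
  qed
qed

text \<open>Pairing \<open>\<theta>\<close> with the coroot of \<open>\<alpha> i\<close> bounds the
  weights of the neighbours of \<open>i\<close>; the case analysis below rests on these
  bounds.\<close>

lemma cartan_row_sum: "(\<Sum>j\<in>UNIV - {i}. n j * cartan i j) = 2 * n i - \<kappa> i"
proof -
  have "\<kappa> i = (\<Sum>j\<in>UNIV. n j * (ci i * (gram i j)))"
    unfolding \<kappa>_def by (subst expand[of \<theta>]) (simp add: inner_sum_right sum_distrib_left mult_ac)
  also have "\<dots> = n i * (ci i * (gram i i)) + (\<Sum>j\<in>UNIV - {i}. n j * (ci i * (gram i j)))"
    by (rule sum.remove) auto
  also have "ci i * (gram i i) = 2" using simple_pos[of i] by simp
  finally show ?thesis by (simp add: cartan_def sum_negf)
qed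

lemma cartan_row_le: assumes "S \<subseteq> UNIV - {i}" shows "(\<Sum>j\<in>S. n j * cartan i j) \<le> 2 * n i - \<kappa> i"
  unfolding cartan_row_sum[symmetric] using assms cartan_nonneg n_ge_1
  by (intro sum_mono2) (auto intro!: mult_nonneg_nonneg order_trans[OF zero_le_one n_ge_1])

lemma kappa_Z: "i \<in> Z \<Longrightarrow> \<kappa> i = 0" by (simp add: \<kappa>_def Z_def)

lemma n_int: "n i \<in> \<int>" using coord_int[OF theta_R] .

lemma ex_neighbour: obtains j where "j \<noteq> k" "gram k j \<noteq> 0"
proof -
  have "{k} \<noteq> UNIV" using rank_ge_2 by (metis UNIV_I singletonD)
  then show ?thesis using connected[of "{k}"] that by auto
qed

text \<open>Used with \<open>B\<close> a set of exceptional nodes of \<open>Z\<close>: since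
  \<open>-Z\<close> is nonempty, connectedness gives an edge leaving \<open>B\<close> unless
  \<open>B\<close> is empty.\<close>

lemma no_isolated_set: assumes "B \<subseteq> Z" "\<And>b x. b \<in> B \<Longrightarrow> x \<notin> B \<Longrightarrow> gram b x \<noteq> 0 \<Longrightarrow> False" shows "B = {}"
proof (rule ccontr)
  assume "B \<noteq> {}"
  moreover have "B \<noteq> UNIV"
  proof
    assume "B = UNIV"
    then have "-Z = {}" using assms(1) by auto
    then show False using sum_K by simp
  qed
  ultimately show False using connected[of B] assms(2) by blast
qed

text \<open>By \<open>norm_sum\<close>, this is equivalent to \<open>L = eps R \<alpha>\<close>.\<close>

definition value_eq where "value_eq \<longleftrightarrow> 3 * \<Lambda> = U + 4 + (\<Sum>j\<in>Z. n j * M j)"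

text \<open>With a single eigenvalue \<open>m\<close>, \<open>sum_Z\<close> and
  \<open>M_quadratic\<close> reduce the equation to the vanishing of
  \<open>(m - 2) * (U - 3 * m + 4)\<close>.\<close>

lemma value_eq_const: assumes "\<And>i. i \<in> Z \<Longrightarrow> M i = m" "j \<in> Z" "(m - 2) * (U - 3 * m + 4) = 0" shows value_eq
proof -
  have "(\<Sum>j\<in>Z. n j * M j) = (\<Sum>j\<in>Z. n j) * m" unfolding sum_distrib_right by (rule sum.cong) (auto simp: assms(1))
  then have "(\<Sum>j\<in>Z. n j * M j) = (U - 5) * m" by (simp add: sum_Z)
  moreover have "2 * \<Lambda> = m * (U - m)" using M_quadratic[OF assms(2)] assms(1)[OF assms(2)] by simp
  ultimately show ?thesis using assms(3) unfolding value_eq_def by (simp add: algebra_simps)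
qed

text \<open>Row \<open>k\<close> gives the neighbours total weight \<open>4 - \<kappa> k\<close>.
  The case \<open>\<kappa> k = 3\<close> is impossible and \<open>\<kappa> k = 2\<close> is type C.
  For \<open>\<kappa> k = 1\<close> the neighbours have weights 3 (types E, F, G), or 2 and 1 (types
  B and D), or 1, 1 and 1 (type D of rank 4).\<close>

lemma value_eq_single:
  assumes K: "- Z = {k}" shows value_eq
proof -
  have kZ: "k \<notin> Z" and Z: "x \<in> Z \<longleftrightarrow> x \<noteq> k" for x using K by auto
  have nk: "n k = 2" using sum_K K by simp
  obtain j0 where j0: "j0 \<noteq> k" "gram k j0 \<noteq> 0" using ex_neighbour by blast
  have U6: "U \<ge> 6"
  proof -
    have "(\<Sum>i\<in>{k,j0}. n i) \<le> (\<Sum>i\<in>UNIV. n i)"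
      by (intro sum_mono2) (auto intro: order_trans[OF zero_le_one n_ge_1])
    then show ?thesis using j0 nk n_ge_1[of j0] sum_n by simp
  qed
  have nbr_le: "n j * cartan k j \<le> 4 - \<kappa> k" if "j \<noteq> k" for j
    using cartan_row_le[of "{j}" k] that nk by simp
  have na: "n j * cartan k j \<ge> n j" "n j * cartan k j \<ge> cartan k j" "cartan k j \<ge> 1" if "j \<noteq> k" "gram k j \<noteq> 0" for j
  proof -
    show p: "cartan k j \<ge> 1" using cartan_ge1[OF that(1)[symmetric] that(2)] .
    show "n j * cartan k j \<ge> n j" using mult_left_mono[OF p, of "n j"] n_ge_1[of j] by simp
    show "n j * cartan k j \<ge> cartan k j" using mult_right_mono[OF n_ge_1[of j], of "cartan k j"] p by simp
  qed
  have k3: "\<kappa> k \<le> 3" using nbr_le[OF j0(1)] na[OF j0] by linarith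
  obtain m where m: "\<kappa> k = of_int m" using kappa(3)[OF kZ] by (auto elim: Ints_cases)
  have "m \<ge> 1" "m \<le> 3" using k3 kappa(2)[OF kZ] m by simp_all
  then have m3: "m = 1 \<or> m = 2 \<or> m = 3" by linarith
  have edge: "cartan k j = 1 \<and> \<kappa> k * M j = 2 * A j + n j * (2 - A j) \<or>
    cartan k j \<ge> 2 \<and> cartan k j \<le> \<kappa> k \<and> \<kappa> k * M j = 2 * cartan k j * n j" if "j \<noteq> k" "gram k j \<noteq> 0" for j
    using edge_M[OF kZ, of j] that Z nk by simp
  \<comment> \<open>It suffices to know the eigenvalue at the neighbours of \<open>k\<close>, since
    by \<open>M_adjacent\<close> it propagates through \<open>Z\<close>.\<close>
  have const: value_eq if all: "\<And>j. j \<noteq> k \<Longrightarrow> gram k j \<noteq> 0 \<Longrightarrow> M j = v" "(v - 2) * (U - 3 * v + 4) = 0" for v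
  proof -
    have "{i \<in> Z. M i \<noteq> v} = {}"
    proof (rule no_isolated_set)
      fix b x assume b: "b \<in> {i \<in> Z. M i \<noteq> v}" "x \<notin> {i \<in> Z. M i \<noteq> v}" "gram b x \<noteq> 0"
      show False
      proof (cases "x = k")
        case True then show False using b all(1)[of b] Z by (simp add: inner_commute)
      next
        case False then show False using b Z M_adjacent[of b x] by auto
      qed
    qed auto
    then show value_eq using value_eq_const[of v j0] that(2) j0 Z by blast
  qed
  have nj: "n j = 1 \<or> n j = 2 \<or> n j = 3" if "n j \<le> 3" for j
  proof -
    obtain z where z: "n j = of_int z" using n_int by (auto elim: Ints_cases)
    have "z \<ge> 1" "z \<le> 3" using that n_ge_1[of j] z by simp_all
    then have "z = 1 \<or> z = 2 \<or> z = 3" by linarith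
    then show ?thesis using z by auto
  qed
  from m3 show value_eq
  proof (elim disjE)
    assume "m = 3"
    then have kk: "\<kappa> k = 3" using m by simp
    have "n j0 = 1" "cartan k j0 = 1" using nbr_le[OF j0(1)] na[OF j0] n_ge_1[of j0] kk by linarith+
    then have "3 * M j0 = A j0 + 2" using edge[OF j0] kk by simp
    \<comment> \<open>Inserting \<open>A j0\<close> gives \<open>M j0 = 4 - U\<close>, so this case
      cannot occur.\<close>
    then have "M j0 < 0" using U6 unfolding A_def by simp
    then show value_eq using M_nonneg[of j0] by simp
  next
    assume "m = 2"
    then have kk: "\<kappa> k = 2" using m by simp
    show value_eq
    proof (rule const[of 2])
      fix j assume j: "j \<noteq> k" "gram k j \<noteq> 0"
      have le: "n j \<le> 2" "n j * cartan k j \<le> 2" using nbr_le[OF j(1)] na[OF j] kk by linarith+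
      show "M j = 2" using edge[OF j]
      proof
        assume e: "cartan k j = 1 \<and> \<kappa> k * M j = 2 * A j + n j * (2 - A j)"
        have "n j = 1 \<or> n j = 2" using nj[of j] le by linarith
        then show "M j = 2"
        proof
          assume "n j = 2" then show "M j = 2" using e kk by simp
        next
          assume "n j = 1"
          then have "2 * M j = A j + 2" using e kk by simp
          then show ?thesis using U6 unfolding A_def by simp
        qed
      next
        assume e: "cartan k j \<ge> 2 \<and> cartan k j \<le> \<kappa> k \<and> \<kappa> k * M j = 2 * cartan k j * n j"
        then have "cartan k j = 2" using kk by simp
        then have "n j = 1" using le n_ge_1[of j] by simp
        then show ?thesis using e kk \<open>cartan k j = 2\<close> by simp
      qed
    qed simp
  next
    assume "m = 1"
    then have kk: "\<kappa> k = 1" using m by simp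
    have a1: "cartan k j = 1" and Mj: "M j = 2 * A j + n j * (2 - A j)" if "j \<noteq> k" "gram k j \<noteq> 0" for j
      using edge[OF that] kk by auto
    have le3: "n j \<le> 3" if "j \<noteq> k" "gram k j \<noteq> 0" for j
      using nbr_le[OF that(1)] na[OF that] kk by linarith
    have row3: "(\<Sum>j\<in>S. n j * cartan k j) \<le> 3" if "k \<notin> S" for S
      using cartan_row_le[of S k] that kk nk by auto
    have M1: "M j = U - 4" if "j \<noteq> k" "gram k j \<noteq> 0" "n j = 1" for j
      using Mj[OF that(1,2)] that(3) unfolding A_def by simp
    have M2: "M j = 4" if "j \<noteq> k" "gram k j \<noteq> 0" "n j = 2" for j
      using Mj[OF that(1,2)] that(3) unfolding A_def by simp
    have M3: "3 * M j = U + 4" if "j \<noteq> k" "gram k j \<noteq> 0" "n j = 3" for j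
      using Mj[OF that(1,2)] that(3) unfolding A_def by simp
    \<comment> \<open>The bound for row \<open>l\<close> is 2, and the weight 2 of \<open>k\<close>
      already exhausts it.\<close>
    have leaf: "x = k" if "l \<noteq> k" "gram k l \<noteq> 0" "n l = 1" "x \<noteq> l" "gram l x \<noteq> 0" for l x
    proof (rule ccontr)
      assume "x \<noteq> k"
      then have "n k * cartan l k + n x * cartan l x \<le> 2"
        using cartan_row_le[of "{k,x}" l] that(1,3,4) kappa_Z[of l] Z by simp
      moreover have "cartan l k \<ge> 1" using cartan_ge1[OF that(1)] that(2) by (simp add: inner_commute)
      moreover have "1 * 1 \<le> n x * cartan l x" using cartan_ge1[OF that(4)[symmetric] that(5)] n_ge_1[of x] by (intro mult_mono) auto
      ultimately show False using nk by simp
    qed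
    have pair: False if "i \<noteq> k" "gram k i \<noteq> 0" "j \<noteq> k" "gram k j \<noteq> 0" "i \<noteq> j" "n i + n j > 3" for i j
      using row3[of "{i,j}"] that a1 by simp
    show value_eq
    proof (cases "\<exists>j. j \<noteq> k \<and> gram k j \<noteq> 0 \<and> n j = 3")
      case True
      then obtain j where j: "j \<noteq> k" "gram k j \<noteq> 0" "n j = 3" by blast
      show value_eq
      proof (rule const[of "M j"])
        fix l assume l: "l \<noteq> k" "gram k l \<noteq> 0"
        have "l = j" using pair[OF l j(1,2)] j(3) n_ge_1[of l] by force
        then show "M l = M j" by simp
      qed (use M3[OF j] in simp)
    next
      case no3: False
      show value_eq
      proof (cases "\<exists>j. j \<noteq> k \<and> gram k j \<noteq> 0 \<and> n j = 2")
        case True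
        then obtain j where j: "j \<noteq> k" "gram k j \<noteq> 0" "n j = 2" by blast
        \<comment> \<open>Of the total weight 3 this leaves 1 beside \<open>j\<close>, so there is
          exactly one further neighbour \<open>l\<close>, of weight 1.\<close>
        have r1: "(\<Sum>x\<in>UNIV - {k} - {j}. n x * cartan k x) = 1"
          using cartan_row_sum[of k] sum.remove[of "UNIV - {k}" j "\<lambda>x. n x * cartan k x"] j a1[OF j(1,2)] kk nk by simp
        have "\<exists>l\<in>UNIV - {k} - {j}. n l * cartan k l \<noteq> 0"
        proof (rule ccontr)
          assume "\<not> ?thesis"
          then have "(\<Sum>x\<in>UNIV - {k} - {j}. n x * cartan k x) = 0" by (intro sum.neutral) blast
          then show False using r1 by simp
        qed
        then obtain l where l: "l \<noteq> k" "l \<noteq> j" "gram k l \<noteq> 0" using cartan_eq_0 by auto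
        have nl: "n l = 1" using nj[OF le3[OF l(1,3)]] pair[OF l(1,3) j(1,2) l(2)] j(3) by force
        have only: "x = j \<or> x = l" if "x \<noteq> k" "gram k x \<noteq> 0" for x
        proof (rule ccontr)
          assume "\<not> ?thesis"
          then have "n j * cartan k j + (n l * cartan k l + n x * cartan k x) \<le> 3" using row3[of "{j,l,x}"] j l that by auto
          then show False using a1 j l that nl n_ge_1[of x] by simp
        qed
        \<comment> \<open>The leaf \<open>l\<close> has eigenvalue \<open>U - 4\<close>. The other
          nodes of \<open>Z\<close> are reached from \<open>j\<close> and inherit its eigenvalue
          4.\<close>
        have "{i \<in> Z. i \<noteq> l \<and> M i \<noteq> 4} = {}"
        proof (rule no_isolated_set)
          fix b x assume b: "b \<in> {i \<in> Z. i \<noteq> l \<and> M i \<noteq> 4}" "x \<notin> {i \<in> Z. i \<noteq> l \<and> M i \<noteq> 4}" "gram b x \<noteq> 0"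
          have xb: "gram x b \<noteq> 0" using b(3) by (simp add: inner_commute)
          show False
          proof (cases "x = k")
            case True
            then have "b = j" using only[of b] b xb Z by auto
            then show False using M2[OF j] b by simp
          next
            case xk: False
            show False
            proof (cases "x = l")
              case True
              then show False using leaf[OF l(1,3) nl, of b] xb b Z by auto
            next
              case False
              then have "M x = 4" "x \<in> Z" using b(2) xk Z by auto
              then show False using M_adjacent[of b x] b by auto
            qed
          qed
        qed auto
        then have all4: "M i = 4" if "i \<noteq> k" "i \<noteq> l" for i using that Z by blast
        have lZ: "l \<in> Z" "j \<in> Z" using l j Z by auto
        have "(\<Sum>i\<in>Z. n i * M i) = n l * M l + (\<Sum>i\<in>Z - {l}. n i * M i)" using lZ by (intro sum.remove) auto
        also have "(\<Sum>i\<in>Z - {l}. n i * M i) = (\<Sum>i\<in>Z - {l}. n i) * 4" unfolding sum_distrib_right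
          by (rule sum.cong) (use all4 Z in auto)
        also have "(\<Sum>i\<in>Z - {l}. n i) = U - 6" using sum_Z sum.remove[of Z l n] lZ nl by simp
        finally have "(\<Sum>i\<in>Z. n i * M i) = (U - 4) + (U - 6) * 4" using nl M1[OF l(1,3) nl] by simp
        moreover have "2 * \<Lambda> = 4 * (U - 4)" using M_quadratic[OF lZ(2)] M2[OF j] by simp
        ultimately show value_eq unfolding value_eq_def by simp
      next
        case no2: False
        have n1: "n j = 1" if "j \<noteq> k" "gram k j \<noteq> 0" for j
          using nj[OF le3[OF that]] no2 no3 that by blast
        have "{i \<in> Z. gram k i = 0} = {}"
        proof (rule no_isolated_set)
          fix b x assume b: "b \<in> {i \<in> Z. gram k i = 0}" "x \<notin> {i \<in> Z. gram k i = 0}" "gram b x \<noteq> 0"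
          have xb: "gram x b \<noteq> 0" using b(3) by (simp add: inner_commute)
          show False
          proof (cases "x = k")
            case True then show False using b xb by simp
          next
            case False
            then have "gram k x \<noteq> 0" using b(2) Z by auto
            then have "b = k" using leaf[OF False _ n1[OF False], of b] xb b by auto
            then show False using b kZ by auto
          qed
        qed auto
        then have adj: "gram k i \<noteq> 0" if "i \<noteq> k" for i using that Z by blast
        have "(\<Sum>j\<in>UNIV - {k}. n j * cartan k j) = (\<Sum>j\<in>Z. n j)"
          by (rule sum.cong) (use Z adj a1 in auto)
        \<comment> \<open>The neighbours are leaves and exhaust \<open>Z\<close>, so their total
          weight 3 determines \<open>U\<close>. Then the common eigenvalue \<open>U - 4 = 4\<close>
          is a zero of the second factor in \<open>value_eq_const\<close>.\<close>
        then have "U = 8" using cartan_row_sum[of k] kk nk sum_Z by simp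
        then show value_eq using M1[OF _ _ n1] by (intro const[of 4]) auto
      qed
    qed
  qed
qed

text \<open>This is type A. The row bound at a node outside \<open>Z\<close> forces weight 1 and
  Cartan entry 1 for every neighbour, whereupon \<open>edge_M\<close> reads
  \<open>M j = 2\<close>.\<close>

lemma value_eq_double:
  assumes kk: "k \<noteq> k'" and K: "- Z = {k, k'}" shows value_eq
proof -
  have n1: "n k = 1" "n k' = 1" using sum_K K kk n_ge_1[of k] n_ge_1[of k'] by auto
  have Z: "x \<in> Z \<longleftrightarrow> x \<noteq> k \<and> x \<noteq> k'" for x using K by auto
  have nb: "n j = 1 \<and> cartan l j = 1 \<and> \<kappa> l = 1" if l: "l \<notin> Z" and j: "j \<noteq> l" "gram l j \<noteq> 0" for l j
  proof -
    have nl: "n l = 1" using l n1 Z by auto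
    have "n j * cartan l j \<le> 2 - \<kappa> l" using cartan_row_le[of "{j}" l] j nl by simp
    moreover have a: "cartan l j \<ge> 1" using cartan_ge1[OF j(1)[symmetric] j(2)] .
    moreover have "n j * cartan l j \<ge> n j" "n j * cartan l j \<ge> cartan l j"
      using mult_left_mono[OF a, of "n j"] mult_right_mono[OF n_ge_1[of j], of "cartan l j"] n_ge_1[of j] a by simp_all
    ultimately show ?thesis using n_ge_1[of j] kappa(2)[OF l] by linarith
  qed
  have M2: "M j = 2" if "l \<notin> Z" "j \<in> Z" "gram l j \<noteq> 0" for l j
  proof -
    have "j \<noteq> l" using that by auto
    then show ?thesis using nb[OF that(1) _ that(3)] edge_M[OF that] n1 Z that(1) by auto
  qed
  have all2: "{i \<in> Z. M i \<noteq> 2} = {}"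
  proof (rule no_isolated_set)
    fix b x assume b: "b \<in> {i \<in> Z. M i \<noteq> 2}" "x \<notin> {i \<in> Z. M i \<noteq> 2}" "gram b x \<noteq> 0"
    show False
    proof (cases "x \<in> Z")
      case True then show False using b M_adjacent[of b x] by auto
    next
      case False then show False using b M2[of x b] by (simp add: inner_commute)
    qed
  qed auto
  show value_eq
  proof (cases "Z = {}")
    case False
    then show value_eq using value_eq_const[of 2] all2 by auto
  next
    case True
    \<comment> \<open>In rank 2 there is no simple root orthogonal to \<open>\<theta>\<close>. The
      vector \<open>?\<delta>\<close> takes its place: it is an orthogonal eigenvector of
      \<open>cprod \<theta>\<close>, and the argument of \<open>M_quadratic\<close> applies to
      it.\<close>
    then have UN: "UNIV = {k, k'}" using K by auto
    then have cases: "x = k \<or> x = k'" for x by auto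
    have kZ: "k \<notin> Z" "k' \<notin> Z" using True by auto
    obtain j where "j \<noteq> k" "gram k j \<noteq> 0" using ex_neighbour by blast
    then have g0: "gram k k' \<noteq> 0" "gram k' k \<noteq> 0" using cases[of j] by (auto simp: inner_commute)
    have kap: "\<kappa> k = 1" "\<kappa> k' = 1" "cartan k k' = 1" using nb[OF kZ(1) kk[symmetric] g0(1)] nb[OF kZ(2) kk g0(2)] by auto
    have ck: "ci k = 2 / d" "ci k' = 2 / d"
      using kap(1,2) kappa(1) kZ d_pos by (auto simp: field_simps)
    then have dk: "gram k k = d" "gram k' k' = d"
      using d_pos simple_pos[of k] simple_pos[of k'] by (auto simp: field_simps)
    have g: "gram k k' = - d / 2" "gram k' k = - d / 2"
      using kap(3) d_pos unfolding cartan_def ck by (auto simp: field_simps inner_commute)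
    have U5: "U = 5" using sum_n n1 kk unfolding UN by simp
    have t1: "trit k k = 7 / 4 * d^2" "trit k' k' = 7 / 4 * d^2"
      using K_diag[OF kZ(1)] K_diag[OF kZ(2)] d_pos unfolding ck U5 by (auto simp: field_simps power2_eq_square)
    have t2: "trit k k' = - (d^2) / 2"
    proof -
      have "trit k k' = tri k k k' + tri k' k k'"
        unfolding tri_theta_expand UN using kk n1 by simp
      also have "tri k' k k' = tri k' k' k" by (rule tri_perm)
      also have "tri k k k' + tri k' k' k = d / 2 * (2 * (gram k k'))"
        using edge_sum[OF kk] d_pos unfolding ck by (simp add: field_simps)
      finally show ?thesis unfolding g by (simp add: power2_eq_square)
    qed
    have t3: "trit k' k = - (d^2) / 2" using t2 tri_sym by metis
    let ?\<delta> = "\<alpha> k - \<alpha> k'"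
    have cprod\<delta>: "cprod \<theta> ?\<delta> = (3 / 2 * d) *\<^sub>R ?\<delta>"
    proof (rule inner_simple_eqI)
      fix i
      show "\<alpha> i \<bullet> cprod \<theta> ?\<delta> = \<alpha> i \<bullet> (3 / 2 * d) *\<^sub>R ?\<delta>"
        using cases[of i] t1 t2 t3 dk g
        by (auto simp: cprod_simps inner_diff_right inner_commute[of "\<alpha> _" "cprod _ _"] power2_eq_square)
    qed
    have \<delta>\<delta>: "?\<delta> \<bullet> ?\<delta> = 3 * d" by (simp add: inner_diff_left inner_diff_right dk g)
    have \<theta>\<delta>: "\<theta> \<bullet> ?\<delta> = 0" using inner_theta_half[OF kZ(1)] inner_theta_half[OF kZ(2)] by (simp add: inner_diff_right inner_commute)
    have "cprod \<theta> \<theta> \<bullet> cprod ?\<delta> ?\<delta> = \<mu> * (cprod \<theta> ?\<delta> \<bullet> ?\<delta>)"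
      unfolding cprod_theta_theta using tri_sym'[of ?\<delta> ?\<delta> \<theta>] by (simp add: inner_commute)
    then have "curv \<theta> ?\<delta> \<theta> ?\<delta> = \<mu> * (3 / 2 * d) * (3 * d) - (3 / 2 * d)^2 * (3 * d)"
      unfolding curv_def cprod\<delta> using \<delta>\<delta> by (simp add: power2_eq_square)
    then have "L * (d * (3 * d)) = \<mu> * (3 / 2 * d) * (3 * d) - (3 / 2 * d)^2 * (3 * d)"
      unfolding curv_const \<delta>\<delta> \<theta>\<delta> by simp
    also have "\<dots> = 3 / 2 * d * (d * (3 * d))" unfolding mu_U U5 by (simp add: power2_eq_square)
    finally have "L = 3 / 2 * d" using d_pos by simp
    then have "\<Lambda> = 3" using d_pos unfolding \<Lambda>_def by (simp add: nonzero_divide_eq_eq)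
    then show value_eq unfolding value_eq_def True using U5 by simp
  qed
qed

lemma value_eq: value_eq
proof -
  have "-Z \<noteq> {}"
  proof
    assume "-Z = {}"
    then show False using sum_K by simp
  qed
  then obtain k where k: "k \<in> -Z" by blast
  have s1: "n k + (\<Sum>i\<in>-Z - {k}. n i) = 2" using sum_K sum.remove[of "-Z" k n] k by simp
  have pos: "n i > 0" for i using n_ge_1[of i] by linarith
  show value_eq
  proof (cases "-Z - {k} = {}")
    case True
    then have "-Z = {k}" using k by auto
    then show value_eq by (rule value_eq_single)
  next
    case False
    then obtain k' where k': "k' \<in> -Z - {k}" by blast
    have s2: "(\<Sum>i\<in>-Z - {k}. n i) = n k' + (\<Sum>i\<in>-Z - {k} - {k'}. n i)"
      using sum.remove[of "-Z - {k}" k' n] k' by simp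
    have "(\<Sum>i\<in>-Z - {k} - {k'}. n i) \<le> 0" using s1 s2 n_ge_1[of k] n_ge_1[of k'] by linarith
    then have "-Z - {k} - {k'} = {}" using sum_pos[of "-Z - {k} - {k'}" n] pos by (metis finite not_le)
    then have "-Z = {k, k'}" using k k' by auto
    then show value_eq using value_eq_double[of k k'] k' by blast
  qed
qed

text \<open>In \<open>norm_sum\<close> the nodes of \<open>Z\<close> contribute their eigenvalues,
  the others the value from \<open>K_diag\<close> with total weight 2; \<open>value_eq\<close> then
  eliminates the eigenvalues.\<close>

lemma L_eps: "L = eps R \<alpha>"
proof -
  let ?f = "\<lambda>i. n i * ci i * (trit i i)"
  have "sum ?f UNIV = sum ?f Z + sum ?f (-Z)"
    using sum.union_disjoint[of Z "-Z" ?f] by (simp add: Compl_partition)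
  also have "sum ?f Z = (\<Sum>i\<in>Z. d * (n i * M i))"
  proof (rule sum.cong[OF refl])
    fix i show "?f i = d * (n i * M i)" using d_pos simple_pos[of i] by (simp add: M_def)
  qed
  also have "\<dots> = d * (\<Sum>i\<in>Z. n i * M i)" by (simp add: sum_distrib_left)
  also have "sum ?f (-Z) = (\<Sum>i\<in>-Z. n i * (d / 2 * (U + 2)))"
  proof (rule sum.cong[OF refl])
    fix i assume "i \<in> -Z"
    then have "i \<notin> Z" by simp
    from K_diag[OF this] show "?f i = n i * (d / 2 * (U + 2))" by (simp only: mult.assoc)
  qed
  also have "\<dots> = 2 * (d / 2 * (U + 2))" using sum_K by (simp only: sum_distrib_right[symmetric])
  finally have "6 * eps R \<alpha> - 2 * d = d * (\<Sum>i\<in>Z. n i * M i) + 2 * (d / 2 * (U + 2))" using norm_sum by simp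
  moreover have "(\<Sum>i\<in>Z. n i * M i) = 3 * \<Lambda> - U - 4" using value_eq unfolding value_eq_def by simp
  ultimately have "6 * eps R \<alpha> - 2 * d = d * (3 * \<Lambda> - U - 4) + 2 * (d / 2 * (U + 2))" by (simp only:)
  then have "6 * eps R \<alpha> = 3 * (d * \<Lambda>)" by (simp add: field_simps)
  then show ?thesis using d_pos by (simp add: \<Lambda>_def)
qed

end

context irreducible_roots begin

text \<open>In rank 1 all vectors are proportional and both sides vanish; otherwise
  \<open>L_eps\<close> identifies the constant.\<close>

theorem curv_eps: "curv x z y w = eps R \<alpha> * ((x \<bullet> y) * (z \<bullet> w) - (x \<bullet> w) * (z \<bullet> y))"
proof -
  obtain L where L: "\<And>x z y w. curv x z y w = L * ((x \<bullet> y) * (z \<bullet> w) - (x \<bullet> w) * (z \<bullet> y))" using ex_curv_const by blast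
  show ?thesis
  proof (cases "\<exists>i j. i \<noteq> (j :: 'n)")
    case True
    then interpret curved_roots R \<alpha> L by unfold_locales (use L in auto)
    show ?thesis using L L_eps by simp
  next
    case False
    define i where "i = (undefined :: 'n)"
    have U: "UNIV = {i}" using False by auto
    have e: "x = (\<omega> i \<bullet> x) *\<^sub>R \<alpha> i" for x using expand[of x] unfolding U by simp
    have "(x \<bullet> y) * (z \<bullet> w) - (x \<bullet> w) * (z \<bullet> y) = 0"
      by (subst (1 2) e[of x], subst (1 2) e[of z]) simp
    then show ?thesis unfolding L by simp
  qed
qed

section \<open>Independence of \<open>q\<close>\<close>

text \<open>The bivector of \<open>\<beta>\<close> and \<open>\<gamma>\<close>, evaluated at
  \<open>x\<close> and \<open>z\<close>.\<close>

definition wedge :: "'a \<Rightarrow> 'a \<Rightarrow> 'a \<Rightarrow> 'a \<Rightarrow> real" where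
  "wedge \<beta> \<gamma> x z = (x \<bullet> \<beta>) * (z \<bullet> \<gamma>) - (x \<bullet> \<gamma>) * (z \<bullet> \<beta>)"

text \<open>The coefficient of the product of the series of \<open>\<beta>\<close> and
  \<open>\<gamma>\<close> in the deformed tensor, the contributions of both orders of the pair being
  added.\<close>

definition kern :: "'a \<Rightarrow> 'a \<Rightarrow> 'a \<Rightarrow> 'a \<Rightarrow> 'a \<Rightarrow> 'a \<Rightarrow> real" where
  "kern x z y w \<beta> \<gamma> = c \<beta> * c \<gamma> * (\<beta> \<bullet> \<gamma>) * wedge \<beta> \<gamma> x z * wedge \<beta> \<gamma> y w"

definition sg :: "'a \<Rightarrow> int" where "sg \<beta> = (if \<beta> \<in> P then 1 else - 1)"

definition pairs :: "('a \<times> 'a) set" where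
  "pairs = {(\<beta>, \<gamma>). \<beta> \<in> R \<and> \<gamma> \<in> R \<and> \<gamma> \<noteq> \<beta> \<and> \<gamma> \<noteq> - \<beta>}"

definition comb :: "'a \<Rightarrow> 'a \<Rightarrow> int \<Rightarrow> int \<Rightarrow> 'a" where
  "comb \<beta> \<gamma> r u = of_int r *\<^sub>R \<beta> + of_int u *\<^sub>R \<gamma>"

text \<open>
  The value of \<open>h\<close> at the coordinates of \<open>v\<close> with respect to the pair \<open>p\<close> if these exist and are
  integral, and \<open>0\<close> otherwise; they are unique for the elements of \<open>pairs\<close>.
\<close>

definition cf :: "'a \<Rightarrow> (int \<Rightarrow> int \<Rightarrow> int) \<Rightarrow> 'a \<times> 'a \<Rightarrow> int" where
  "cf v h p = (if \<exists>r u. v = comb (fst p) (snd p) r u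
     then (let t = SOME t. v = comb (fst p) (snd p) (fst t) (snd t) in h (fst t) (snd t)) else 0)"

abbreviation "wt v \<beta> \<gamma> \<equiv> cf v (\<lambda>r u. (sg \<beta> + sgn r) * (sg \<gamma> + sgn u)) (\<beta>, \<gamma>)"

text \<open>Two different representations would make one root a multiple of the other; reducedness
  allows this only up to sign, which \<open>pairs\<close> excludes.\<close>

lemma comb_unique: assumes "(\<beta>, \<gamma>) \<in> pairs" "comb \<beta> \<gamma> r u = comb \<beta> \<gamma> r' u'" shows "r = r' \<and> u = u'"
proof -
  have b: "\<beta> \<in> R" "\<gamma> \<in> R" "\<gamma> \<noteq> \<beta>" "\<gamma> \<noteq> - \<beta>" using assms(1) by (auto simp: pairs_def)
  have e: "(of_int u' - of_int u) *\<^sub>R \<gamma> = (of_int r - of_int r' :: real) *\<^sub>R \<beta>"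
    using assms(2) by (simp add: comb_def algebra_simps)
  have u: "u = u'"
  proof (rule ccontr)
    assume "u \<noteq> u'"
    then have ne: "(of_int u' - of_int u :: real) \<noteq> 0" by simp
    have "\<gamma> = (1 / (of_int u' - of_int u)) *\<^sub>R (of_int u' - of_int u :: real) *\<^sub>R \<gamma>" using ne by simp
    then have g: "\<gamma> = ((of_int r - of_int r') / (of_int u' - of_int u)) *\<^sub>R \<beta>" unfolding e by simp
    then have "((of_int r - of_int r') / (of_int u' - of_int u)) *\<^sub>R \<beta> \<in> R" using b by simp
    from reduced[OF b(1) this] g b show False by auto
  qed
  moreover have "r = r'" using e u root_nz[OF b(1)] by simp
  ultimately show ?thesis by simp
qed

lemma cf_eq: assumes "(\<beta>, \<gamma>) \<in> pairs" "v = comb \<beta> \<gamma> r u" shows "cf v h (\<beta>, \<gamma>) = h r u"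
proof -
  have "(SOME t. v = comb \<beta> \<gamma> (fst t) (snd t)) = (r, u)"
    by (rule some_equality) (use assms comb_unique[OF assms(1)] in \<open>auto simp: prod_eq_iff\<close>)
  then show ?thesis using assms(2) unfolding cf_def by auto
qed
lemma cf_0: "(\<And>r u. v \<noteq> comb \<beta> \<gamma> r u) \<Longrightarrow> cf v h (\<beta>, \<gamma>) = 0"
  by (simp add: cf_def)

lemma c_refl: "c (reflection \<beta> \<gamma>) = c \<gamma>" if "\<beta> \<in> R"
  using reflection_inner[OF root_nz[OF that]] by simp

lemma refl_comb: assumes "\<beta> \<in> R" "\<gamma> \<in> R"
  obtains k where "reflection \<beta> \<gamma> = comb \<gamma> \<beta> 1 (- k)" "reflection \<beta> \<gamma> = \<gamma> - of_int k *\<^sub>R \<beta>"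
proof -
  obtain k where "c \<beta> * (\<beta> \<bullet> \<gamma>) = of_int k" using cartan_int[OF assms] by (auto elim: Ints_cases)
  then have "reflection \<beta> \<gamma> = \<gamma> - of_int k *\<^sub>R \<beta>" by (simp only: reflection_eq)
  then show ?thesis using that[of k] by (simp add: comb_def)
qed

lemma flip_pairs: assumes "(\<beta>, \<gamma>) \<in> pairs" shows "(\<beta>, reflection \<beta> \<gamma>) \<in> pairs"
proof -
  have b: "\<beta> \<in> R" "\<gamma> \<in> R" "\<gamma> \<noteq> \<beta>" "\<gamma> \<noteq> - \<beta>" using assms by (auto simp: pairs_def)
  have i: "reflection \<beta> (reflection \<beta> \<gamma>) = \<gamma>" using reflection_reflection root_nz b by blast
  have "reflection \<beta> \<gamma> \<noteq> \<beta>" "reflection \<beta> \<gamma> \<noteq> - \<beta>"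
    using i b reflection_self[OF root_nz[OF b(1)]] linear_neg[OF reflection_linear, of \<beta> \<beta>] by auto
  then show ?thesis using b refl_in by (simp add: pairs_def)
qed

text \<open>Replacing \<open>\<gamma>\<close> by its mirror image changes only the coefficient of
  \<open>\<beta>\<close>, on which this function does not depend.\<close>

lemma flip_cf: assumes "(\<beta>, \<gamma>) \<in> pairs"
  shows "cf v (\<lambda>r u. h u) (\<beta>, reflection \<beta> \<gamma>) = cf v (\<lambda>r u. h u) (\<beta>, \<gamma>)"
proof -
  have b: "\<beta> \<in> R" "\<gamma> \<in> R" using assms by (auto simp: pairs_def)
  obtain k where k: "reflection \<beta> \<gamma> = \<gamma> - of_int k *\<^sub>R \<beta>" using refl_comb[OF b] by blast
  have 1: "comb \<beta> \<gamma> r u = comb \<beta> (reflection \<beta> \<gamma>) (r + u * k) u" for r u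
    by (simp add: comb_def k algebra_simps)
  have 2: "comb \<beta> (reflection \<beta> \<gamma>) r u = comb \<beta> \<gamma> (r - u * k) u" for r u
    by (simp add: comb_def k algebra_simps)
  show ?thesis
  proof (cases "\<exists>r u. v = comb \<beta> \<gamma> r u")
    case True
    then obtain r u where rs: "v = comb \<beta> \<gamma> r u" by blast
    show ?thesis using cf_eq[OF assms rs] cf_eq[OF flip_pairs[OF assms] rs[unfolded 1]] by simp
  next
    case False
    then have "\<not> (\<exists>r u. v = comb \<beta> (reflection \<beta> \<gamma>) r u)" using 2 by metis
    then show ?thesis using False by (simp add: cf_0)
  qed
qed

lemma wedge_refl: "wedge \<beta> (reflection \<beta> \<gamma>) x z = wedge \<beta> \<gamma> x z"
  unfolding wedge_def reflection_eq by (simp add: inner_diff_right algebra_simps)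

text \<open>The mirror image in \<open>\<beta>\<close> leaves the bivector and the lengths unchanged
  but negates \<open>\<beta> \<bullet> \<gamma>\<close>.\<close>

lemma flip_kern: assumes "(\<beta>, \<gamma>) \<in> pairs" shows "kern x z y w \<beta> (reflection \<beta> \<gamma>) = - kern x z y w \<beta> \<gamma>"
proof -
  have b: "\<beta> \<in> R" using assms by (auto simp: pairs_def)
  have "\<beta> \<bullet> reflection \<beta> \<gamma> = - (\<beta> \<bullet> \<gamma>)"
    using reflection_adjoint[OF root_nz[OF b], of \<beta> \<gamma>] reflection_self[OF root_nz[OF b]] by simp
  then show ?thesis unfolding kern_def wedge_refl c_refl[OF b] by simp
qed

lemma kern_swap: "kern x z y w \<beta> \<gamma> = kern x z y w \<gamma> \<beta>"
  by (simp add: kern_def wedge_def inner_commute[of \<gamma> \<beta>] algebra_simps)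

text \<open>The mirror image in the first root is an involution of \<open>pairs\<close> that negates
  \<open>kern\<close> and preserves \<open>f\<close>, so the sum is its own negative.\<close>

lemma flip_sum:
  assumes "\<And>\<beta> \<gamma>. (\<beta>, \<gamma>) \<in> pairs \<Longrightarrow> f \<beta> (reflection \<beta> \<gamma>) = (f \<beta> \<gamma> :: int)"
  shows "(\<Sum>(\<beta>, \<gamma>)\<in>pairs. kern x z y w \<beta> \<gamma> * of_int (f \<beta> \<gamma>)) = 0"
proof -
  let ?t = "\<lambda>p. (fst p, reflection (fst p) (snd p))"
  let ?F = "\<lambda>p. kern x z y w (fst p) (snd p) * of_int (f (fst p) (snd p))"
  have inv: "?t (?t p) = p" "?t p \<in> pairs" "?F (?t p) = - ?F p" if "p \<in> pairs" for p
  proof -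
    obtain \<beta> \<gamma> where p: "p = (\<beta>, \<gamma>)" by force
    then have b: "\<beta> \<in> R" and bg: "(\<beta>, \<gamma>) \<in> pairs" using that by (auto simp: pairs_def)
    show "?t (?t p) = p" using p reflection_reflection[OF root_nz[OF b]] by simp
    show "?t p \<in> pairs" using p flip_pairs[OF bg] by simp
    show "?F (?t p) = - ?F p" using p flip_kern[OF bg] assms[OF bg] by simp
  qed
  have "(\<Sum>p\<in>pairs. ?F p) = (\<Sum>p\<in>pairs. ?F (?t p))"
    by (rule sum.reindex_bij_witness[of _ ?t ?t]) (use inv in auto)
  also have "\<dots> = - (\<Sum>p\<in>pairs. ?F p)" unfolding sum_negf[symmetric]
    by (rule sum.cong) (use inv(3) in auto)
  finally show ?thesis by (simp add: case_prod_unfold)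
qed

lemma swap_pairs: "(\<beta>, \<gamma>) \<in> pairs \<longleftrightarrow> (\<gamma>, \<beta>) \<in> pairs" by (auto simp: pairs_def)
lemma swap_sum: "(\<Sum>(\<beta>, \<gamma>)\<in>pairs. f \<beta> \<gamma>) = (\<Sum>(\<beta>, \<gamma>)\<in>pairs. (f \<gamma> \<beta> :: real))"
  by (rule sum.reindex_bij_witness[of _ prod.swap prod.swap]) (use swap_pairs in auto)

lemma cf_swap: assumes "(\<beta>, \<gamma>) \<in> pairs" shows "cf v h (\<beta>, \<gamma>) = cf v (\<lambda>r u. h u r) (\<gamma>, \<beta>)"
proof (cases "\<exists>r u. v = comb \<beta> \<gamma> r u")
  case True
  then obtain r u where rs: "v = comb \<beta> \<gamma> r u" by blast
  then have "v = comb \<gamma> \<beta> u r" by (simp add: comb_def)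
  then show ?thesis using cf_eq[OF assms rs] cf_eq assms swap_pairs by metis
next
  case False
  then have "\<not> (\<exists>r u. v = comb \<gamma> \<beta> r u)" by (metis comb_def add.commute)
  then show ?thesis using False by (simp add: cf_0)
qed

text \<open>
  With the convention \<open>f\<^sub>-\<^sub>\<beta> = - f\<^sub>\<beta>\<close> the series \<open>f\<^sub>\<beta> = (1 + q\<^sup>\<beta>) / (1 - q\<^sup>\<beta>)\<close> has the coefficient
  \<open>sg \<beta> + sgn r\<close> at \<open>q\<^sup>r\<^sup>\<beta>\<close> for every root \<open>\<beta>\<close> and integer \<open>r\<close> (it is \<open>0\<close> unless \<open>r \<beta>\<close> is positive
  or \<open>0\<close>). Expanding the product of two such factors, the mixed terms cancel under the mirror images
  in \<open>\<beta>\<close> and \<open>\<gamma>\<close>, and what remains is invariant under the simple reflections.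
\<close>

definition symcoeff where "symcoeff v x z y w = (\<Sum>(\<beta>, \<gamma>)\<in>pairs. kern x z y w \<beta> \<gamma> *
   of_int (sg \<beta> * sg \<gamma> * cf v (\<lambda>r u. 1) (\<beta>, \<gamma>) + cf v (\<lambda>r u. sgn r * sgn u) (\<beta>, \<gamma>)))"
definition qcoeff where "qcoeff v x z y w = (\<Sum>(\<beta>, \<gamma>)\<in>pairs. kern x z y w \<beta> \<gamma> *
   of_int (wt v \<beta> \<gamma>))"

lemma qcoeff_eq_symcoeff: "qcoeff v x z y w = symcoeff v x z y w"
proof -
  let ?h1 = "\<lambda>\<beta> \<gamma>. of_int (sg \<beta> * cf v (\<lambda>r u. sgn u) (\<beta>, \<gamma>)) :: real"
  let ?h2 = "\<lambda>\<beta> \<gamma>. of_int (sg \<gamma> * cf v (\<lambda>r u. sgn r) (\<beta>, \<gamma>)) :: real"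
  \<comment> \<open>This mixed term involves \<open>\<beta>\<close> and \<open>u\<close> only, which
    the mirror image in \<open>\<beta>\<close> preserves; the other one reduces to it by exchanging
    the roots.\<close>
  have z1: "(\<Sum>(\<beta>, \<gamma>)\<in>pairs. kern x z y w \<beta> \<gamma> * ?h1 \<beta> \<gamma>) = 0"
    by (rule flip_sum) (simp add: flip_cf)
  have "(\<Sum>(\<beta>, \<gamma>)\<in>pairs. kern x z y w \<beta> \<gamma> * ?h2 \<beta> \<gamma>) = (\<Sum>(\<beta>, \<gamma>)\<in>pairs. kern x z y w \<gamma> \<beta> * ?h2 \<gamma> \<beta>)"
    by (rule swap_sum)
  also have "\<dots> = (\<Sum>(\<beta>, \<gamma>)\<in>pairs. kern x z y w \<beta> \<gamma> * ?h1 \<beta> \<gamma>)"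
  proof (rule sum.cong[OF refl], clarify)
    fix \<beta> \<gamma> assume "(\<beta>, \<gamma>) \<in> pairs"
    then have "(\<gamma>, \<beta>) \<in> pairs" using swap_pairs by blast
    from cf_swap[OF this, of v "\<lambda>r u. sgn r"] show "kern x z y w \<gamma> \<beta> * ?h2 \<gamma> \<beta> = kern x z y w \<beta> \<gamma> * ?h1 \<beta> \<gamma>"
      by (simp add: kern_swap)
  qed
  finally have z2: "(\<Sum>(\<beta>, \<gamma>)\<in>pairs. kern x z y w \<beta> \<gamma> * ?h2 \<beta> \<gamma>) = 0" using z1 by simp
  have "qcoeff v x z y w = (\<Sum>(\<beta>, \<gamma>)\<in>pairs. kern x z y w \<beta> \<gamma> *
     of_int (sg \<beta> * sg \<gamma> * cf v (\<lambda>r u. 1) (\<beta>, \<gamma>) + cf v (\<lambda>r u. sgn r * sgn u) (\<beta>, \<gamma>))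
     + (kern x z y w \<beta> \<gamma> * ?h1 \<beta> \<gamma> + kern x z y w \<beta> \<gamma> * ?h2 \<beta> \<gamma>))"
    unfolding qcoeff_def
  proof (rule sum.cong[OF refl], clarify)
    fix \<beta> \<gamma> assume bg: "(\<beta>, \<gamma>) \<in> pairs"
    have "wt v \<beta> \<gamma> = sg \<beta> * sg \<gamma> * cf v (\<lambda>r u. 1) (\<beta>, \<gamma>)
      + cf v (\<lambda>r u. sgn r * sgn u) (\<beta>, \<gamma>) + (sg \<beta> * cf v (\<lambda>r u. sgn u) (\<beta>, \<gamma>) + sg \<gamma> * cf v (\<lambda>r u. sgn r) (\<beta>, \<gamma>))"
    proof (cases "\<exists>r u. v = comb \<beta> \<gamma> r u")
      case True
      then obtain r u where rs: "v = comb \<beta> \<gamma> r u" by blast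
      show ?thesis unfolding cf_eq[OF bg rs] by (simp add: algebra_simps)
    qed (simp add: cf_0)
    then show "kern x z y w \<beta> \<gamma> * of_int (wt v \<beta> \<gamma>) = kern x z y w \<beta> \<gamma> *
     of_int (sg \<beta> * sg \<gamma> * cf v (\<lambda>r u. 1) (\<beta>, \<gamma>) + cf v (\<lambda>r u. sgn r * sgn u) (\<beta>, \<gamma>))
     + (kern x z y w \<beta> \<gamma> * ?h1 \<beta> \<gamma> + kern x z y w \<beta> \<gamma> * ?h2 \<beta> \<gamma>)"
      by (simp add: distrib_left)
  qed
  also have "\<dots> = symcoeff v x z y w" using z1 z2 by (simp add: symcoeff_def sum.distrib case_prod_unfold)
  finally show ?thesis .
qed

lemma sg_s: assumes "\<beta> \<in> R" shows "sg (s i \<beta>) = (if \<beta> = \<alpha> i \<or> \<beta> = - \<alpha> i then - sg \<beta> else sg \<beta>)"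
proof (cases "\<beta> = \<alpha> i \<or> \<beta> = - \<alpha> i")
  case True
  then show ?thesis using reflection_self[OF simple_nz[of i]] linear_neg[OF s_lin, of i "\<alpha> i"] simple_P[of i] P_not_both[OF simple_P[of i]]
    by (auto simp: sg_def)
next
  case False
  show ?thesis
  proof (cases "\<beta> \<in> P")
    case True then show ?thesis using s_P(1)[OF True] False by (simp add: sg_def)
  next
    case nP: False
    then have "- \<beta> \<in> P" using P_or assms by blast
    moreover have "- \<beta> \<noteq> \<alpha> i" using False by (metis minus_minus)
    ultimately have "- s i \<beta> \<in> P" using s_P(1)[of "-\<beta>" i] linear_neg[OF s_lin] by metis
    then have "s i \<beta> \<notin> P" using P_not_both by fastforce
    then show ?thesis using nP False by (simp add: sg_def)
  qed
qed

text \<open>Reindexing by \<open>s i\<close> changes signs only in pairs containing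
  \<open>\<alpha> i\<close> or \<open>- \<alpha> i\<close>. There \<open>s i\<close> preserves the
  sign of the other root, so \<open>flip_sum\<close> cancels the difference.\<close>

lemma symcoeff_reflection: "symcoeff (s i v) (s i x) (s i z) (s i y) (s i w) = symcoeff v x z y w"
proof -
  let ?t = "\<lambda>p. (s i (fst p), s i (snd p))"
  have nz: "\<alpha> i \<noteq> 0" by (rule simple_nz)
  have ss: "s i (s i u) = u" for u by (rule reflection_reflection[OF nz])
  have sneg: "s i (- u) = - s i u" for u by (rule linear_neg[OF s_lin])
  have inj: "s i u = s i u' \<longleftrightarrow> u = u'" for u u' using ss by metis
  have tp: "(s i \<beta>, s i \<gamma>) \<in> pairs" if "(\<beta>, \<gamma>) \<in> pairs" for \<beta> \<gamma>
    using that refl_in[OF simple_in] inj unfolding pairs_def by (auto simp flip: sneg)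
  have sc: "s i (comb \<beta> \<gamma> r t) = comb (s i \<beta>) (s i \<gamma>) r t" for \<beta> \<gamma> r t
    by (simp add: comb_def linear_add[OF s_lin] linear_scale[OF s_lin])
  have cfs: "cf (s i v) h (s i \<beta>, s i \<gamma>) = cf v h (\<beta>, \<gamma>)" if bg: "(\<beta>, \<gamma>) \<in> pairs" for \<beta> \<gamma> h
  proof (cases "\<exists>r t. v = comb \<beta> \<gamma> r t")
    case True
    then obtain r t where rs: "v = comb \<beta> \<gamma> r t" by blast
    then have "s i v = comb (s i \<beta>) (s i \<gamma>) r t" using sc by simp
    from cf_eq[OF tp[OF bg] this] cf_eq[OF bg rs] show ?thesis by simp
  next
    case False
    then have "s i v \<noteq> comb (s i \<beta>) (s i \<gamma>) r t" for r t using sc inj by metis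
    then show ?thesis using False by (simp add: cf_0)
  qed
  have wed: "wedge (s i \<beta>) (s i \<gamma>) (s i x) (s i z) = wedge \<beta> \<gamma> x z" for \<beta> \<gamma> x z
    by (simp add: wedge_def reflection_inner[OF nz])
  have Ks: "kern (s i x) (s i z) (s i y) (s i w) (s i \<beta>) (s i \<gamma>) = kern x z y w \<beta> \<gamma>" for \<beta> \<gamma>
    unfolding kern_def wed by (simp add: reflection_inner[OF nz])
  let ?k = "\<lambda>\<beta> \<gamma>. kern x z y w \<beta> \<gamma>" let ?n = "\<lambda>\<beta> \<gamma>. cf v (\<lambda>r u. 1) (\<beta>, \<gamma>)"
  let ?m = "\<lambda>\<beta> \<gamma>. cf v (\<lambda>r u. sgn r * sgn u) (\<beta>, \<gamma>)"
  define e where "e \<beta> = (if \<beta> = \<alpha> i \<or> \<beta> = - \<alpha> i then 1 else 0 :: int)" for \<beta>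
  have "symcoeff (s i v) (s i x) (s i z) (s i y) (s i w) =
     (\<Sum>(\<beta>, \<gamma>)\<in>pairs. ?k \<beta> \<gamma> * of_int (sg (s i \<beta>) * sg (s i \<gamma>) * ?n \<beta> \<gamma> + ?m \<beta> \<gamma>))"
  proof -
    let ?F = "\<lambda>(\<beta>, \<gamma>). kern (s i x) (s i z) (s i y) (s i w) \<beta> \<gamma> * of_int (sg \<beta> * sg \<gamma> * cf (s i v) (\<lambda>r u. 1) (\<beta>, \<gamma>)
      + cf (s i v) (\<lambda>r u. sgn r * sgn u) (\<beta>, \<gamma>))"
    have "sum ?F pairs = (\<Sum>p\<in>pairs. ?F (?t p))"
      by (rule sum.reindex_bij_witness[of _ ?t ?t]) (use tp ss in auto)
    also have "\<dots> = (\<Sum>(\<beta>, \<gamma>)\<in>pairs. ?k \<beta> \<gamma> * of_int (sg (s i \<beta>) * sg (s i \<gamma>) * ?n \<beta> \<gamma> + ?m \<beta> \<gamma>))"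
      by (rule sum.cong[OF refl]) (use cfs Ks in auto)
    finally show ?thesis unfolding symcoeff_def .
  qed
  also have "\<dots> = (\<Sum>(\<beta>, \<gamma>)\<in>pairs. ?k \<beta> \<gamma> * of_int (sg \<beta> * sg \<gamma> * ?n \<beta> \<gamma> + ?m \<beta> \<gamma>)
      - 2 * (?k \<beta> \<gamma> * of_int (e \<beta> * sg \<beta> * sg \<gamma> * ?n \<beta> \<gamma>)) - 2 * (?k \<beta> \<gamma> * of_int (e \<gamma> * sg \<beta> * sg \<gamma> * ?n \<beta> \<gamma>)))"
  proof (rule sum.cong[OF refl], clarify)
    fix \<beta> \<gamma> assume bg: "(\<beta>, \<gamma>) \<in> pairs"
    then have b: "\<beta> \<in> R" "\<gamma> \<in> R" "\<gamma> \<noteq> \<beta>" "\<gamma> \<noteq> - \<beta>" by (auto simp: pairs_def)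
    \<comment> \<open>A pair contains at most one of the roots \<open>\<alpha> i\<close> and
      \<open>- \<alpha> i\<close>, so no term with \<open>e \<beta> * e \<gamma>\<close>
      arises.\<close>
    have sgeq: "sg (s i \<beta>) * sg (s i \<gamma>) = sg \<beta> * sg \<gamma> - 2 * (e \<beta> * sg \<beta> * sg \<gamma>) - 2 * (e \<gamma> * sg \<beta> * sg \<gamma>)"
      unfolding sg_s[OF b(1)] sg_s[OF b(2)] e_def using b(3,4) by auto
    show "?k \<beta> \<gamma> * of_int (sg (s i \<beta>) * sg (s i \<gamma>) * ?n \<beta> \<gamma> + ?m \<beta> \<gamma>) = ?k \<beta> \<gamma> * of_int (sg \<beta> * sg \<gamma> * ?n \<beta> \<gamma> + ?m \<beta> \<gamma>)
      - 2 * (?k \<beta> \<gamma> * of_int (e \<beta> * sg \<beta> * sg \<gamma> * ?n \<beta> \<gamma>)) - 2 * (?k \<beta> \<gamma> * of_int (e \<gamma> * sg \<beta> * sg \<gamma> * ?n \<beta> \<gamma>))"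
      unfolding sgeq by (simp add: algebra_simps)
  qed
  also have "\<dots> = symcoeff v x z y w - 2 * (\<Sum>(\<beta>, \<gamma>)\<in>pairs. ?k \<beta> \<gamma> * of_int (e \<beta> * sg \<beta> * sg \<gamma> * ?n \<beta> \<gamma>))
      - 2 * (\<Sum>(\<beta>, \<gamma>)\<in>pairs. ?k \<beta> \<gamma> * of_int (e \<gamma> * sg \<beta> * sg \<gamma> * ?n \<beta> \<gamma>))"
    by (simp add: symcoeff_def sum_subtractf case_prod_unfold sum_distrib_left)
  also have z1: "(\<Sum>(\<beta>, \<gamma>)\<in>pairs. ?k \<beta> \<gamma> * of_int (e \<beta> * sg \<beta> * sg \<gamma> * ?n \<beta> \<gamma>)) = 0"
  proof -
    have "e \<beta> * sg \<beta> * sg (reflection \<beta> \<gamma>) * ?n \<beta> (reflection \<beta> \<gamma>) = e \<beta> * sg \<beta> * sg \<gamma> * ?n \<beta> \<gamma>" if bg: "(\<beta>, \<gamma>) \<in> pairs" for \<beta> \<gamma>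
    proof (cases "\<beta> = \<alpha> i \<or> \<beta> = - \<alpha> i")
      case True
      have "reflection (- u) = reflection u" for u :: 'a by (simp add: reflection_def fun_eq_iff)
      then have "reflection \<beta> = s i" using True by metis
      moreover have "sg (s i \<gamma>) = sg \<gamma>" using bg True by (subst sg_s) (auto simp: pairs_def)
      ultimately have "sg (reflection \<beta> \<gamma>) = sg \<gamma>" by simp
      then show ?thesis using flip_cf[OF bg, of v "\<lambda>u. 1"] by simp
    qed (simp add: e_def)
    then show ?thesis by (rule flip_sum)
  qed
  also have "(\<Sum>(\<beta>, \<gamma>)\<in>pairs. ?k \<beta> \<gamma> * of_int (e \<gamma> * sg \<beta> * sg \<gamma> * ?n \<beta> \<gamma>)) = (\<Sum>(\<beta>, \<gamma>)\<in>pairs. ?k \<gamma> \<beta> * of_int (e \<beta> * sg \<gamma> * sg \<beta> * ?n \<gamma> \<beta>))"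
    by (rule swap_sum)
  also have "\<dots> = (\<Sum>(\<beta>, \<gamma>)\<in>pairs. ?k \<beta> \<gamma> * of_int (e \<beta> * sg \<beta> * sg \<gamma> * ?n \<beta> \<gamma>))"
  proof (rule sum.cong[OF refl], clarify)
    fix \<beta> \<gamma> assume "(\<beta>, \<gamma>) \<in> pairs"
    from cf_swap[OF this, of v "\<lambda>r u. 1"] show "?k \<gamma> \<beta> * of_int (e \<beta> * sg \<gamma> * sg \<beta> * ?n \<gamma> \<beta>) = ?k \<beta> \<gamma> * of_int (e \<beta> * sg \<beta> * sg \<gamma> * ?n \<beta> \<gamma>)"
      by (simp add: kern_swap mult_ac)
  qed
  also note z1
  finally show ?thesis by simp
qed

lemma qcoeff_reflection: "qcoeff (s i v) (s i x) (s i z) (s i y) (s i w) = qcoeff v x z y w"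
  by (simp add: qcoeff_eq_symcoeff symcoeff_reflection)

text \<open>A nonzero weight requires the multiples of \<open>\<beta>\<close> and
  \<open>\<gamma>\<close> summing to \<open>v\<close> to have nonnegative coefficients.\<close>

lemma qcoeff_support: assumes "\<omega> j \<bullet> v < 0" shows "qcoeff v x z y w = 0"
proof -
  have key: "\<omega> j \<bullet> of_int r *\<^sub>R \<beta> \<ge> 0" if "\<beta> \<in> R" "sg \<beta> + sgn r \<noteq> 0" for \<beta> r
  proof (cases "\<beta> \<in> P")
    case True
    then have "r \<ge> 0" using that by (auto simp: sg_def sgn_if split: if_splits)
    moreover have "\<omega> j \<bullet> \<beta> \<ge> 0" using True P_iff by blast
    ultimately show ?thesis by simp
  next
    case False
    then have "r \<le> 0" using that by (auto simp: sg_def sgn_if split: if_splits)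
    moreover have "- \<beta> \<in> P" using P_or that False by blast
    then have "\<omega> j \<bullet> \<beta> \<le> 0" using P_iff[of "-\<beta>"] by simp
    ultimately show ?thesis by (simp add: mult_nonpos_nonpos)
  qed
  have "wt v \<beta> \<gamma> = 0" if bg: "(\<beta>, \<gamma>) \<in> pairs" for \<beta> \<gamma>
  proof (cases "\<exists>r u. v = comb \<beta> \<gamma> r u")
    case True
    then obtain r u where rs: "v = comb \<beta> \<gamma> r u" by blast
    have b: "\<beta> \<in> R" "\<gamma> \<in> R" using bg by (auto simp: pairs_def)
    have "\<not> (sg \<beta> + sgn r \<noteq> 0 \<and> sg \<gamma> + sgn u \<noteq> 0)"
      using key[OF b(1), of r] key[OF b(2), of u] assms unfolding rs comb_def inner_add_right by linarith
    then show ?thesis unfolding cf_eq[OF bg rs] by auto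
  qed (simp add: cf_0)
  then show ?thesis unfolding qcoeff_def by (intro sum.neutral) auto
qed

text \<open>Induction on the height. In the positive cone some \<open>\<alpha> i \<bullet> v\<close>
  is positive, and by integrality \<open>s i\<close> lowers the height by at least 1; outside the
  cone \<open>qcoeff_support\<close> applies.\<close>

lemma qcoeff_zero:
  assumes "v \<noteq> 0" "\<And>i. \<omega> i \<bullet> v \<in> \<int>" shows "qcoeff v x z y w = 0"
proof -
  have "v \<noteq> 0 \<Longrightarrow> (\<And>i. \<omega> i \<bullet> v \<in> \<int>) \<Longrightarrow> ht v \<le> real m \<Longrightarrow> qcoeff v x z y w = 0" for m
  proof (induction m arbitrary: v x z y w)
    case (0 v)
    show ?case
    proof (cases "\<exists>j. \<omega> j \<bullet> v < 0")
      case False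
      then have nn: "0 \<le> \<omega> i \<bullet> v" for i by (simp add: not_less)
      have "v = 0" using ht_le_0[OF nn] 0 by simp
      then show ?thesis using 0 by simp
    qed (use qcoeff_support in blast)
  next
    case (Suc m v)
    show ?case
    proof (cases "\<exists>j. \<omega> j \<bullet> v < 0")
      case False
      then have nn: "0 \<le> \<omega> i \<bullet> v" for i by (simp add: not_less)
      have "v \<bullet> v > 0" using Suc by simp
      have "\<exists>i. \<alpha> i \<bullet> v > 0"
      proof (rule ccontr)
        assume "\<not> ?thesis"
        then have "\<alpha> i \<bullet> v \<le> 0" for i by (simp add: not_less)
        then have "v \<bullet> v \<le> 0" unfolding inner_expand[of v v] by (intro sum_nonpos mult_nonneg_nonpos nn)
        then show False using \<open>v \<bullet> v > 0\<close> by simp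
      qed
      then obtain i where i: "\<alpha> i \<bullet> v > 0" by blast
      have "ci i * (\<alpha> i \<bullet> v) = (\<Sum>j\<in>UNIV. (\<omega> j \<bullet> v) * (ci i * (\<alpha> i \<bullet> \<alpha> j)))"
        by (subst expand[of v]) (simp add: inner_sum_right sum_distrib_left mult_ac)
      moreover have "(\<omega> j \<bullet> v) * (ci i * (\<alpha> i \<bullet> \<alpha> j)) \<in> \<int>" for j
        using Ints_mult[OF Suc.prems(2) cartan_int[OF simple_in simple_in]] .
      ultimately have int: "ci i * (\<alpha> i \<bullet> v) \<in> \<int>" by (simp only: Ints_sum)
      have pos: "ci i * (\<alpha> i \<bullet> v) > 0" using i simple_pos[of i] by simp
      have ht: "ht (s i v) \<le> real m" using Suc.prems(3) Int_pos_ge_1[OF int pos] unfolding ht_s by simp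
      have nz: "s i v \<noteq> 0" using Suc.prems(1) s_norm[of i v] by (metis inner_eq_zero_iff)
      have cint: "\<omega> j \<bullet> s i v \<in> \<int>" for j
        using Suc.prems(2)[of j] int by (auto simp only: reflection_eq inner_diff_right inner_scaleR_right dual intro!: Ints_diff Ints_mult Ints_0 Ints_1 split: if_splits)
      show ?thesis using Suc.IH[OF nz cint ht] qcoeff_reflection by metis
    qed (use qcoeff_support in blast)
  qed
  then show ?thesis using assms real_arch_simple by blast
qed

end

section \<open>Coefficients of power series\<close>

lemma mfps_nth_sum: "mfps_nth (\<Sum>x\<in>A. f x) m = (\<Sum>x\<in>A. mfps_nth (f x :: ('n::finite, 'c::comm_ring_1) mfps) m)"
  by (induction A rule: infinite_finite_induct) (simp_all add: zero_mfps.rep_eq plus_mfps.rep_eq)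

lemma mfps_const_times_nth:
  "mfps_nth (mfps_const c * (f :: ('n::finite, 'c::comm_ring_1) mfps)) m = c * mfps_nth f m"
proof -
  have "mfps_nth (mfps_const c * f) m = (\<Sum>(a, b)\<in>splits m. (if a = 0 then c else 0) * mfps_nth f b)"
    by (simp add: times_mfps.rep_eq mfps_const.rep_eq)
  also have "\<dots> = (\<Sum>(a, b)\<in>{(0 :: 'n \<Rightarrow> nat, m)}. (if a = 0 then c else 0) * mfps_nth f b)"
    by (rule sum.mono_neutral_right[OF finite_splits]) (auto simp: splits_def split: if_splits)
  finally show ?thesis by simp
qed

lemma mfps_const_of_int: "mfps_const (of_int k) = (of_int k :: ('n::finite, 'c::comm_ring_1) mfps)"
proof -
  have nat: "mfps_const (of_nat k) = (of_nat k :: ('n, 'c) mfps)" for k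
    by (induction k) (auto intro!: mfps_eqI simp: mfps_const.rep_eq plus_mfps.rep_eq one_mfps.rep_eq zero_mfps.rep_eq
        fun_eq_iff dest!: sym[of "mfps_const _"])
  have neg: "mfps_const (- c) = (- mfps_const c :: ('n, 'c) mfps)" for c
    by (auto intro!: mfps_eqI simp: mfps_const.rep_eq uminus_mfps.rep_eq)
  show ?thesis
    by (cases k rule: int_cases2) (simp_all add: nat neg)
qed

lemma mfps_of_int_times_nth:
  "mfps_nth (of_int k * (f :: ('n::finite, 'c::comm_ring_1) mfps)) m = of_int k * mfps_nth f m"
  by (metis mfps_const_of_int mfps_const_times_nth)

lemma mfps_of_int_nth: "mfps_nth (of_int k :: ('n::finite, 'c::comm_ring_1) mfps) m = (if m = 0 then of_int k else 0)"
  unfolding mfps_const_of_int[symmetric] by (simp add: mfps_const.rep_eq)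

context irreducible_roots begin

section \<open>Reduction to pairs of positive roots\<close>

abbreviation "fq \<equiv> root_qfrac \<alpha>"

lemma R_split: "R = P \<union> uminus ` P" "P \<inter> uminus ` P = {}"
proof -
  show "R = P \<union> uminus ` P"
  proof
    show "R \<subseteq> P \<union> uminus ` P" using P_or by (force simp: image_iff)
    show "P \<union> uminus ` P \<subseteq> R" using P_subset uminus_in by auto
  qed
  show "P \<inter> uminus ` P = {}" using P_not_both by auto
qed

lemma sum_R: "sum f R = (\<Sum>\<beta>\<in>P. f \<beta> + (f (- \<beta>) :: real))"
proof -
  have "sum f R = sum f P + sum f (uminus ` P)"
    using R_split finite_P by (metis finite_imageI sum.union_disjoint)
  also have "sum f (uminus ` P) = (\<Sum>\<beta>\<in>P. f (- \<beta>))" by (subst sum.reindex) (auto simp: inj_on_def)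
  finally show ?thesis by (simp add: sum.distrib)
qed

definition kern_term where "kern_term v x z y w \<beta> \<gamma> = (if (\<beta>, \<gamma>) \<in> pairs then kern x z y w \<beta> \<gamma> *
   of_int (wt v \<beta> \<gamma>) else 0)"

lemma H_kern_term: "qcoeff v x z y w = (\<Sum>\<beta>\<in>R. \<Sum>\<gamma>\<in>R. kern_term v x z y w \<beta> \<gamma>)"
proof -
  have "qcoeff v x z y w = (\<Sum>(\<beta>, \<gamma>)\<in>pairs. kern_term v x z y w \<beta> \<gamma>)"
    unfolding qcoeff_def by (rule sum.cong) (auto simp: kern_term_def)
  also have "\<dots> = (\<Sum>(\<beta>, \<gamma>)\<in>R \<times> R. kern_term v x z y w \<beta> \<gamma>)"
    by (rule sum.mono_neutral_left) (use finite_R in \<open>auto simp: kern_term_def pairs_def\<close>)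
  finally show ?thesis by (simp add: sum.cartesian_product)
qed

lemma sg_neg: assumes "\<beta> \<in> R" shows "sg (- \<beta>) = - sg \<beta>"
  using assms P_or[OF assms] P_not_both[of \<beta>] by (auto simp: sg_def)

text \<open>Negating \<open>\<beta>\<close> changes the sign of both \<open>kern\<close> and the
  weight.\<close>

lemma kern_term_neg: "kern_term v x z y w (- \<beta>) \<gamma> = kern_term v x z y w \<beta> \<gamma>"
proof (cases "(\<beta>, \<gamma>) \<in> pairs")
  case True
  then have b: "\<beta> \<in> R" and p: "(- \<beta>, \<gamma>) \<in> pairs" using uminus_in by (auto simp: pairs_def)
  have "cf v (\<lambda>r u. (sg (- \<beta>) + sgn r) * (sg \<gamma> + sgn u)) (- \<beta>, \<gamma>) = - wt v \<beta> \<gamma>"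
  proof (cases "\<exists>r u. v = comb \<beta> \<gamma> r u")
    case t: True
    then obtain r u where 1: "v = comb \<beta> \<gamma> r u" by blast
    then have 2: "v = comb (- \<beta>) \<gamma> (- r) u" by (simp add: comb_def)
    show ?thesis unfolding cf_eq[OF True 1] cf_eq[OF p 2] sg_neg[OF b] by (simp add: sgn_minus algebra_simps)
  next
    case False
    have "comb (- \<beta>) \<gamma> r u = comb \<beta> \<gamma> (- r) u" for r u by (simp add: comb_def)
    then have "\<not> (\<exists>r u. v = comb (- \<beta>) \<gamma> r u)" using False by metis
    then show ?thesis using False by (simp add: cf_0)
  qed
  moreover have "kern x z y w (- \<beta>) \<gamma> = - kern x z y w \<beta> \<gamma>" by (simp add: kern_def wedge_def algebra_simps)
  ultimately show ?thesis using True p by (simp add: kern_term_def)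
next
  case False
  then have "(- \<beta>, \<gamma>) \<notin> pairs" using uminus_in unfolding pairs_def by (auto, metis minus_minus)
  then show ?thesis using False by (simp add: kern_term_def)
qed

lemma kern_term_swap: "kern_term v x z y w \<beta> \<gamma> = kern_term v x z y w \<gamma> \<beta>"
proof (cases "(\<beta>, \<gamma>) \<in> pairs")
  case True
  then have "(\<gamma>, \<beta>) \<in> pairs" using swap_pairs by blast
  then show ?thesis using True unfolding kern_term_def by (subst cf_swap) (auto simp: kern_swap mult.commute)
next
  case False
  then have "(\<gamma>, \<beta>) \<notin> pairs" using swap_pairs by blast
  then show ?thesis using False by (simp add: kern_term_def)
qed

text \<open>The four choices of signs for two positive roots contribute equally.\<close>

lemma qcoeff_sum_P: "qcoeff v x z y w = 4 * (\<Sum>\<beta>\<in>P. \<Sum>\<gamma>\<in>P. kern_term v x z y w \<beta> \<gamma>)"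
proof -
  have neg2: "kern_term v x z y w \<beta> (- \<gamma>) = kern_term v x z y w \<beta> \<gamma>" for \<beta> \<gamma> using kern_term_swap kern_term_neg by metis
  have "qcoeff v x z y w = (\<Sum>\<beta>\<in>P. \<Sum>\<gamma>\<in>P. 4 * kern_term v x z y w \<beta> \<gamma>)"
    unfolding H_kern_term sum_R kern_term_neg neg2 by (simp add: sum.distrib sum_distrib_left)
  then show ?thesis by (simp add: sum_distrib_left)
qed

section \<open>Exponents as vectors and the coefficients of products of two series\<close>

definition vec :: "('n \<Rightarrow> nat) \<Rightarrow> 'a" where "vec \<nu> = (\<Sum>i\<in>UNIV. real (\<nu> i) *\<^sub>R \<alpha> i)"

lemma vec_coord: "\<omega> i \<bullet> vec \<nu> = real (\<nu> i)"
  by (simp add: vec_def inner_sum_right dual if_distrib cong: if_cong)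
lemma vec_inj: "vec \<nu> = vec \<nu>' \<longleftrightarrow> \<nu> = \<nu>'"
  using vec_coord by (metis ext of_nat_eq_iff)

definition kk :: "'a \<Rightarrow> 'n \<Rightarrow> nat" where "kk \<beta> = (\<lambda>i. nat (root_coords \<alpha> \<beta> i))"

lemma kk: assumes "\<beta> \<in> P" shows "real (kk \<beta> i) = \<omega> i \<bullet> \<beta>"
proof -
  have "real_of_int (root_coords \<alpha> \<beta> i) = \<omega> i \<bullet> \<beta>" using coord_root assms P_subset by blast
  moreover have "\<omega> i \<bullet> \<beta> \<ge> 0" using assms P_iff by blast
  ultimately show ?thesis unfolding kk_def by (metis of_int_0_le_iff of_nat_nat)
qed
lemma vec_kk: assumes "\<beta> \<in> P" "\<gamma> \<in> P"
  shows "vec (\<lambda>i. r * kk \<beta> i + u * kk \<gamma> i) = comb \<beta> \<gamma> (int r) (int u)"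
  by (rule inner_dual_eqI) (simp add: vec_coord comb_def inner_add_right kk[OF assms(1)] kk[OF assms(2)])
lemma kk_nz: assumes "\<beta> \<in> P" shows "kk \<beta> \<noteq> 0"
proof
  assume "kk \<beta> = 0"
  then have "\<omega> i \<bullet> \<beta> = 0" for i using kk[OF assms, of i] by simp
  then have "\<beta> = 0" by (intro inner_dual_eqI) simp
  then show False using assms root_nz P_subset by blast
qed

text \<open>Writing the coefficients 1 and 2 as \<open>1 + sgn (int r)\<close> matches the form used
  in \<open>wt\<close>.\<close>

lemma qfrac_nth_mult: assumes "\<beta> \<in> P"
  shows "mfps_nth (fq \<beta>) (\<lambda>i. r * kk \<beta> i) = of_int (1 + sgn (int r))"
proof (cases "r = 0")
  case True
  then show ?thesis unfolding root_qfrac_def qfrac.rep_eq by (simp add: zero_fun_def)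
next
  case False
  obtain j where "kk \<beta> j \<noteq> 0" using kk_nz[OF assms] by (auto simp: fun_eq_iff)
  then have "(\<lambda>i. r * kk \<beta> i) \<noteq> 0" using False by (auto simp: fun_eq_iff)
  then show ?thesis using False unfolding root_qfrac_def qfrac.rep_eq kk_def[symmetric] by auto
qed
lemma qfrac_nth_0: assumes "mfps_nth (fq \<beta>) k1 \<noteq> 0" obtains r where "k1 = (\<lambda>i. r * kk \<beta> i)"
proof (cases "k1 = 0")
  case True
  then have "k1 = (\<lambda>i. 0 * kk \<beta> i)" by (simp add: zero_fun_def)
  then show ?thesis using that by blast
next
  case False
  then show ?thesis using assms that unfolding root_qfrac_def qfrac.rep_eq kk_def[symmetric] by (auto split: if_splits)
qed

lemma P_pairs: "\<beta> \<in> P \<Longrightarrow> \<gamma> \<in> P \<Longrightarrow> \<beta> \<noteq> \<gamma> \<Longrightarrow> (\<beta>, \<gamma>) \<in> pairs"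
  using P_subset P_not_both by (auto simp: pairs_def)

text \<open>Since \<open>\<beta>\<close> and \<open>\<gamma>\<close> are linearly independent, at
  most one splitting of \<open>\<nu>\<close> contributes to the convolution.\<close>

lemma qfrac_prod_nth: assumes P: "\<beta> \<in> P" "\<gamma> \<in> P" "\<beta> \<noteq> \<gamma>"
  shows "mfps_nth (fq \<beta> * fq \<gamma>) \<nu> = of_int (wt (vec \<nu>) \<beta> \<gamma>)"
proof -
  let ?f = "mfps_nth (fq \<beta>)" let ?g = "mfps_nth (fq \<gamma>)"
  have sg: "sg \<beta> = 1" "sg \<gamma> = 1" using P by (auto simp: sg_def)
  have pr: "(\<beta>, \<gamma>) \<in> pairs" using P_pairs P by blast
  have L: "mfps_nth (fq \<beta> * fq \<gamma>) \<nu> = (\<Sum>(k1, k2)\<in>splits \<nu>. ?f k1 * ?g k2)"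
    by (simp add: times_mfps.rep_eq)
  have nz: "\<exists>r u. k1 = (\<lambda>i. r * kk \<beta> i) \<and> k2 = (\<lambda>i. u * kk \<gamma> i) \<and> vec \<nu> = comb \<beta> \<gamma> (int r) (int u)"
    if ab: "(k1, k2) \<in> splits \<nu>" "?f k1 * ?g k2 \<noteq> 0" for k1 k2
  proof -
    obtain r where r: "k1 = (\<lambda>i. r * kk \<beta> i)" using qfrac_nth_0[of \<beta> k1] ab(2) by (metis mult_zero_left)
    obtain u where u: "k2 = (\<lambda>i. u * kk \<gamma> i)" using qfrac_nth_0[of \<gamma> k2] ab(2) by (metis mult_zero_right)
    have "\<nu> = (\<lambda>i. r * kk \<beta> i + u * kk \<gamma> i)" using ab(1) r u by (auto simp: splits_def plus_fun_def)
    then show ?thesis using vec_kk[OF P(1,2)] r u by blast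
  qed
  show ?thesis
  proof (cases "\<exists>r u. vec \<nu> = comb \<beta> \<gamma> (int r) (int u)")
    case True
    then obtain r u where ru: "vec \<nu> = comb \<beta> \<gamma> (int r) (int u)" by blast
    let ?a = "\<lambda>i. r * kk \<beta> i" let ?b = "\<lambda>i. u * kk \<gamma> i"
    have "\<nu> = (\<lambda>i. r * kk \<beta> i + u * kk \<gamma> i)" using ru vec_kk[OF P(1,2)] vec_inj by metis
    then have ab: "(?a, ?b) \<in> splits \<nu>" by (simp add: splits_def plus_fun_def)
    have "(\<Sum>(k1, k2)\<in>splits \<nu>. ?f k1 * ?g k2) = (\<Sum>(k1, k2)\<in>{(?a, ?b)}. ?f k1 * ?g k2)"
    proof (rule sum.mono_neutral_right)
      show "\<forall>p\<in>splits \<nu> - {(?a, ?b)}. (case p of (k1, k2) \<Rightarrow> ?f k1 * ?g k2) = 0"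
      proof (rule ballI, rule ccontr)
        fix p assume p: "p \<in> splits \<nu> - {(?a, ?b)}" "(case p of (k1, k2) \<Rightarrow> ?f k1 * ?g k2) \<noteq> 0"
        obtain k1 k2 where "p = (k1, k2)" by force
        then have ab: "(k1, k2) \<in> splits \<nu>" "(k1, k2) \<noteq> (?a, ?b)" "?f k1 * ?g k2 \<noteq> 0" using p by auto
        obtain r' u' where k: "k1 = (\<lambda>i. r' * kk \<beta> i)" "k2 = (\<lambda>i. u' * kk \<gamma> i)"
          and v: "vec \<nu> = comb \<beta> \<gamma> (int r') (int u')"
          using nz[OF ab(1,3)] by blast
        have "int r' = int r \<and> int u' = int u" by (rule comb_unique[OF pr trans[OF sym[OF v] ru]])
        then show False using ab(2) k by simp
      qed
    qed (use ab in auto)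
    also have "\<dots> = of_int ((1 + sgn (int r)) * (1 + sgn (int u)))" using qfrac_nth_mult P by simp
    finally show ?thesis unfolding L cf_eq[OF pr ru] sg .
  next
    case False
    have "(\<Sum>(k1, k2)\<in>splits \<nu>. ?f k1 * ?g k2) = 0"
    proof (rule sum.neutral, rule ballI, rule ccontr)
      fix p assume p: "p \<in> splits \<nu>" "(case p of (k1, k2) \<Rightarrow> ?f k1 * ?g k2) \<noteq> 0"
      obtain k1 k2 where "p = (k1, k2)" by force
      then have "(k1, k2) \<in> splits \<nu>" "?f k1 * ?g k2 \<noteq> 0" using p by auto
      from nz[OF this] False show False by blast
    qed
    moreover have "cf (vec \<nu>) (\<lambda>r u. (1 + sgn r) * (1 + sgn u)) (\<beta>, \<gamma>) = 0"
    proof (cases "\<exists>r u. vec \<nu> = comb \<beta> \<gamma> r u")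
      case True
      then obtain r u where ru: "vec \<nu> = comb \<beta> \<gamma> r u" by blast
      \<comment> \<open>A representation with a negative coefficient gets weight 0 from the factor
        \<open>1 + sgn\<close>.\<close>
      have "r < 0 \<or> u < 0" using False ru by (metis int_nat_eq linorder_not_le nat_0_le)
      then show ?thesis unfolding cf_eq[OF pr ru] by auto
    qed (simp add: cf_0)
    ultimately show ?thesis unfolding L sg by simp
  qed
qed

text \<open>At exponent 0 this is \<open>curv_eps\<close>. At the others, symmetrising in
  \<open>\<beta>\<close> and \<open>\<gamma>\<close> yields a multiple of \<open>qcoeff\<close>,
  which vanishes. The four vectors may be arbitrary, as integrality is required of \<open>N\<close>
  and \<open>E\<close> only.\<close>

lemma quantum_curvature:
  assumes N: "\<And>\<beta> \<gamma>. \<beta> \<in> P \<Longrightarrow> \<gamma> \<in> P \<Longrightarrow> real_of_int (N \<beta> \<gamma>) =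
      c \<beta> * c \<gamma> * (\<beta> \<bullet> \<gamma>) * ((x \<bullet> \<beta>) * (z \<bullet> \<gamma>)) * ((y \<bullet> \<beta>) * (w \<bullet> \<gamma>) - (w \<bullet> \<beta>) * (y \<bullet> \<gamma>))"
    and E: "real_of_int E = eps R \<alpha> * ((x \<bullet> y) * (z \<bullet> w) - (x \<bullet> w) * (z \<bullet> y))"
  shows "(\<Sum>\<beta>\<in>P. \<Sum>\<gamma>\<in>P. of_int (N \<beta> \<gamma>) * (fq \<beta> * fq \<gamma>)) = of_int E"
proof (rule mfps_eqI)
  fix \<nu>
  define e where "e \<beta> \<gamma> = wt (vec \<nu>) \<beta> \<gamma>" for \<beta> \<gamma>
  have N0: "N \<beta> \<beta> = 0" if "\<beta> \<in> P" for \<beta>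
  proof -
    have "real_of_int (N \<beta> \<beta>) = 0" unfolding N[OF that that] by (simp add: mult.commute)
    then show ?thesis by simp
  qed
  have t: "mfps_nth (of_int (N \<beta> \<gamma>) * (fq \<beta> * fq \<gamma>)) \<nu> = of_int (N \<beta> \<gamma> * e \<beta> \<gamma>)"
    if "\<beta> \<in> P" "\<gamma> \<in> P" for \<beta> \<gamma>
    using that N0 by (cases "\<beta> = \<gamma>") (simp_all add: mfps_of_int_times_nth qfrac_prod_nth e_def zero_mfps.rep_eq)
  have L: "mfps_nth (\<Sum>\<beta>\<in>P. \<Sum>\<gamma>\<in>P. of_int (N \<beta> \<gamma>) * (fq \<beta> * fq \<gamma>)) \<nu> =
      of_int (\<Sum>\<beta>\<in>P. \<Sum>\<gamma>\<in>P. N \<beta> \<gamma> * e \<beta> \<gamma>)"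
    unfolding mfps_nth_sum using t by simp
  have "(\<Sum>\<beta>\<in>P. \<Sum>\<gamma>\<in>P. N \<beta> \<gamma> * e \<beta> \<gamma>) = (if \<nu> = 0 then E else 0)"
  proof (cases "\<nu> = 0")
    case True
    then have v0: "vec \<nu> = comb \<beta> \<gamma> 0 0" for \<beta> \<gamma> by (simp add: vec_def comb_def)
    then have e1: "e \<beta> \<gamma> = 1" if "\<beta> \<in> P" "\<gamma> \<in> P" "\<beta> \<noteq> \<gamma>" for \<beta> \<gamma>
      using that unfolding e_def cf_eq[OF P_pairs[OF that] v0] by (simp add: sg_def)
    have "(\<Sum>\<beta>\<in>P. \<Sum>\<gamma>\<in>P. N \<beta> \<gamma> * e \<beta> \<gamma>) = (\<Sum>\<beta>\<in>P. \<Sum>\<gamma>\<in>P. N \<beta> \<gamma>)"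
      by (intro sum.cong refl) (metis e1 N0 mult_zero_left mult.right_neutral)
    moreover have "real_of_int (\<Sum>\<beta>\<in>P. \<Sum>\<gamma>\<in>P. N \<beta> \<gamma>) = curv x z y w"
    proof -
      have "cprod x y \<bullet> cprod z w = (\<Sum>\<beta>\<in>P. \<Sum>\<gamma>\<in>P. c \<beta> * c \<gamma> * (\<beta> \<bullet> \<gamma>) * ((x \<bullet> \<beta>) * (z \<bullet> \<gamma>)) * ((y \<bullet> \<beta>) * (w \<bullet> \<gamma>)))" for x y z w
        unfolding cprod_def by (simp only: inner_sum_left, simp only: inner_sum_right, intro sum.cong refl) (simp add: mult_ac)
      from this[of x y z w] this[of x w y z]
      have "curv x z y w = (\<Sum>\<beta>\<in>P. \<Sum>\<gamma>\<in>P. c \<beta> * c \<gamma> * (\<beta> \<bullet> \<gamma>) * ((x \<bullet> \<beta>) * (z \<bullet> \<gamma>)) * ((y \<bullet> \<beta>) * (w \<bullet> \<gamma>))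
         - c \<beta> * c \<gamma> * (\<beta> \<bullet> \<gamma>) * ((x \<bullet> \<beta>) * (y \<bullet> \<gamma>)) * ((w \<bullet> \<beta>) * (z \<bullet> \<gamma>)))"
        unfolding curv_def by (simp only: sum_subtractf)
      also have "\<dots> = (\<Sum>\<beta>\<in>P. \<Sum>\<gamma>\<in>P. real_of_int (N \<beta> \<gamma>))"
        by (intro sum.cong refl) (simp only: N algebra_simps)
      finally show ?thesis by simp
    qed
    ultimately have "real_of_int (\<Sum>\<beta>\<in>P. \<Sum>\<gamma>\<in>P. N \<beta> \<gamma> * e \<beta> \<gamma>) = real_of_int E" using curv_eps E by simp
    then show ?thesis using True by (simp only: of_int_eq_iff if_True simp_thms)
  next
    case False
    let ?v = "vec \<nu>"
    have v0: "?v \<noteq> 0" using False vec_inj[of \<nu> 0] by (simp add: vec_def)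
    have "\<omega> i \<bullet> ?v \<in> \<int>" for i by (simp add: vec_coord)
    then have H0: "qcoeff ?v x z y w = 0" using qcoeff_zero[OF v0] by blast
    have esym: "e \<beta> \<gamma> = e \<gamma> \<beta>" if "\<beta> \<in> P" "\<gamma> \<in> P" "\<beta> \<noteq> \<gamma>" for \<beta> \<gamma>
      unfolding e_def using cf_swap[OF P_pairs[OF that]] by (simp add: mult.commute)
    let ?S = "\<Sum>\<beta>\<in>P. \<Sum>\<gamma>\<in>P. real_of_int (N \<beta> \<gamma>) * of_int (e \<beta> \<gamma>)"
    have "?S + ?S = ?S + (\<Sum>\<beta>\<in>P. \<Sum>\<gamma>\<in>P. real_of_int (N \<gamma> \<beta>) * of_int (e \<gamma> \<beta>))"
      by (subst (3) sum.swap) simp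
    also have "\<dots> = (\<Sum>\<beta>\<in>P. \<Sum>\<gamma>\<in>P. kern_term ?v x z y w \<beta> \<gamma>)"
      unfolding sum.distrib[symmetric]
    proof (intro sum.cong refl)
      fix \<beta> \<gamma> assume P: "\<beta> \<in> P" "\<gamma> \<in> P"
      show "real_of_int (N \<beta> \<gamma>) * of_int (e \<beta> \<gamma>) + real_of_int (N \<gamma> \<beta>) * of_int (e \<gamma> \<beta>) = kern_term ?v x z y w \<beta> \<gamma>"
      proof (cases "\<beta> = \<gamma>")
        case True then show ?thesis using N0 P by (simp add: kern_term_def pairs_def)
      next
        case False
        have "real_of_int (N \<beta> \<gamma>) + real_of_int (N \<gamma> \<beta>) = kern x z y w \<beta> \<gamma>"
          unfolding N[OF P] N[OF P(2,1)] kern_def wedge_def inner_commute[of \<gamma> \<beta>] by (simp only: algebra_simps)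
        then show ?thesis using esym[OF P False] P_pairs[OF P False]
          unfolding kern_term_def e_def[symmetric] by (simp add: distrib_right[symmetric])
      qed
    qed
    also have "\<dots> = 0" using H0 qcoeff_sum_P by simp
    finally have "?S = 0" by simp
    then have "real_of_int (\<Sum>\<beta>\<in>P. \<Sum>\<gamma>\<in>P. N \<beta> \<gamma> * e \<beta> \<gamma>) = 0" by simp
    then show ?thesis using False by (simp only: of_int_eq_0_iff if_False simp_thms)
  qed
  then show "mfps_nth (\<Sum>\<beta>\<in>P. \<Sum>\<gamma>\<in>P. of_int (N \<beta> \<gamma>) * (fq \<beta> * fq \<gamma>)) \<nu> = mfps_nth (of_int E) \<nu>"
    unfolding L mfps_of_int_nth by simp
qed

end

section \<open>Extension of scalars and bilinear products\<close>

text \<open>With an arbitrary degree bound, several polynomials can be expanded over one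
  range.\<close>

lemma laurent_of_poly_eq:
  assumes "degree p \<le> m"
  shows "laurent_of_poly p = (\<Sum>k\<le>m. Poly_Mapping.single (int k) (rat_of_int (poly.coeff p k)))"
  unfolding laurent_of_poly_def
  by (rule sum.mono_neutral_left) (use assms in \<open>auto simp: coeff_eq_0\<close>)

lemma laurent_add: "laurent_of_poly (p + q) = laurent_of_poly p + laurent_of_poly q"
proof -
  let ?m = "max (degree p) (degree q)"
  show ?thesis
    using laurent_of_poly_eq[of p ?m] laurent_of_poly_eq[of q ?m] laurent_of_poly_eq[OF degree_add_le_max[of p q]]
    by (simp add: single_add sum.distrib)
qed

lemma laurent_smult: "laurent_of_poly (smult c p) = Poly_Mapping.single 0 (rat_of_int c) * laurent_of_poly p"
  by (subst laurent_of_poly_eq[of _ "degree p"], rule degree_smult_le)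
    (simp add: laurent_of_poly_def sum_distrib_left mult_single del: single_of_int)

lemma laurent_pCons:
  "laurent_of_poly (pCons c p) = Poly_Mapping.single 0 (rat_of_int c) + Poly_Mapping.single 1 1 * laurent_of_poly p"
proof -
  have "laurent_of_poly (pCons c p) = (\<Sum>k\<le>Suc (degree p). Poly_Mapping.single (int k) (rat_of_int (poly.coeff (pCons c p) k)))"
    by (rule laurent_of_poly_eq) (rule degree_pCons_le)
  also have "\<dots> = Poly_Mapping.single 0 (rat_of_int c) +
      (\<Sum>k\<le>degree p. Poly_Mapping.single (int (Suc k)) (rat_of_int (poly.coeff p k)))"
    by (subst sum.atMost_Suc_shift) simp
  also have "(\<Sum>k\<le>degree p. Poly_Mapping.single (int (Suc k)) (rat_of_int (poly.coeff p k))) = Poly_Mapping.single 1 1 * laurent_of_poly p"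
    unfolding laurent_of_poly_def sum_distrib_left by (simp add: mult_single)
  finally show ?thesis .
qed

lemma laurent_0: "laurent_of_poly 0 = 0" by (simp add: laurent_of_poly_def)

lemma laurent_1: "laurent_of_poly 1 = 1" by (simp add: laurent_of_poly_def)

lemma laurent_mult: "laurent_of_poly (p * q) = laurent_of_poly p * laurent_of_poly q"
proof (induction p)
  case (pCons c p)
  have "laurent_of_poly (pCons c p * q) = laurent_of_poly (smult c q) + laurent_of_poly (pCons 0 (p * q))"
    by (simp add: laurent_add)
  then show ?case using pCons by (simp add: laurent_smult laurent_pCons distrib_right mult.assoc)
qed (simp add: laurent_0)

lemma laurent_sum: "laurent_of_poly (\<Sum>x\<in>A. f x) = (\<Sum>x\<in>A. laurent_of_poly (f x))"
  by (induction A rule: infinite_finite_induct) (simp_all add: laurent_0 laurent_add)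

section \<open>Extension of scalars as a ring homomorphism\<close>

lemma extend_add: "extend_scalars (f + g) = extend_scalars f + extend_scalars g"
  by (rule mfps_eqI) (simp add: extend_scalars_def mfps_map.rep_eq plus_mfps.rep_eq laurent_add)
lemma extend_0: "extend_scalars 0 = 0"
  by (rule mfps_eqI) (simp add: extend_scalars_def mfps_map.rep_eq zero_mfps.rep_eq laurent_0)
lemma extend_1: "extend_scalars 1 = 1"
  by (rule mfps_eqI) (simp add: extend_scalars_def mfps_map.rep_eq one_mfps.rep_eq laurent_0 laurent_1)
lemma extend_mult: "extend_scalars (f * g) = extend_scalars f * extend_scalars g"
  by (rule mfps_eqI) (simp add: extend_scalars_def mfps_map.rep_eq times_mfps.rep_eq laurent_sum laurent_mult case_prod_unfold)
lemma extend_uminus: "extend_scalars (- f) = - extend_scalars f"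
  by (metis extend_add extend_0 add.right_inverse add_eq_0_iff)
lemma extend_sum: "extend_scalars (\<Sum>x\<in>A. f x) = (\<Sum>x\<in>A. extend_scalars (f x))"
  by (induction A rule: infinite_finite_induct) (simp_all add: extend_0 extend_add)
lemma extend_of_nat: "extend_scalars (of_nat k) = of_nat k"
  by (induction k) (simp_all add: extend_0 extend_1 extend_add)
lemma extend_of_int: "extend_scalars (of_int k) = of_int k"
  by (cases k rule: int_cases2) (simp_all add: extend_of_nat extend_uminus)
lemma extend_tt: "extend_scalars tt = mfps_const (Poly_Mapping.single 1 1)"
  by (rule mfps_eqI) (simp add: extend_scalars_def tt_def mfps_map.rep_eq mfps_const.rep_eq laurent_0 laurent_pCons)

lemma mfps_const_mult: "mfps_const (a * b) = (mfps_const a * mfps_const b :: ('n::finite, 'c::comm_ring_1) mfps)"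
  by (rule mfps_eqI) (simp add: mfps_const_times_nth mfps_const.rep_eq)
lemma mfps_const_add: "mfps_const (a + b) = (mfps_const a + mfps_const b :: ('n::finite, 'c::comm_ring_1) mfps)"
  by (rule mfps_eqI) (simp add: mfps_const.rep_eq plus_mfps.rep_eq)
lemma mfps_const_0: "mfps_const 0 = (0 :: ('n::finite, 'c::comm_ring_1) mfps)"
  by (rule mfps_eqI) (simp add: mfps_const.rep_eq zero_mfps.rep_eq)
lemma mfps_const_1: "mfps_const 1 = (1 :: ('n::finite, 'c::comm_ring_1) mfps)"
  by (rule mfps_eqI) (simp add: mfps_const.rep_eq one_mfps.rep_eq)

section \<open>Bilinear maps on free modules\<close>

lemma module_vec: "module ((*s) :: 'c :: comm_ring_1 \<Rightarrow> ('c, 'b :: finite) vec \<Rightarrow> _)"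
  by unfold_locales (simp_all add: vec_eq_iff algebra_simps)

lemma module_ring: "module ((*) :: 'c :: comm_ring_1 \<Rightarrow> 'c \<Rightarrow> 'c)"
  by unfold_locales (simp_all add: algebra_simps)

lemma vec_hom_eqI:
  fixes f g :: "('c :: comm_ring_1, 'b :: finite) vec \<Rightarrow> 'd :: ab_group_add"
  assumes "module_hom (*s) sc f" "module_hom (*s) sc g" "\<And>a. f (axis a 1) = g (axis a 1)"
  shows "f x = g x"
proof -
  have "f x = f (\<Sum>a\<in>UNIV. (x $ a) *s axis a 1)" by (simp add: basis_expansion)
  also have "\<dots> = g (\<Sum>a\<in>UNIV. (x $ a) *s axis a 1)"
    by (simp only: module_hom.sum[OF assms(1)] module_hom.sum[OF assms(2)] module_hom.scale[OF assms(1)]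
        module_hom.scale[OF assms(2)] assms(3))
  finally show ?thesis by (simp add: basis_expansion)
qed

abbreviation "be \<equiv> bilinear_extension"

lemma be_right: "module_hom (*s) (*s) (be m x)"
  unfolding module_hom_iff
  by (auto simp: module_vec bilinear_extension_def vec_eq_iff algebra_simps sum.distrib sum_distrib_left)

lemma be_left: "module_hom (*s) (*s) (\<lambda>x. be m x y)"
  unfolding module_hom_iff
  by (auto simp: module_vec bilinear_extension_def vec_eq_iff algebra_simps sum.distrib sum_distrib_left)

lemma be_nth: "be m x y $ e = (\<Sum>a\<in>UNIV. \<Sum>b\<in>UNIV. x $ a * y $ b * m a b $ e)"
  by (simp add: bilinear_extension_def)

lemma be_nth_axis: "be m x (axis b 1) $ e = (\<Sum>a\<in>UNIV. x $ a * m a b $ e)"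
proof -
  have "x $ a * axis b 1 $ b' * m a b' $ e = (if b' = b then x $ a * m a b' $ e else 0)" for a b'
    by (simp add: axis_def)
  then show ?thesis by (simp add: be_nth)
qed

lemma be_axis: "be m (axis a 1) (axis b 1) = m a b"
proof -
  have "axis a 1 $ a' * m a' b $ e = (if a' = a then m a' b $ e else 0)" for a' e
    by (simp add: axis_def)
  then show ?thesis by (simp add: vec_eq_iff be_nth_axis)
qed

lemma hom_id: "module_hom (*s) (*s) (\<lambda>x :: ('c :: comm_ring_1, 'b :: finite) vec. x)"
  by (simp add: module_hom_iff module_vec)

lemma hom_compose: "module_hom s1 s2 f \<Longrightarrow> module_hom s2 s3 g \<Longrightarrow> module_hom s1 s3 (\<lambda>x. g (f x))"
  by (simp add: module_hom_iff)

text \<open>Both sides are linear in each argument. The restriction to basis vectors is lifted for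
  \<open>z\<close>, then \<open>y\<close>, then \<open>x\<close>.\<close>

lemma be_assocI:
  assumes "\<And>a b c. be m (m a b) (axis c 1) = be m (axis a 1) (m b c)"
  shows "be m (be m x y) z = be m x (be m y z)"
proof -
  have 1: "be m (be m (axis a 1) (axis b 1)) z = be m (axis a 1) (be m (axis b 1) z)" for a b z
    by (rule vec_hom_eqI[OF be_right hom_compose[OF be_right be_right]]) (simp add: be_axis assms)
  have 2: "be m (be m (axis a 1) y) z = be m (axis a 1) (be m y z)" for a y z
    by (rule vec_hom_eqI[OF hom_compose[OF be_right be_left] hom_compose[OF be_left be_right]]) (rule 1)
  show ?thesis
    by (rule vec_hom_eqI[OF hom_compose[OF be_left be_left] be_left]) (rule 2)
qed

lemma be_unit_left: "(\<And>b. m u b = axis b 1) \<Longrightarrow> be m (axis u 1) x = x"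
  by (rule vec_hom_eqI[OF be_right hom_id]) (simp add: be_axis)

lemma be_unit_right: "(\<And>a. m a u = axis a 1) \<Longrightarrow> be m x (axis u 1) = x"
  by (rule vec_hom_eqI[OF be_left hom_id]) (simp add: be_axis)

lemma be_comm: "(\<And>a b. m a b = m b a) \<Longrightarrow> be m x y = be m y x"
  unfolding bilinear_extension_def by (subst sum.swap) (simp add: mult.commute)

lemma extend_QH_be: "extend_QH (be m x y) = be (\<lambda>a b. extend_QH (m a b)) (extend_QH x) (extend_QH y)"
  by (simp add: vec_eq_iff extend_QH_def be_nth extend_sum extend_mult)

lemma extend_QH_axis: "extend_QH (axis a 1) = axis a 1"
  by (simp add: vec_eq_iff extend_QH_def axis_def extend_0 extend_1)

lemma sum_option: "(\<Sum>a\<in>UNIV. f a) = f None + (\<Sum>i\<in>UNIV. f (Some (i :: 'n :: finite)))"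
  unfolding UNIV_option_conv by (subst sum.insert) (auto simp: sum.reindex)

section \<open>The Frobenius algebra\<close>

locale integral_roots = irreducible_roots R \<alpha>
  for R :: "'a :: euclidean_space set" and \<alpha> :: "'n :: finite \<Rightarrow> 'a" +
  assumes integral: "integral_inner_on R"
begin

abbreviation "sb \<equiv> star_basis R \<alpha>"
definition g :: "'n \<Rightarrow> 'n \<Rightarrow> int" where "g i j = \<lfloor>gram i j\<rfloor>"
definition N :: "'n \<Rightarrow> 'n \<Rightarrow> 'a \<Rightarrow> int" where "N i j \<beta> = \<lfloor>(\<alpha> i \<bullet> \<beta>) * (\<alpha> j \<bullet> coroot \<beta>)\<rfloor>"
definition S :: "'a \<Rightarrow> 'n \<Rightarrow> int" where "S \<beta> l = (\<Sum>k\<in>UNIV. root_coords \<alpha> \<beta> k * g k l)"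
definition \<epsilon> :: int where "\<epsilon> = \<lfloor>eps R \<alpha>\<rfloor>"

lemma real_g: "real_of_int (g i j) = gram i j"
  using integral simple_in unfolding integral_inner_on_def g_def by (metis of_int_floor_cancel Ints_cases floor_of_int)
lemma real_eps: "real_of_int \<epsilon> = eps R \<alpha>"
  using eps_in_Ints[OF simple integral theta_largest] unfolding \<epsilon>_def by (metis Ints_cases floor_of_int)
lemma eps_nz: "\<epsilon> \<noteq> 0" using real_eps eps_pos by auto
lemma real_N: assumes "\<beta> \<in> P" shows "real_of_int (N i j \<beta>) = c \<beta> * (\<alpha> i \<bullet> \<beta>) * (\<alpha> j \<bullet> \<beta>)"
proof -
  have "(\<alpha> i \<bullet> \<beta>) * (\<alpha> j \<bullet> coroot \<beta>) \<in> \<int>"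
    using structure_constant_in_Ints[OF irr integral simple_in simple_in] assms P_subset by blast
  then have "real_of_int (N i j \<beta>) = (\<alpha> i \<bullet> \<beta>) * (\<alpha> j \<bullet> coroot \<beta>)" unfolding N_def by (metis Ints_cases floor_of_int)
  then show ?thesis by (simp add: coroot_def mult_ac)
qed
lemma real_b: "\<beta> \<in> P \<Longrightarrow> real_of_int (root_coords \<alpha> \<beta> i) = \<omega> i \<bullet> \<beta>"
  using coord_root P_subset by blast
lemma real_S: assumes "\<beta> \<in> P" shows "real_of_int (S \<beta> l) = \<beta> \<bullet> \<alpha> l"
  unfolding S_def inner_expand[of \<beta>] by (simp add: real_b[OF assms] real_g)

text \<open>Both sides are the summand of \<open>\<beta>\<close> in the cubic form at three simple
  roots.\<close>

lemma N_S_sym: assumes "\<beta> \<in> P" shows "N i j \<beta> * S \<beta> l = N l j \<beta> * S \<beta> i"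
proof -
  have "real_of_int (N i j \<beta> * S \<beta> l) = real_of_int (N l j \<beta> * S \<beta> i)"
    unfolding of_int_mult real_N[OF assms] real_S[OF assms] inner_commute[of \<beta> "\<alpha> _"] by (simp only: mult_ac)
  then show ?thesis by (simp only: of_int_eq_iff)
qed

lemma sb_None_right: "sb x None = axis x 1" by (cases x) auto

lemma sb_comm: "sb x y = sb y x"
proof (cases x; cases y)
  fix i j assume "x = Some i" "y = Some j"
  moreover have "\<lfloor>(\<alpha> i \<bullet> \<beta>) * (\<alpha> j \<bullet> coroot \<beta>)\<rfloor> = \<lfloor>(\<alpha> j \<bullet> \<beta>) * (\<alpha> i \<bullet> coroot \<beta>)\<rfloor>" for \<beta>
    by (simp add: coroot_def mult_ac)
  ultimately show ?thesis by (simp add: inner_commute[of "\<alpha> i" "\<alpha> j"])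
qed auto

lemma root_vec_nth: "root_vec \<alpha> \<beta> $ None = 0" "root_vec \<alpha> \<beta> $ Some k = of_int (root_coords \<alpha> \<beta> k)"
  by (simp_all add: root_vec_def axis_def if_distrib cong: if_cong)

lemma sb_nth_None: "sb (Some i) (Some j) $ None = - (tt\<^sup>2 * of_int \<epsilon> * of_int (g i j))"
  by (simp add: root_vec_nth unit_vec_def axis_def \<epsilon>_def g_def)

lemma sb_nth_Some: "sb (Some i) (Some j) $ Some k =
    (\<Sum>\<beta>\<in>P. of_int (N i j \<beta>) * of_int (root_coords \<alpha> \<beta> k) * (tt * fq \<beta>))"
  by (simp add: root_vec_nth unit_vec_def axis_def N_def mult_ac)

lemma contract:
  "(\<Sum>k\<in>UNIV. sb (Some i) (Some j) $ Some k * of_int (h k)) =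
   (\<Sum>\<beta>\<in>P. of_int (N i j \<beta> * (\<Sum>k\<in>UNIV. root_coords \<alpha> \<beta> k * h k)) * (tt * fq \<beta>))"
proof -
  have "(\<Sum>k\<in>UNIV. sb (Some i) (Some j) $ Some k * of_int (h k)) =
    (\<Sum>k\<in>UNIV. \<Sum>\<beta>\<in>P. of_int (N i j \<beta>) * of_int (root_coords \<alpha> \<beta> k) * (tt * fq \<beta>) * of_int (h k))"
    unfolding sb_nth_Some sum_distrib_right ..
  also have "\<dots> = (\<Sum>\<beta>\<in>P. \<Sum>k\<in>UNIV. of_int (N i j \<beta>) * of_int (root_coords \<alpha> \<beta> k) * (tt * fq \<beta>) * of_int (h k))"
    by (rule sum.swap)
  finally show ?thesis by (simp add: sum_distrib_left sum_distrib_right mult_ac)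
qed

lemma contract_S: "(\<Sum>k\<in>UNIV. sb (Some i) (Some j) $ Some k * of_int (g k l)) =
   (\<Sum>\<beta>\<in>P. of_int (N i j \<beta> * S \<beta> l) * (tt * fq \<beta>))"
  unfolding contract S_def ..

lemma triple_None: "be sb (sb (Some i) (Some j)) (axis (Some l) 1) $ None =
   - (tt\<^sup>2 * of_int \<epsilon>) * (\<Sum>\<beta>\<in>P. of_int (N i j \<beta> * S \<beta> l) * (tt * fq \<beta>))"
proof -
  have "be sb (sb (Some i) (Some j)) (axis (Some l) 1) $ None =
      (\<Sum>k\<in>UNIV. sb (Some i) (Some j) $ Some k * (- (tt\<^sup>2 * of_int \<epsilon> * of_int (g k l))))"
    unfolding be_nth_axis sum_option sb_nth_None[symmetric] by (simp add: axis_def)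
  also have "\<dots> = - (tt\<^sup>2 * of_int \<epsilon>) * (\<Sum>k\<in>UNIV. sb (Some i) (Some j) $ Some k * of_int (g k l))"
    by (simp add: sum_distrib_left sum_negf mult_ac del: star_basis.simps)
  finally show ?thesis unfolding contract_S .
qed

text \<open>The integer coefficient of \<open>tt\<^sup>2 * (fq \<beta> * fq \<gamma>)\<close> in
  coordinate \<open>p\<close> of the triple product, see \<open>triple_Some\<close>.\<close>

definition Q where "Q i j l p \<beta> \<gamma> = N i j \<beta> * (\<Sum>k\<in>UNIV. root_coords \<alpha> \<beta> k * N k l \<gamma>) * root_coords \<alpha> \<gamma> p"

lemma real_Q: assumes "\<beta> \<in> P" "\<gamma> \<in> P"
  shows "real_of_int (Q i j l p \<beta> \<gamma>) = c \<beta> * c \<gamma> * (\<beta> \<bullet> \<gamma>) * (\<alpha> i \<bullet> \<beta>) * (\<alpha> j \<bullet> \<beta>) * (\<alpha> l \<bullet> \<gamma>) * (\<omega> p \<bullet> \<gamma>)"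
proof -
  have "(\<Sum>k\<in>UNIV. (\<omega> k \<bullet> \<beta>) * (c \<gamma> * (\<alpha> k \<bullet> \<gamma>) * (\<alpha> l \<bullet> \<gamma>))) = c \<gamma> * (\<beta> \<bullet> \<gamma>) * (\<alpha> l \<bullet> \<gamma>)"
    unfolding inner_expand[of \<beta> \<gamma>] by (simp add: sum_distrib_left sum_distrib_right mult_ac)
  then have "(\<Sum>k\<in>UNIV. real_of_int (root_coords \<alpha> \<beta> k) * real_of_int (N k l \<gamma>)) = c \<gamma> * (\<beta> \<bullet> \<gamma>) * (\<alpha> l \<bullet> \<gamma>)"
    by (simp only: real_b[OF assms(1)] real_N[OF assms(2)])
  then show ?thesis unfolding Q_def of_int_mult of_int_sum real_N[OF assms(1)] real_b[OF assms(2)]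
    by (simp only: mult_ac)
qed

lemma triple_Some: "be sb (sb (Some i) (Some j)) (axis (Some l) 1) $ Some p =
   - (tt\<^sup>2 * of_int \<epsilon> * of_int (g i j)) * (if p = l then 1 else 0)
   + tt\<^sup>2 * (\<Sum>\<beta>\<in>P. \<Sum>\<gamma>\<in>P. of_int (Q i j l p \<beta> \<gamma>) * (fq \<beta> * fq \<gamma>))"
proof -
  let ?h = "\<lambda>k \<gamma>. N k l \<gamma>"
  have "(\<Sum>k\<in>UNIV. sb (Some i) (Some j) $ Some k * sb (Some k) (Some l) $ Some p) =
     (\<Sum>k\<in>UNIV. \<Sum>\<gamma>\<in>P. sb (Some i) (Some j) $ Some k * of_int (?h k \<gamma>) * (of_int (root_coords \<alpha> \<gamma> p) * (tt * fq \<gamma>)))"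
    unfolding sb_nth_Some[of _ l p] sum_distrib_left by (simp only: mult_ac)
  also have "\<dots> = (\<Sum>\<gamma>\<in>P. (\<Sum>k\<in>UNIV. sb (Some i) (Some j) $ Some k * of_int (?h k \<gamma>)) * (of_int (root_coords \<alpha> \<gamma> p) * (tt * fq \<gamma>)))"
    unfolding sum_distrib_right by (rule sum.swap)
  also have "\<dots> = (\<Sum>\<gamma>\<in>P. \<Sum>\<beta>\<in>P. tt\<^sup>2 * (of_int (Q i j l p \<beta> \<gamma>) * (fq \<beta> * fq \<gamma>)))"
    unfolding contract sum_distrib_right Q_def of_int_mult power2_eq_square by (simp only: mult_ac)
  also have "\<dots> = tt\<^sup>2 * (\<Sum>\<beta>\<in>P. \<Sum>\<gamma>\<in>P. of_int (Q i j l p \<beta> \<gamma>) * (fq \<beta> * fq \<gamma>))"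
    unfolding sum_distrib_left by (rule sum.swap)
  finally show ?thesis unfolding be_nth_axis sum_option sb_nth_None by (simp add: axis_def)
qed

text \<open>By commutativity this exchange is associativity on simple roots. The coordinate at 1
  follows from \<open>N_S_sym\<close>, the others from \<open>quantum_curvature\<close>.\<close>

lemma triple_sym: "be sb (sb (Some i) (Some j)) (axis (Some l) 1) = be sb (sb (Some l) (Some j)) (axis (Some i) 1)"
  unfolding vec_eq_iff
proof
  fix e show "be sb (sb (Some i) (Some j)) (axis (Some l) 1) $ e = be sb (sb (Some l) (Some j)) (axis (Some i) 1) $ e"
  proof (cases e)
    case None
    have "(\<Sum>\<beta>\<in>P. of_int (N i j \<beta> * S \<beta> l) * (tt * fq \<beta>)) = (\<Sum>\<beta>\<in>P. of_int (N l j \<beta> * S \<beta> i) * (tt * fq \<beta>))"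
      by (rule sum.cong[OF refl]) (simp only: N_S_sym)
    then show ?thesis unfolding None triple_None by simp
  next
    case (Some p)
    let ?F = "\<lambda>\<beta> \<gamma>. fq \<beta> * fq \<gamma>"
    let ?E = "\<epsilon> * (g i j * (if p = l then 1 else 0) - g l j * (if p = i then 1 else 0))"
    have "(\<Sum>\<beta>\<in>P. \<Sum>\<gamma>\<in>P. of_int (Q i j l p \<beta> \<gamma> - Q l j i p \<beta> \<gamma>) * ?F \<beta> \<gamma>) = of_int ?E"
    \<comment> \<open>The dual vector \<open>\<omega> p\<close> extracts the coefficient at
      \<open>\<alpha> p\<close>.\<close>
    proof (rule quantum_curvature[of _ "\<alpha> j" "\<omega> p" "\<alpha> i" "\<alpha> l"])
      fix \<beta> \<gamma> assume "\<beta> \<in> P" "\<gamma> \<in> P"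
      then show "real_of_int (Q i j l p \<beta> \<gamma> - Q l j i p \<beta> \<gamma>) = c \<beta> * c \<gamma> * (\<beta> \<bullet> \<gamma>) * ((\<alpha> j \<bullet> \<beta>) * (\<omega> p \<bullet> \<gamma>)) *
          ((\<alpha> i \<bullet> \<beta>) * (\<alpha> l \<bullet> \<gamma>) - (\<alpha> l \<bullet> \<beta>) * (\<alpha> i \<bullet> \<gamma>))"
        by (simp only: of_int_diff real_Q algebra_simps)
    next
      show "real_of_int ?E = eps R \<alpha> * ((gram j i) * (\<omega> p \<bullet> \<alpha> l) - (gram j l) * (\<omega> p \<bullet> \<alpha> i))"
        by (simp add: real_eps real_g dual inner_commute[of "\<alpha> j" "\<alpha> _"])
    qed
    then have eq: "(\<Sum>\<beta>\<in>P. \<Sum>\<gamma>\<in>P. of_int (Q i j l p \<beta> \<gamma>) * ?F \<beta> \<gamma>) = (\<Sum>\<beta>\<in>P. \<Sum>\<gamma>\<in>P. of_int (Q l j i p \<beta> \<gamma>) * ?F \<beta> \<gamma>) + of_int ?E"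
      by (simp add: left_diff_distrib sum_subtractf algebra_simps)
    show ?thesis unfolding Some triple_Some eq by (simp add: algebra_simps)
  qed
qed

lemma sb_assoc: "be sb (sb x y) (axis z 1) = be sb (axis x 1) (sb y z)"
proof (cases "x = None \<or> y = None \<or> z = None")
  case True
  then show ?thesis
    by (elim disjE) (simp_all add: be_axis sb_None_right be_unit_left[of sb None] be_unit_right[of sb None])
next
  case False
  then obtain i j l where s: "x = Some i" "y = Some j" "z = Some l" by auto
  have "be sb (axis x 1) (sb y z) = be sb (sb z y) (axis x 1)" using be_comm[of sb] sb_comm by metis
  then show ?thesis unfolding s using triple_sym by simp
qed

lemma star_assoc: "star R \<alpha> (star R \<alpha> x y) z = star R \<alpha> x (star R \<alpha> y z)"
  unfolding star_def by (rule be_assocI) (rule sb_assoc)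

abbreviation "sb\<^sub>Q \<equiv> \<lambda>x y. extend_QH (sb x y)"

lemma star_ext_assoc: "star_ext R \<alpha> (star_ext R \<alpha> x y) z = star_ext R \<alpha> x (star_ext R \<alpha> y z)"
  unfolding star_ext_def
proof (rule be_assocI)
  fix x y z
  show "be sb\<^sub>Q (sb\<^sub>Q x y) (axis z 1) = be sb\<^sub>Q (axis x 1) (sb\<^sub>Q y z)"
    using arg_cong[OF sb_assoc[of x y z], of extend_QH] unfolding extend_QH_be extend_QH_axis .
qed

section \<open>The pairing and the Frobenius condition\<close>

abbreviation "sing \<equiv> Poly_Mapping.single :: int \<Rightarrow> rat \<Rightarrow> _"
abbreviation "form \<equiv> pairing_ext R \<alpha>"
abbreviation "pb \<equiv> pairing_basis R \<alpha>"

lemma pb_sym: "pb x y = pb y x"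
  by (cases x; cases y) (auto simp: inner_commute)

lemma pairing_axis_right: "form x (axis b 1) = (\<Sum>e\<in>UNIV. x $ e * pb e b)"
proof -
  have "x $ e * axis b 1 $ b' * pb e b' = (if b' = b then x $ e * pb e b' else 0)" for e b'
    by (simp add: axis_def)
  then show ?thesis by (simp add: pairing_ext_def)
qed

lemma pairing_sym: "form x y = form y x"
  unfolding pairing_ext_def by (subst sum.swap) (simp add: pb_sym mult_ac)

lemma pairing_right: "module_hom (*s) (*) (form x)"
  unfolding module_hom_iff
  by (auto simp: module_vec module_ring pairing_ext_def algebra_simps sum.distrib sum_distrib_left)

lemma pairing_left: "module_hom (*s) (*) (\<lambda>x. form x y)"
  using pairing_right by (subst pairing_sym)

lemma pairing_axis: "form (axis x 1) (axis y 1) = pb x y"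
proof -
  have "axis x 1 $ e * pb e y = (if e = x then pb e y else 0)" for e by (simp add: axis_def)
  then show ?thesis by (simp add: pairing_axis_right)
qed

text \<open>The factors of the coefficient at 1 cancel against the normalisation of the pairing, so
  that \<open>\<alpha> i \<star> \<alpha> j\<close> paired with 1 gives
  \<open>gram i j\<close>.\<close>

lemma pb_NN: "extend_scalars (- (tt\<^sup>2 * of_int \<epsilon> * of_int k)) * pb None None = of_int k"
proof -
  let ?t = "mfps_const (sing 1 1) :: 'n Qcoeff"
  let ?p = "mfps_const (sing (-2) (- 1 / rat_of_int \<epsilon>)) :: 'n Qcoeff"
  have "?t * ?t * of_int \<epsilon> * ?p = mfps_const (sing 1 1 * sing 1 1 * sing 0 (of_int \<epsilon>) * sing (-2) (- 1 / rat_of_int \<epsilon>))"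
    unfolding mfps_const_mult single_of_int mfps_const_of_int ..
  also have "sing 1 1 * sing 1 1 * sing 0 (of_int \<epsilon>) * sing (-2) (- 1 / rat_of_int \<epsilon>) = sing 0 (of_int (- 1))"
    unfolding mult_single using eps_nz by simp
  also have "mfps_const \<dots> = (of_int (- 1) :: 'n Qcoeff)" unfolding single_of_int mfps_const_of_int ..
  finally have u: "?t * ?t * of_int \<epsilon> * ?p = - 1" by simp
  have "extend_scalars (- (tt\<^sup>2 * of_int \<epsilon> * of_int k)) = - (?t * ?t * of_int \<epsilon> * of_int k)"
    by (simp add: extend_uminus extend_mult extend_tt extend_of_int power2_eq_square)
  moreover have "pb None None = ?p" by (simp add: \<epsilon>_def)
  ultimately have "extend_scalars (- (tt\<^sup>2 * of_int \<epsilon> * of_int k)) * pb None None = - (?t * ?t * of_int \<epsilon> * ?p) * of_int k"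
    by (simp only: mult_minus_left mult_minus_right mult_ac)
  then show ?thesis unfolding u by simp
qed

text \<open>For three simple roots both sides are the cubic expression in \<open>mS\<close>, which
  is symmetric; if one argument is 1, the unit law and \<open>mN\<close> decide.\<close>

lemma pairing_basis_frobenius: "form (sb\<^sub>Q x y) (axis z 1) = form (axis x 1) (sb\<^sub>Q y z)"
proof -
  have r: "form (axis x 1) u = (\<Sum>e\<in>UNIV. u $ e * pb e x)" for x u
    unfolding pairing_sym[of "axis x 1"] by (rule pairing_axis_right)
  have mN: "form (sb\<^sub>Q (Some i) (Some j)) (axis None 1) = of_int (g i j)" for i j
    unfolding pairing_axis_right sum_option extend_QH_def using pb_NN[of "g i j"]
    by (simp add: sb_nth_None del: star_basis.simps)
  have mS: "form (sb\<^sub>Q (Some i) (Some j)) (axis (Some l) 1) =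
     extend_scalars (\<Sum>\<beta>\<in>P. of_int (N i j \<beta> * S \<beta> l) * (tt * fq \<beta>))" for i j l
    unfolding contract_S[symmetric] extend_sum extend_mult extend_of_int pairing_axis_right sum_option extend_QH_def
    by (simp add: g_def del: star_basis.simps)
  have N: "sb\<^sub>Q None y = axis y 1" "sb\<^sub>Q y None = axis y 1" for y by (simp_all add: sb_None_right extend_QH_axis)
  show ?thesis
  proof (cases "x = None \<or> y = None \<or> z = None")
    case True
    then consider "y = None" | "x = None" "y \<noteq> None" | "z = None" "x \<noteq> None" "y \<noteq> None" by blast
    then show ?thesis
    proof cases
      case 1
      show ?thesis unfolding 1 N by (rule refl)
    next
      case 2
      then obtain j where j: "y = Some j" by blast
      show ?thesis unfolding 2 N j
      proof (cases z)
        case None then show "form (axis (Some j) 1) (axis z 1) = form (axis None 1) (sb\<^sub>Q (Some j) z)"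
          by (simp only: N pairing_axis) simp
      next
        case (Some l) then show "form (axis (Some j) 1) (axis z 1) = form (axis None 1) (sb\<^sub>Q (Some j) z)"
          unfolding pairing_sym[of "axis None 1"] Some mN pairing_axis by (simp add: g_def)
      qed
    next
      case 3
      then obtain i j where ij: "x = Some i" "y = Some j" by blast
      show ?thesis unfolding 3(1) ij N mN pairing_axis by (simp add: g_def)
    qed
  next
    case False
    then obtain i j l where s: "x = Some i" "y = Some j" "z = Some l" by auto
    have "(\<Sum>\<beta>\<in>P. of_int (N i j \<beta> * S \<beta> l) * (tt * fq \<beta>)) = (\<Sum>\<beta>\<in>P. of_int (N l j \<beta> * S \<beta> i) * (tt * fq \<beta>))"
      by (rule sum.cong[OF refl]) (simp only: N_S_sym)
    then show ?thesis unfolding s pairing_sym[of "axis (Some i) 1"] sb_comm[of "Some j" "Some l"] mS by simp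
  qed
qed

lemma pairing_ext_frobenius: "form (star_ext R \<alpha> x y) z = form x (star_ext R \<alpha> y z)"
proof -
  have 1: "form (be sb\<^sub>Q (axis a 1) (axis b 1)) z = form (axis a 1) (be sb\<^sub>Q (axis b 1) z)" for a b z
    by (rule vec_hom_eqI[OF pairing_right hom_compose[OF be_right pairing_right]]) (simp only: be_axis pairing_basis_frobenius)
  have 2: "form (be sb\<^sub>Q (axis a 1) y) z = form (axis a 1) (be sb\<^sub>Q y z)" for a y z
    by (rule vec_hom_eqI[OF hom_compose[OF be_right pairing_left] hom_compose[OF be_left pairing_right]]) (rule 1)
  show ?thesis unfolding star_ext_def
    by (rule vec_hom_eqI[OF hom_compose[OF be_left pairing_left] pairing_left]) (rule 2)
qed

lemma pairing_frobenius: "pairing R \<alpha> (star R \<alpha> x y) z = pairing R \<alpha> x (star R \<alpha> y z)"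
  unfolding pairing_def star_def extend_QH_be using pairing_ext_frobenius unfolding star_ext_def .

text \<open>A kernel vector of the Gram matrix gives a real combination of simple roots orthogonal
  to all of them, hence 0. The inverse is taken over the rationals, whose elements are scalars of
  the coefficient ring.\<close>

lemma ex_gram_inverse: "\<exists>B :: rat^'n^'n. B ** (\<chi> i j. of_int (g i j)) = mat 1"
  unfolding matrix_left_invertible_ker
proof (intro allI impI)
  fix x :: "rat^'n" assume x: "(\<chi> i j. of_int (g i j)) *v x = 0"
  let ?v = "\<Sum>j\<in>UNIV. real_of_rat (x $ j) *\<^sub>R \<alpha> j"
  have "\<alpha> i \<bullet> ?v = 0" for i
  proof -
    have "(\<Sum>j\<in>UNIV. of_int (g i j) * x $ j) = 0" using x by (simp add: vec_eq_iff matrix_vector_mult_def)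
    then have "real_of_rat (\<Sum>j\<in>UNIV. of_int (g i j) * x $ j) = 0" by simp
    then show ?thesis by (simp add: of_rat_sum of_rat_mult real_g inner_sum_right mult_ac)
  qed
  then have v: "?v = 0" by (intro inner_simple_eqI) simp
  have "real_of_rat (x $ i) = 0" for i
  proof -
    have "\<omega> i \<bullet> ?v = real_of_rat (x $ i)" by (simp add: inner_sum_right dual if_distrib cong: if_cong)
    then show ?thesis using v by simp
  qed
  then show "x = 0" by (simp add: vec_eq_iff)
qed

definition B :: "rat^'n^'n" where "B = (SOME B. B ** (\<chi> i j. of_int (g i j)) = mat 1)"

lemma gram_inverse: "(\<Sum>k\<in>UNIV. B $ i $ k * of_int (g k j)) = (if i = j then 1 else 0)"
    "(\<Sum>k\<in>UNIV. of_int (g i k) * B $ k $ j) = (if i = j then 1 else 0)"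
proof -
  have 1: "B ** (\<chi> i j. of_int (g i j)) = mat 1" unfolding B_def using ex_gram_inverse by (rule someI_ex)
  then have 2: "(\<chi> i j. of_int (g i j)) ** B = mat 1" by (simp only: matrix_left_right_inverse)
  show "(\<Sum>k\<in>UNIV. B $ i $ k * of_int (g k j)) = (if i = j then 1 else 0)"
    using arg_cong[OF 1, of "\<lambda>M. M $ i $ j"] by (simp add: matrix_matrix_mult_def mat_def)
  show "(\<Sum>k\<in>UNIV. of_int (g i k) * B $ k $ j) = (if i = j then 1 else 0)"
    using arg_cong[OF 2, of "\<lambda>M. M $ i $ j"] by (simp add: matrix_matrix_mult_def mat_def)
qed

text \<open>The inverse of the pairing matrix; its entry at 1 is the inverse of the Laurent monomial
  used as the square of 1.\<close>

fun pinv :: "'n option \<Rightarrow> 'n option \<Rightarrow> 'n Qcoeff" where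
  "pinv None None = mfps_const (sing 2 (- rat_of_int \<epsilon>))"
| "pinv (Some i) (Some j) = mfps_const (sing 0 (B $ i $ j))"
| "pinv _ _ = 0"

lemma pinv_N: "mfps_const (sing (- 2) (- 1 / rat_of_int \<epsilon>)) * pinv None None = 1"
proof -
  have "mfps_const (sing (- 2) (- 1 / rat_of_int \<epsilon>)) * pinv None None =
    mfps_const (sing (- 2) (- 1 / rat_of_int \<epsilon>) * sing 2 (- rat_of_int \<epsilon>))"
    by (simp add: mfps_const_mult)
  also have "sing (- 2) (- 1 / rat_of_int \<epsilon>) * sing 2 (- rat_of_int \<epsilon>) = (1 :: int \<Rightarrow>\<^sub>0 rat)"
    unfolding mult_single using eps_nz by simp
  finally show ?thesis by (simp add: mfps_const_1)
qed

lemma const_of_int: "mfps_const (sing (0 :: int) (of_int k :: rat)) = (of_int k :: 'n Qcoeff)"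
  unfolding mfps_const_of_int[symmetric] single_of_int ..

lemma const_mult_rat: "mfps_const (sing (0 :: int) (x * y :: rat)) =
    (mfps_const (sing 0 x) * mfps_const (sing 0 y) :: 'n Qcoeff)"
  unfolding mfps_const_mult[symmetric] mult_single by simp

lemma const_sum_rat: "mfps_const (sing (0 :: int) (\<Sum>k\<in>A. f k :: rat)) =
    (\<Sum>k\<in>A. mfps_const (sing 0 (f k)) :: 'n Qcoeff)"
  by (induction A rule: infinite_finite_induct) (simp_all add: mfps_const_0 mfps_const_add single_add)

lemma pinv_left: "(\<Sum>y\<in>UNIV. pinv x y * pb y z) = (if x = z then 1 else 0)"
proof (cases x; cases z)
  assume "x = None" "z = None"
  then show ?thesis using pinv_N by (simp add: sum_option \<epsilon>_def mult.commute)
next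
  fix i j assume ij: "x = Some i" "z = Some j"
  have "(\<Sum>y\<in>UNIV. pinv x y * pb y z) = (\<Sum>k\<in>UNIV. mfps_const (sing 0 (B $ i $ k * of_int (g k j))))"
    unfolding ij const_mult_rat const_of_int by (simp add: sum_option g_def)
  also have "\<dots> = mfps_const (sing 0 (if i = j then 1 else 0))"
    unfolding const_sum_rat[symmetric] gram_inverse ..
  also have "\<dots> = (if x = z then 1 else 0)" unfolding ij by (simp add: mfps_const_0 mfps_const_1)
  finally show ?thesis .
qed (simp_all add: sum_option)

lemma pinv_right: "(\<Sum>y\<in>UNIV. pb x y * pinv y z) = (if x = z then 1 else 0)"
proof (cases x; cases z)
  assume "x = None" "z = None"
  then show ?thesis using pinv_N by (simp add: sum_option \<epsilon>_def)
next
  fix i j assume ij: "x = Some i" "z = Some j"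
  have "(\<Sum>y\<in>UNIV. pb x y * pinv y z) = (\<Sum>k\<in>UNIV. mfps_const (sing 0 (of_int (g i k) * B $ k $ j)))"
    unfolding ij const_mult_rat const_of_int by (simp add: sum_option g_def)
  also have "\<dots> = mfps_const (sing 0 (if i = j then 1 else 0))"
    unfolding const_sum_rat[symmetric] gram_inverse ..
  also have "\<dots> = (if x = z then 1 else 0)" unfolding ij by (simp add: mfps_const_0 mfps_const_1)
  finally show ?thesis .
qed (simp_all add: sum_option)

text \<open>The values of \<open>f\<close> on the basis, multiplied by the inverse matrix, give the
  representing vector by \<open>pinv_left\<close>; \<open>pinv_right\<close> recovers any vector
  from its pairings, whence uniqueness.\<close>

lemma perfect:
  assumes "module_hom (*s) (*) f" shows "\<exists>!x. \<forall>y. form x y = f y"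
proof
  define x where "x = (\<chi> e. \<Sum>y\<in>UNIV. f (axis y 1) * pinv y e)"
  have ax: "form x (axis z 1) = f (axis z 1)" for z
  proof -
    have "form x (axis z 1) = (\<Sum>e\<in>UNIV. \<Sum>y\<in>UNIV. f (axis y 1) * (pinv y e * pb e z))"
      unfolding pairing_axis_right x_def by (simp add: sum_distrib_right mult.assoc)
    also have "\<dots> = (\<Sum>y\<in>UNIV. f (axis y 1) * (\<Sum>e\<in>UNIV. pinv y e * pb e z))"
      unfolding sum_distrib_left by (rule sum.swap)
    also have "\<dots> = (\<Sum>y\<in>UNIV. if y = z then f (axis y 1) else 0)"
      unfolding pinv_left by (intro sum.cong) auto
    finally show ?thesis by simp
  qed
  show "\<forall>y. form x y = f y" using vec_hom_eqI[OF pairing_right assms ax] by blast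
  fix x' assume x': "\<forall>y. form x' y = f y"
  have expand: "u $ e = (\<Sum>z\<in>UNIV. form u (axis z 1) * pinv z e)" for u e
  proof -
    have "(\<Sum>z\<in>UNIV. form u (axis z 1) * pinv z e) = (\<Sum>z\<in>UNIV. \<Sum>y\<in>UNIV. u $ y * (pb y z * pinv z e))"
      unfolding pairing_axis_right by (simp add: sum_distrib_right mult.assoc)
    also have "\<dots> = (\<Sum>y\<in>UNIV. u $ y * (\<Sum>z\<in>UNIV. pb y z * pinv z e))"
      unfolding sum_distrib_left by (rule sum.swap)
    also have "\<dots> = (\<Sum>y\<in>UNIV. if y = e then u $ y else 0)"
      unfolding pinv_right by (intro sum.cong) auto
    finally show ?thesis by simp
  qed
  show "x' = x" unfolding vec_eq_iff
  proof
    fix e show "x' $ e = x $ e" unfolding expand[of x'] expand[of x] using x' ax by simp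
  qed
qed

lemma frobenius: "frobenius_algebra (*s) (star_ext R \<alpha>) unit_vec (pairing_ext R \<alpha>)"
proof -
  have axis_inj: "axis a 1 = (axis b 1 :: 'n QH_ext) \<longleftrightarrow> a = b" for a b
    by (simp add: axis_eq_axis)
  have un: "sb\<^sub>Q None y = axis y 1" "sb\<^sub>Q y None = axis y 1" for y by (simp_all add: sb_None_right extend_QH_axis)
  show ?thesis
  proof (intro frobenius_algebra.intro frobenius_algebra_axioms.intro)
    show "module ((*s) :: 'n Qcoeff \<Rightarrow> 'n QH_ext \<Rightarrow> 'n QH_ext)" by (rule module_vec)
  next
    fix x y z :: "'n QH_ext"
    show "module_hom (*s) (*s) (star_ext R \<alpha> x)" unfolding star_ext_def by (rule be_right)
    show "module_hom (*s) (*s) (\<lambda>x. star_ext R \<alpha> x y)" unfolding star_ext_def by (rule be_left)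
    show "star_ext R \<alpha> (star_ext R \<alpha> x y) z = star_ext R \<alpha> x (star_ext R \<alpha> y z)" by (rule star_ext_assoc)
    show "star_ext R \<alpha> unit_vec x = x" unfolding star_ext_def unit_vec_def by (rule be_unit_left) (rule un)
    show "star_ext R \<alpha> x unit_vec = x" unfolding star_ext_def unit_vec_def by (rule be_unit_right) (rule un)
    show "module_hom (*s) (*) (form x)" by (rule pairing_right)
    show "module_hom (*s) (*) (\<lambda>x. form x y)" by (rule pairing_left)
    show "form (star_ext R \<alpha> x y) z = form x (star_ext R \<alpha> y z)" by (rule pairing_ext_frobenius)
    show "\<exists>E \<phi>. finite E \<and> (\<forall>e\<in>E. module_hom (*s) (*) (\<phi> e)) \<and> (\<forall>x :: 'n QH_ext. x = (\<Sum>e\<in>E. \<phi> e x *s e))"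
    proof (intro exI conjI ballI allI)
      let ?ax = "\<lambda>a. axis a 1 :: 'n QH_ext"
      \<comment> \<open>The coordinate functionals, indexed by basis vectors; the description
        recovers the index, as \<open>axis\<close> is injective.\<close>
      let ?\<phi> = "\<lambda>e x. x $ (THE a. e = ?ax a)"
      show "finite (range ?ax)" by simp
      show "module_hom (*s) (*) (?\<phi> e)" for e by (simp add: module_hom_iff module_vec module_ring)
      fix x :: "'n QH_ext"
      have "(\<Sum>e\<in>range ?ax. ?\<phi> e x *s e) = (\<Sum>a\<in>UNIV. x $ a *s ?ax a)"
        by (subst sum.reindex) (auto simp: inj_on_def axis_inj)
      then show "x = (\<Sum>e\<in>range ?ax. ?\<phi> e x *s e)" by (simp add: basis_expansion)
    qed
  next
    fix f :: "'n QH_ext \<Rightarrow> 'n Qcoeff" assume f: "module_hom (*s) (*) f"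
    show "\<exists>!x. \<forall>y. form x y = f y" by (rule perfect[OF f])
    then show "\<exists>!y. \<forall>x. form x y = f x" by (subst pairing_sym)
  qed
qed

end

theorem theorem6:
  fixes R :: "'a :: euclidean_space set" and \<alpha> :: "'n :: finite \<Rightarrow> 'a"
  assumes "irreducible_root_system R" and "integral_inner_on R" and "simple_roots R \<alpha>"
  shows "(\<forall>x y z. star R \<alpha> (star R \<alpha> x y) z = star R \<alpha> x (star R \<alpha> y z)) \<and>
         (\<forall>x y z. pairing R \<alpha> (star R \<alpha> x y) z = pairing R \<alpha> x (star R \<alpha> y z)) \<and>
         frobenius_algebra (*s) (star_ext R \<alpha>) unit_vec (pairing_ext R \<alpha>)"
proof -
  interpret integral_roots R \<alpha>
    using assms by unfold_locales
  show ?thesis using star_assoc pairing_frobenius frobenius by blast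
qed

end
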